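(* Let $n\geq 2$ and let $f\in L^2(\mathbb{R}^n)$ be $O(n)$-finite and an eigenfunction of the Fourier transform. Then there exists a positive constant $C$, independent of $a$, such that for every $0<a<1$ for which $$K_a(f) = \int_{\mathbb{R}^n}\int_{\mathbb{R}^n} |f(x)|\,|\hat f(y)|\, e^{a|x\cdot y|}\,dx\,dy < \infty,$$ and for all $\alpha\in\mathbb{N}^n$, $$|(f,\Phi_\alpha)| \leq C (K_a(f))^{1/2} \left(\prod_{j=1}^n (2\alpha_j+1)^{1/4}\right) e^{-(2|\alpha|+n)t/2},$$ where $t>0$ is determined by the condition $a=\tanh(2t)$.
   Context: The Fourier transform is $\hat f(y) = (2\pi)^{-n/2}\int_{\mathbb{R}^n} f(x) e^{-i x\cdot y}\,dx$, extended to $L^2(\mathbb{R}^n)$ as usual. A function $f$ on $\mathbb{R}^n$ is $O(n)$-finite if the linear span of its rotates $x\mapsto f(kx)$, $k\in O(n)$, is finite dimensional. $\mathbb{N}=\{0,1,2,\ldots\}$ and $|\alpha|=\alpha_1+\cdots+\alpha_n$ for $\alpha\in\mathbb{N}^n$. $\Phi_\alpha$ are the normalised Hermite functions on $\mathbb{R}^n$: $\Phi_\alpha(x)=\prod_{j=1}^n h_{\alpha_j}(x_j)$, where $h_k(s) = (2^k k!\sqrt{\pi})^{-1/2} H_k(s) e^{-s^2/2}$ and $H_k(s) = (-1)^k e^{s^2}\frac{d^k}{ds^k}e^{-s^2}$. $(f,\Phi_\alpha)=\int_{\mathbb{R}^n} f(x)\Phi_\alpha(x)\,dx$. *)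

theory Defs
  imports "HOL-Analysis.Analysis"
begin

text \<open>
  Elements of \<open>L\<^sup>2(\<real>\<^sup>n)\<close> are represented by complex-valued Lebesgue measurable functions;
  equality in \<open>L\<^sup>2\<close> is equality almost everywhere.
\<close>

definition L2 :: "((real ^ 'n) \<Rightarrow> complex) set" where
  "L2 = {f. f \<in> borel_measurable lebesgue \<and> integrable lebesgue (\<lambda>x. (norm (f x))\<^sup>2)}"

definition fourier_L1 :: "((real ^ 'n) \<Rightarrow> complex) \<Rightarrow> (real ^ 'n) \<Rightarrow> complex" where
  "fourier_L1 f y =
     complex_of_real ((2 * pi) powr (- real CARD('n) / 2)) *
     (LINT x|lebesgue. f x * exp (- \<i> * complex_of_real (x \<bullet> y)))"

definition L2_tendsto ::
    "(nat \<Rightarrow> (real ^ 'n) \<Rightarrow> complex) \<Rightarrow> ((real ^ 'n) \<Rightarrow> complex) \<Rightarrow> bool" where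
  "L2_tendsto F f \<longleftrightarrow>
     (\<lambda>m. \<integral>\<^sup>+x. ennreal ((norm (F m x - f x))\<^sup>2) \<partial>lebesgue) \<longlonglongrightarrow> 0"

text \<open>
  The Fourier transform on \<open>L\<^sup>2\<close> is the continuous extension of the integral formula from
  \<open>L\<^sup>1 \<inter> L\<^sup>2\<close>. It is determined only almost everywhere, so it is given as a relation between
  representatives: \<open>g\<close> represents the Fourier transform of \<open>f\<close>.
\<close>

definition has_fourier_L2 ::
    "((real ^ 'n) \<Rightarrow> complex) \<Rightarrow> ((real ^ 'n) \<Rightarrow> complex) \<Rightarrow> bool" where
  "has_fourier_L2 f g \<longleftrightarrow>
     f \<in> L2 \<and> g \<in> L2 \<and>
     (\<exists>F. (\<forall>m. F m \<in> L2 \<and> integrable lebesgue (F m)) \<and>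
          L2_tendsto F f \<and> L2_tendsto (\<lambda>m. fourier_L1 (F m)) g)"

definition fourier_eigenfunction :: "((real ^ 'n) \<Rightarrow> complex) \<Rightarrow> bool" where
  "fourier_eigenfunction f \<longleftrightarrow>
     \<not> (AE x in lebesgue. f x = 0) \<and> (\<exists>c. has_fourier_L2 f (\<lambda>x. c * f x))"

definition rotate_span :: "((real ^ 'n) \<Rightarrow> complex) \<Rightarrow> ((real ^ 'n) \<Rightarrow> complex) set" where
  "rotate_span f =
     {(\<lambda>x. \<Sum>k\<in>K. c k * f (k x)) | K c. finite K \<and> (\<forall>k\<in>K. orthogonal_transformation k)}"

text \<open>
  Finite dimensionality of the span of the rotates is that of its image in \<open>L\<^sup>2\<close>, that is,
  modulo almost everywhere equality.
\<close>

definition O_finite :: "((real ^ 'n) \<Rightarrow> complex) \<Rightarrow> bool" where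
  "O_finite f \<longleftrightarrow>
     (\<exists>B. finite B \<and> B \<subseteq> rotate_span f \<and>
          (\<forall>g\<in>rotate_span f. \<exists>c. AE x in lebesgue. g x = (\<Sum>b\<in>B. c b * b x)))"

definition hermite_poly :: "nat \<Rightarrow> real \<Rightarrow> real" where
  "hermite_poly k s = (- 1) ^ k * exp (s\<^sup>2) * (deriv ^^ k) (\<lambda>u. exp (- u\<^sup>2)) s"

definition hermite_fun :: "nat \<Rightarrow> real \<Rightarrow> real" where
  "hermite_fun k s =
     (2 ^ k * fact k * sqrt pi) powr (- 1 / 2) * hermite_poly k s * exp (- s\<^sup>2 / 2)"

definition hermite_Phi :: "('n \<Rightarrow> nat) \<Rightarrow> (real ^ 'n) \<Rightarrow> real" where
  "hermite_Phi \<alpha> x = (\<Prod>j\<in>UNIV. hermite_fun (\<alpha> j) (x $ j))"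

definition hermite_coeff :: "((real ^ 'n) \<Rightarrow> complex) \<Rightarrow> ('n \<Rightarrow> nat) \<Rightarrow> complex" where
  "hermite_coeff f \<alpha> = (LINT x|lebesgue. f x * complex_of_real (hermite_Phi \<alpha> x))"

text \<open>\<open>g\<close> stands for a representative of the Fourier transform of \<open>f\<close>.\<close>

definition K_int ::
    "real \<Rightarrow> ((real ^ 'n) \<Rightarrow> complex) \<Rightarrow> ((real ^ 'n) \<Rightarrow> complex) \<Rightarrow> ennreal" where
  "K_int a f g =
     (\<integral>\<^sup>+x. (\<integral>\<^sup>+y. ennreal (norm (f x) * norm (g y) * exp (a * \<bar>x \<bullet> y\<bar>)) \<partial>lebesgue) \<partial>lebesgue)"

end

theory Submission
  imports Defs "HOL-Complex_Analysis.Complex_Analysis" "HOL-Probability.Distributions"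
begin

text \<open>
  Write \<open>c\<^sub>\<alpha>\<close> for the Hermite coefficients of \<open>f\<close>, and let the Fourier transform of \<open>f\<close> be \<open>c f\<close>.
  The proof derives the decay of \<open>c\<^sub>\<alpha>\<close> from bounds for \<open>\<Sum>\<^sub>\<alpha> \<rho>\<^sup>\<alpha> |c\<^sub>\<alpha>|\<^sup>2\<close> with weights \<open>\<rho>\<^sub>j\<close> that
  may exceed 1.

  For small weights, Mehler's formula (\<open>mehler_formula\<close>) says that \<open>\<Sum>\<^sub>\<alpha> \<rho>\<^sup>\<alpha> \<Phi>\<^sub>\<alpha>(x) \<Phi>\<^sub>\<alpha>(y)\<close> is a
  Gaussian kernel \<open>M\<^sub>\<rho>(x, y)\<close>, so the sum above is the quadratic form of \<open>M\<^sub>\<rho>\<close> at \<open>f\<close>. The Fourier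
  transform multiplies \<open>\<Phi>\<^sub>\<alpha>\<close> by \<open>(-i)\<close> to the power \<open>|\<alpha>|\<close>, hence \<open>M\<^sub>\<rho>\<close> is, in one variable, the transform of
  the kernel \<open>N\<^sub>\<rho> = M\<^sub>i\<^sub>\<rho>\<close>. Moving the transform over to \<open>f\<close> gives \<open>small_weight_identity\<close>: the sum
  equals \<open>c\<close> times the form of \<open>N\<^sub>\<rho>\<close>. In contrast to \<open>M\<^sub>\<rho>\<close>, the kernel \<open>N\<^sub>\<rho>\<close> has no singularity at
  \<open>\<rho> = 1\<close>: for \<open>\<rho> = e\<^sup>2\<^sup>s\<close> its modulus is a multiple of \<open>exp (tanh (2s) (x\<^sup>2 + y\<^sup>2) / 2)\<close>.

  If \<open>c\<close> is not 0, finiteness of \<open>K\<^sub>a\<close> forces \<open>f(x) exp (b |x|\<^sup>2 / 2)\<close> to be integrable for every \<open>b < a\<close>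
  (\<open>weighted_integrable_of_double_integral\<close>). So the form of \<open>N\<^sub>\<rho>\<close> is holomorphic in a scaling
  parameter of \<open>\<rho>\<close> as long as \<open>tanh (2s\<^sub>j) < a\<close>. The series has nonnegative coefficients, and by the
  Vivanti-Pringsheim theorem (\<open>pringsheim_continuation\<close>) it converges to the form wherever the form
  continues holomorphically along the positive axis. Keeping a single term yields
  \<open>weighted_hermite_coeff_le_form\<close>.

  It remains to bound the form of \<open>N\<^sub>\<rho>\<close> by \<open>K\<^sub>a\<close>, whose kernel \<open>exp (a |x \<bullet> y|)\<close> is much smaller than
  \<open>|N\<^sub>\<rho>|\<close> when \<open>x\<close> and \<open>y\<close> are nearly orthogonal. The oscillation of \<open>N\<^sub>\<rho>\<close> is essential here. Write
  \<open>N\<^sub>\<rho>(x, y) = const * \<integral> P(x, v) P(y, v) dv\<close> with complex Gaussians \<open>P\<close>. The form becomes a bilinear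
  pairing of the transforms of \<open>f\<close> and of its conjugate by \<open>P\<close>, and the \<open>L\<^sup>2\<close> norms of those involve
  only \<open>\<integral> P(x, v) cnj (P(y, v)) dv\<close>. The parameters of \<open>P\<close> can be chosen so that the modulus of this
  integral is at most a multiple of \<open>exp (b (x \<bullet> y))\<close> (\<open>chirp_kernel_hermitian_product\<close>,
  \<open>rotated_form_bound\<close>).

  The price is a constant that blows up as \<open>tanh (2s\<^sub>j)\<close> approaches \<open>b\<close>. Taking \<open>s\<^sub>j\<close> below its limit by
  \<open>1 / (4 (2\<alpha>\<^sub>j + 1))\<close> costs only a constant in \<open>\<rho>\<^sup>\<alpha>\<close> and a factor \<open>(2\<alpha>\<^sub>j + 1)\<^sup>1\<^sup>/\<^sup>2\<close> in the form
  (\<open>chirp_factor_bound\<close>), which becomes the exponent \<open>1/4\<close> after a square root.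

  If \<open>c = 0\<close>, then \<open>K\<^sub>a\<close> vanishes too, but so do all Hermite coefficients, by the same identity for
  small weights. Double integrals are taken for Borel representatives \<open>f'\<close> of \<open>f\<close>, for which Fubini's
  theorem on the product of two Borel measures applies.
\<close>

section \<open>Holomorphic parameter integrals and nonnegative power series\<close>

(* The symbol $ denotes vector components throughout, not coefficients of power series. *)
unbundle no fps_syntax

text \<open>
  The majorant need only be local in the parameter. Cauchy's inequality on a smaller disc turns it into
  a majorant of the difference quotients, and dominated convergence differentiates under the integral.
\<close>

lemma holomorphic_on_integral:
  fixes h :: "complex \<Rightarrow> 'a \<Rightarrow> complex"
  assumes hol: "\<And>x. x \<in> space M \<Longrightarrow> (\<lambda>w. h w x) holomorphic_on S"
    and meas: "\<And>w. w \<in> S \<Longrightarrow> h w \<in> borel_measurable M"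
    and dom: "\<And>w. w \<in> S \<Longrightarrow> \<exists>r>0. \<exists>G. integrable M G \<and> ball w r \<subseteq> S \<and>
                (\<forall>z\<in>ball w r. \<forall>x\<in>space M. norm (h z x) \<le> G x)"
  shows "(\<lambda>w. LINT x|M. h w x) holomorphic_on S"
proof (rule holomorphic_onI)
  fix w assume "w \<in> S"
  then obtain r G where r: "r > 0" and G: "integrable M G" and sub: "ball w r \<subseteq> S"
    and bd: "\<And>z x. z \<in> ball w r \<Longrightarrow> x \<in> space M \<Longrightarrow> norm (h z x) \<le> G x"
    using dom by metis
  have Gnn: "G x \<ge> 0" if "x \<in> space M" for x
    using order_trans[OF norm_ge_zero bd[of w x]] that r by auto
  have int: "integrable M (h z)" if "z \<in> ball w r" for z
    using that sub bd Gnn by (intro Bochner_Integration.integrable_bound[OF G meas] AE_I2) force+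
  have lip: "norm (h z x - h w x) \<le> 4 / r * G x * norm (z - w)"
    if z: "z \<in> ball w (r/2)" and x: "x \<in> space M" for z x
  proof (rule field_differentiable_bound[where S = "ball w (r/2)" and f' = "deriv (\<lambda>w. h w x)"])
    show "convex (ball w (r/2))" by simp
    show "z \<in> ball w (r/2)" "w \<in> ball w (r/2)" using z r by auto
    fix u assume u: "u \<in> ball w (r/2)"
    have hu: "(\<lambda>w. h w x) holomorphic_on ball w r"
      using hol[OF x] sub holomorphic_on_subset by blast
    have "u \<in> ball w r" using u r by auto
    then have "((\<lambda>w. h w x) has_field_derivative deriv (\<lambda>w. h w x) u) (at u)"
      using holomorphic_derivI[OF hu open_ball] by auto
    then show "((\<lambda>w. h w x) has_field_derivative deriv (\<lambda>w. h w x) u) (at u within ball w (r/2))"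
      by (rule has_field_derivative_at_within)
    have sb: "cball u (r/4) \<subseteq> ball w r"
    proof
      fix v assume "v \<in> cball u (r/4)"
      then have "dist w v < r" using u dist_triangle[of w v u] r by simp
      then show "v \<in> ball w r" by simp
    qed
    have "norm ((deriv ^^ 1) (\<lambda>w. h w x) u) \<le> fact 1 * G x / (r/4) ^ 1"
    proof (rule Cauchy_inequality)
      show "(\<lambda>w. h w x) holomorphic_on ball u (r/4)"
        using hu sb holomorphic_on_subset ball_subset_cball by blast
      show "continuous_on (cball u (r/4)) (\<lambda>w. h w x)"
        using hu sb holomorphic_on_imp_continuous_on holomorphic_on_subset by blast
      show "0 < r/4" using r by simp
      fix v assume "cmod (u - v) = r/4"
      then have "v \<in> cball u (r/4)" by (simp add: dist_norm)
      then show "norm (h v x) \<le> G x" using sb bd[OF _ x] by blast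
    qed
    then show "norm (deriv (\<lambda>w. h w x) u) \<le> 4 / r * G x" by (simp add: field_simps)
  qed
  define h' where "h' x = deriv (\<lambda>w. h w x) w" for x
  have der: "((\<lambda>w. h w x) has_field_derivative h' x) (at w)" if "x \<in> space M" for x
    unfolding h'_def using holomorphic_derivI[OF _ open_ball, of "\<lambda>w. h w x" w r w]
      holomorphic_on_subset[OF hol[OF that] sub] r by auto
  have "((\<lambda>w. LINT x|M. h w x) has_field_derivative (LINT x|M. h' x)) (at w)"
    unfolding has_field_derivative_iff tendsto_at_iff_sequentially o_def
  proof (intro allI impI)
    fix X :: "nat \<Rightarrow> complex" assume X: "\<forall>i. X i \<in> UNIV - {w}" "X \<longlonglongrightarrow> w"
    obtain N where N: "\<And>i. i \<ge> N \<Longrightarrow> X i \<in> ball w (r/2)"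
      using X(2) r unfolding lim_sequentially by (metis dist_commute half_gt_zero mem_ball)
    define Y where "Y i = X (i + N)" for i
    have Y: "Y i \<in> ball w (r/2)" "Y i \<in> ball w r" "Y i \<noteq> w" for i
      using N[of "i+N"] X(1) r unfolding Y_def by auto
    have Ylim: "Y \<longlonglongrightarrow> w" unfolding Y_def using X(2) by (rule LIMSEQ_ignore_initial_segment)
    have pt: "(\<lambda>i. (h (Y i) x - h w x) / (Y i - w)) \<longlonglongrightarrow> h' x" if "x \<in> space M" for x
      using der[OF that, unfolded has_field_derivative_iff tendsto_at_iff_sequentially o_def] Y(3) Ylim
      by blast
    have wb: "w \<in> ball w r" using r by simp
    have m: "(\<lambda>x. (h (Y i) x - h w x) / (Y i - w)) \<in> borel_measurable M" for i
      using int[OF Y(2)] int[OF wb] by measurable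
    have "(\<lambda>i. LINT x|M. (h (Y i) x - h w x) / (Y i - w)) \<longlonglongrightarrow> (LINT x|M. h' x)"
    proof (rule integral_dominated_convergence)
      show "integrable M (\<lambda>x. 4 / r * G x)" using G by simp
      show "h' \<in> borel_measurable M" using m pt by (rule borel_measurable_LIMSEQ_metric)
      show "AE x in M. (\<lambda>i. (h (Y i) x - h w x) / (Y i - w)) \<longlonglongrightarrow> h' x" using pt by auto
      show "AE x in M. norm ((h (Y i) x - h w x) / (Y i - w)) \<le> 4 / r * G x" for i
        using lip[OF Y(1)] Y(3)[of i] by (intro AE_I2) (simp add: norm_divide divide_le_eq)
    qed (rule m)
    also have "(\<lambda>i. LINT x|M. (h (Y i) x - h w x) / (Y i - w)) =
       (\<lambda>i. ((LINT x|M. h (Y i) x) - (LINT x|M. h w x)) / (Y i - w))"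
      using int[OF Y(2)] int[OF wb] by (simp add: Bochner_Integration.integral_diff)
    finally show "(\<lambda>i. ((LINT x|M. h (X i) x) - (LINT x|M. h w x)) / (X i - w)) \<longlonglongrightarrow> (LINT x|M. h' x)"
      unfolding Y_def by (rule LIMSEQ_offset)
  qed
  then show "(\<lambda>w. LINT x|M. h w x) field_differentiable at w within S"
    using field_differentiable_at_within field_differentiable_def by blast
qed

text \<open>
  The identity theorem needs agreement only on a set that accumulates in \<open>S\<close>; a one-sided interval does,
  at its left end point. In this form it applies at the boundary point \<open>0\<close> of an interval of positive
  weights as well as to integrals evaluated for real parameters.
\<close>

lemma analytic_continuation_from_reals:
  assumes S: "open S" "connected S" and f: "f holomorphic_on S" and g: "g holomorphic_on S"
    and x0: "complex_of_real x0 \<in> S" and \<delta>: "\<delta> > 0"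
    and eq: "\<And>y. x0 < y \<Longrightarrow> y < x0 + \<delta> \<Longrightarrow> complex_of_real y \<in> S \<Longrightarrow> f (of_real y) = g (of_real y)"
    and z: "z \<in> S"
  shows "f z = g z"
proof -
  let ?U = "complex_of_real ` {x0<..<x0 + \<delta>} \<inter> S"
  have "complex_of_real x0 islimpt ?U"
    unfolding islimpt_def
  proof (intro allI impI)
    fix T :: "complex set" assume T: "complex_of_real x0 \<in> T" "open T"
    then obtain e where e: "e > 0" "ball (complex_of_real x0) e \<subseteq> S \<inter> T"
      using openE[of "S \<inter> T" "complex_of_real x0"] S(1) x0 by auto
    define y where "y = x0 + min e \<delta> / 2"
    have "dist (complex_of_real x0) (complex_of_real y) = min e \<delta> / 2"
      using e(1) \<delta> unfolding y_def dist_norm by (simp flip: of_real_diff)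
    then have "complex_of_real y \<in> S \<inter> T" using e \<delta> by auto
    moreover have "x0 < y" "y < x0 + \<delta>" using e(1) \<delta> unfolding y_def by auto
    ultimately show "\<exists>y\<in>?U. y \<in> T \<and> y \<noteq> complex_of_real x0"
      by (intro bexI[of _ "complex_of_real y"]) auto
  qed
  moreover have "(\<lambda>z. f z - g z) holomorphic_on S" using f g by (intro holomorphic_intros)
  moreover have "f u - g u = 0" if "u \<in> ?U" for u using eq that by auto
  ultimately have "f z - g z = 0"
    using analytic_continuation[of "\<lambda>z. f z - g z" S ?U "complex_of_real x0"] S x0 z by blast
  then show ?thesis by simp
qed

text \<open>
  The point of this class is that it is closed under differentiation, so all derivatives at points of
  \<open>[0, R)\<close> are nonnegative reals.
\<close>

definition nonneg_power_series_on_ball :: "real \<Rightarrow> (complex \<Rightarrow> complex) \<Rightarrow> bool" where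
  "nonneg_power_series_on_ball R \<phi> \<longleftrightarrow>
     (\<exists>B. (\<forall>k. 0 \<le> B k) \<and> (\<forall>w. norm w < R \<longrightarrow> (\<lambda>k. complex_of_real (B k) * w ^ k) sums \<phi> w))"

lemma nonneg_power_series_on_ball_deriv:
  assumes "nonneg_power_series_on_ball R \<phi>"
  shows "nonneg_power_series_on_ball R (deriv \<phi>)"
proof -
  obtain B where B: "\<And>k. 0 \<le> B k"
    and s: "\<And>w. norm w < R \<Longrightarrow> (\<lambda>k. complex_of_real (B k) * w ^ k) sums \<phi> w"
    using assms unfolding nonneg_power_series_on_ball_def by auto
  let ?c = "\<lambda>k. complex_of_real (B k)"
  have "diffs ?c = (\<lambda>k. complex_of_real (real (Suc k) * B (Suc k)))"
    by (simp add: diffs_def fun_eq_iff)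
  moreover have "(\<lambda>k. diffs ?c k * w ^ k) sums deriv \<phi> w" if w: "norm w < R" for w
  proof -
    have "((\<lambda>z. \<Sum>n. ?c n * z ^ n) has_field_derivative (\<Sum>n. diffs ?c n * w ^ n)) (at w)"
      using s w by (intro termdiffs_strong'[where K = R]) (auto simp: sums_iff)
    then have "(\<phi> has_field_derivative (\<Sum>n. diffs ?c n * w ^ n)) (at w)"
    proof (rule has_field_derivative_transform_within_open)
      show "open (ball 0 R :: complex set)" "w \<in> ball 0 R" using w by auto
      show "(\<Sum>n. ?c n * z ^ n) = \<phi> z" if "z \<in> ball 0 R" for z
        using s[of z] that by (auto simp: sums_iff)
    qed
    then have "deriv \<phi> w = (\<Sum>n. diffs ?c n * w ^ n)" by (rule DERIV_imp_deriv)
    moreover have "summable (\<lambda>n. diffs ?c n * w ^ n)"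
      using s w by (intro termdiff_converges[where K = R]) (auto simp: sums_iff)
    ultimately show ?thesis by (simp add: sums_iff)
  qed
  ultimately show ?thesis using B unfolding nonneg_power_series_on_ball_def
    by (intro exI[of _ "\<lambda>k. real (Suc k) * B (Suc k)"]) auto
qed

lemma nonneg_power_series_higher_deriv_nonneg:
  assumes "nonneg_power_series_on_ball R \<phi>" "0 \<le> x" "x < R"
  shows "\<exists>d\<ge>0. (deriv ^^ m) \<phi> (of_real x) = complex_of_real d"
proof -
  have "nonneg_power_series_on_ball R ((deriv ^^ m) \<phi>)"
  proof (induction m)
    case 0
    show ?case using assms(1) by simp
  next
    case (Suc m)
    show ?case using nonneg_power_series_on_ball_deriv[OF Suc] by simp
  qed
  then obtain B where B: "\<And>k. 0 \<le> B k"
    and s0: "\<And>w. norm w < R \<Longrightarrow> (\<lambda>k. complex_of_real (B k) * w ^ k) sums (deriv ^^ m) \<phi> w"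
    unfolding nonneg_power_series_on_ball_def by auto
  have s: "(\<lambda>k. complex_of_real (B k) * of_real x ^ k) sums (deriv ^^ m) \<phi> (of_real x)"
    using assms by (intro s0) simp
  then have s': "(\<lambda>k. complex_of_real (B k * x ^ k)) sums (deriv ^^ m) \<phi> (of_real x)" by simp
  have "summable (\<lambda>k. B k * x ^ k)"
    using sums_summable[OF s'] by (simp only: summable_complex_of_real)
  then have "(\<lambda>k. complex_of_real (B k * x ^ k)) sums complex_of_real (\<Sum>k. B k * x ^ k)"
    by (simp only: sums_of_real_iff summable_sums)
  then have "(deriv ^^ m) \<phi> (of_real x) = complex_of_real (\<Sum>k. B k * x ^ k)"
    using s' sums_unique2 by blast
  moreover have "(\<Sum>k. B k * x ^ k) \<ge> 0"
    using B assms(2) \<open>summable _\<close> by (intro suminf_nonneg) auto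
  ultimately show ?thesis by blast
qed

text \<open>
  This is the Vivanti-Pringsheim theorem: a power series with nonnegative coefficients is singular at the
  positive point of its circle of convergence. If the series converges on \<open>[0, x\<^sub>0)\<close> and \<open>R\<close> is
  holomorphic near \<open>x\<^sub>0\<close>, expand \<open>R\<close> around a point \<open>w\<^sub>1\<close> slightly to the left of \<open>x\<^sub>0\<close>. The Taylor
  coefficients there are nonnegative, and this bounds the partial sums at a point \<open>x > x\<^sub>0\<close>. So the set
  of points of convergence in \<open>[0, 1]\<close> has no supremum below \<open>1\<close>, and convergence even extends beyond
  \<open>1\<close>. Convexity of \<open>\<Omega>\<close> serves to make its intersection with a disc connected.
\<close>

theorem pringsheim_continuation:
  fixes R :: "complex \<Rightarrow> complex" and B :: "nat \<Rightarrow> real"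
  assumes \<Omega>: "open \<Omega>" "convex \<Omega>" "\<And>x. 0 \<le> x \<Longrightarrow> x \<le> 1 \<Longrightarrow> complex_of_real x \<in> \<Omega>"
    and hol: "R holomorphic_on \<Omega>" and B: "\<And>k. 0 \<le> B k" and r: "r > 0"
    and eq: "\<And>x. 0 < x \<Longrightarrow> x < r \<Longrightarrow> (\<lambda>k. complex_of_real (B k * x ^ k)) sums R (of_real x)"
  shows "(\<lambda>k. complex_of_real (B k)) sums R 1"
proof -
  let ?s = "\<lambda>x. summable (\<lambda>k. B k * x ^ k)"
  have mono: "?s x" if "?s y" "0 \<le> x" "x \<le> y" for x y
    by (rule summable_comparison_test'[OF that(1), of 0])
       (use that B in \<open>auto intro!: mult_left_mono power_mono\<close>)
  have sumC: "(\<lambda>k. complex_of_real (B k) * w ^ k) sums R w"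
    if x0: "0 < x0" and s: "\<And>x. 0 \<le> x \<Longrightarrow> x < x0 \<Longrightarrow> ?s x"
      and w: "w \<in> ball 0 x0 \<inter> \<Omega>" for x0 w
  proof -
    have summ: "summable (\<lambda>k. complex_of_real (B k) * z ^ k)" if "norm z < x0" for z
    proof (rule summable_norm_cancel)
      show "summable (\<lambda>k. norm (complex_of_real (B k) * z ^ k))"
        using s[of "norm z"] that B by (simp add: norm_mult norm_power)
    qed
    define \<phi> where "\<phi> z = (\<Sum>k. complex_of_real (B k) * z ^ k)" for z
    have hol\<phi>: "\<phi> holomorphic_on ball 0 x0 \<inter> \<Omega>"
    proof (rule holomorphic_on_subset[OF power_series_holomorphic[where r = x0 and z = 0 and a = "\<lambda>k. of_real (B k)"]])
      show "(\<lambda>n. complex_of_real (B n) * (w - 0) ^ n) sums \<phi> w" if "w \<in> ball 0 x0" for w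
        using summ[of w] that unfolding \<phi>_def by (auto simp: summable_sums)
    qed auto
    have holR: "R holomorphic_on ball 0 x0 \<inter> \<Omega>" using hol by (rule holomorphic_on_subset) auto
    have "R w = \<phi> w"
    proof (rule analytic_continuation_from_reals[where S = "ball 0 x0 \<inter> \<Omega>" and f = R and g = \<phi> and ?x0.0 = 0 and \<delta> = r])
      show "open (ball 0 x0 \<inter> \<Omega>)" using \<Omega> by auto
      show "connected (ball 0 x0 \<inter> \<Omega>)" using \<Omega> by (intro convex_connected convex_Int) auto
      show "complex_of_real 0 \<in> ball 0 x0 \<inter> \<Omega>" using x0 \<Omega>(3)[of 0] by auto
      show "R (complex_of_real y) = \<phi> (complex_of_real y)" if "0 < y" "y < 0 + r" for y
        using eq[of y] that unfolding \<phi>_def by (simp add: sums_iff)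
    qed (use r w hol\<phi> holR in auto)
    then show ?thesis using summ[of w] w unfolding \<phi>_def by (simp add: sums_iff)
  qed
  have step: "\<exists>\<delta>>0. ?s (x0 + \<delta>)"
    if x0: "0 < x0" "x0 \<le> 1" and s: "\<And>x. 0 \<le> x \<Longrightarrow> x < x0 \<Longrightarrow> ?s x" for x0
  proof -
    obtain e0 where e0: "e0 > 0" "ball (complex_of_real x0) e0 \<subseteq> \<Omega>"
      using openE[OF \<Omega>(1) \<Omega>(3)[of x0]] x0 by (metis less_imp_le)
    define \<epsilon> where "\<epsilon> = min (e0 / 3) (x0 / 2)"
    have \<epsilon>: "\<epsilon> > 0" "\<epsilon> < x0" "3 * \<epsilon> \<le> e0" using e0 x0 unfolding \<epsilon>_def by auto
    define w1 where "w1 = x0 - \<epsilon>"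
    define x where "x = w1 + 3 * \<epsilon> / 2"
    have w1: "0 < w1" "w1 < x0" using \<epsilon> unfolding w1_def by auto
    \<comment> \<open>The Taylor series of R at w1 has radius of convergence at least 2 eps and so reaches beyond x0 = w1 + eps.\<close>
    have b2: "ball (complex_of_real w1) (2 * \<epsilon>) \<subseteq> \<Omega>"
    proof
      fix z assume "z \<in> ball (complex_of_real w1) (2 * \<epsilon>)"
      moreover have "dist (complex_of_real x0) (complex_of_real w1) = \<epsilon>"
        using \<epsilon> unfolding w1_def dist_norm by (simp add: algebra_simps)
      ultimately have "dist (complex_of_real x0) z < 3 * \<epsilon>"
        using dist_triangle[of "complex_of_real x0" z "complex_of_real w1"] by simp
      then show "z \<in> \<Omega>" using e0 \<epsilon> by auto
    qed
    have "(\<Sum>k<N. B k * x ^ k) \<le> Re (R (of_real x))" for N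
    proof -
      \<comment> \<open>Removing the first N terms keeps the remaining coefficients, and hence all derivatives, nonnegative.\<close>
      define tl where "tl w = R w - (\<Sum>k<N. complex_of_real (B k) * w ^ k)" for w
      have holt: "tl holomorphic_on ball (complex_of_real w1) (2 * \<epsilon>)"
        unfolding tl_def using holomorphic_on_subset[OF hol b2] by (intro holomorphic_intros) auto
      define ser where "ser w = (\<Sum>k. complex_of_real (if k < N then 0 else B k) * w ^ k)" for w
      have ser: "(\<lambda>k. complex_of_real (if k < N then 0 else B k) * w ^ k) sums ser w" if "norm w < x0" for w
      proof -
        have "summable (\<lambda>k. norm (complex_of_real (if k < N then 0 else B k) * w ^ k))"
          by (rule summable_comparison_test'[OF s[of "norm w"], of 0])
             (use that B in \<open>auto simp: norm_mult norm_power\<close>)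
        then show ?thesis unfolding ser_def by (rule summable_sums[OF summable_norm_cancel])
      qed
      have tl_ser: "tl w = ser w" if w: "norm w < x0" "w \<in> \<Omega>" for w
      proof -
        have "(\<lambda>k. complex_of_real (B k) * w ^ k) sums R w" using sumC[OF x0(1) s] w by auto
        moreover have "(\<lambda>k. if k \<in> {..<N} then complex_of_real (B k) * w ^ k else 0) sums (\<Sum>k<N. complex_of_real (B k) * w ^ k)"
          by (rule sums_If_finite_set) simp
        ultimately have "(\<lambda>k. complex_of_real (B k) * w ^ k - (if k \<in> {..<N} then complex_of_real (B k) * w ^ k else 0)) sums tl w"
          unfolding tl_def by (rule sums_diff)
        moreover have "(\<lambda>k. complex_of_real (B k) * w ^ k - (if k \<in> {..<N} then complex_of_real (B k) * w ^ k else 0))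
           = (\<lambda>k. complex_of_real (if k < N then 0 else B k) * w ^ k)" by auto
        ultimately show ?thesis using ser[OF w(1)] sums_unique2 by metis
      qed
      have nn: "nonneg_power_series_on_ball x0 ser"
        unfolding nonneg_power_series_on_ball_def
        using B ser by (intro exI[of _ "\<lambda>k. if k < N then 0 else B k"]) auto
      have sub1: "norm w < x0 \<and> w \<in> \<Omega>" if "w \<in> ball (complex_of_real w1) \<epsilon>" for w
      proof -
        have "norm w \<le> norm (complex_of_real w1) + dist (complex_of_real w1) w"
          using norm_triangle_sub[of w "complex_of_real w1"] by (simp add: dist_norm norm_minus_commute)
        moreover have "norm (complex_of_real w1) = w1" using w1 by simp
        ultimately have "norm w < x0" using that unfolding w1_def by simp
        moreover have "w \<in> ball (complex_of_real w1) (2 * \<epsilon>)" using that \<epsilon> by auto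
        ultimately show ?thesis using b2 by blast
      qed
      have dcoef: "\<exists>d\<ge>0. (deriv ^^ m) tl (of_real w1) = complex_of_real d" for m
      proof -
        have "(deriv ^^ m) tl (of_real w1) = (deriv ^^ m) ser (of_real w1)"
        proof (rule higher_deriv_transform_within_open[where S = "ball (complex_of_real w1) \<epsilon>"])
          show "tl holomorphic_on ball (complex_of_real w1) \<epsilon>"
            using holt \<epsilon> by (elim holomorphic_on_subset) (simp add: subset_ball)
          then show "ser holomorphic_on ball (complex_of_real w1) \<epsilon>"
            by (rule holomorphic_transform) (use tl_ser sub1 in blast)
          show "tl w = ser w" if "w \<in> ball (complex_of_real w1) \<epsilon>" for w
            using tl_ser sub1[OF that] by blast
        qed (use \<epsilon> in auto)
        then show ?thesis using nonneg_power_series_higher_deriv_nonneg[OF nn, of w1 m] w1 by auto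
      qed
      then obtain d where d: "\<And>m. d m \<ge> 0" "\<And>m. (deriv ^^ m) tl (of_real w1) = complex_of_real (d m)" by metis
      \<comment> \<open>The Taylor series of the tail at w1, evaluated at x > w1, consists of nonnegative terms.\<close>
      have "complex_of_real x \<in> ball (complex_of_real w1) (2 * \<epsilon>)"
        unfolding x_def using \<epsilon> by (simp add: dist_norm norm_divide norm_mult)
      from holomorphic_power_series[OF holt this]
      have "(\<lambda>m. complex_of_real (d m / fact m * (x - w1) ^ m)) sums tl (of_real x)"
        unfolding d(2) by simp
      from sums_Re[OF this] have s1: "(\<lambda>m. d m / fact m * (x - w1) ^ m) sums Re (tl (of_real x))"
        by (simp only: Re_complex_of_real)
      have nn1: "0 \<le> d m / fact m * (x - w1) ^ m" for m
        using d(1) \<epsilon> unfolding x_def by simp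
      have "Re (tl (of_real x)) \<ge> 0" by (rule sums_le[OF nn1 sums_zero s1])
      then show ?thesis unfolding tl_def by (simp flip: of_real_power of_real_mult)
    qed
    then have "(\<Sum>k\<le>N. B k * x ^ k) \<le> Re (R (of_real x))" for N
      by (simp only: flip: lessThan_Suc_atMost)
    moreover have "x \<ge> 0" unfolding x_def using w1 \<epsilon> by simp
    ultimately have "?s x"
      using B by (intro bounded_imp_summable[where B = "Re (R (of_real x))"]) auto
    moreover have "x = x0 + \<epsilon> / 2" unfolding x_def w1_def by simp
    ultimately show ?thesis using \<epsilon> by (intro exI[of _ "\<epsilon>/2"]) auto
  qed
  define X where "X = {x. 0 \<le> x \<and> x \<le> 1 \<and> ?s x}"
  have small: "?s (min r 1 / 2)"
  proof -
    have "(\<lambda>k. complex_of_real (B k * (min r 1 / 2) ^ k)) sums R (of_real (min r 1 / 2))"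
      by (rule eq) (use r in auto)
    from sums_summable[OF this] show ?thesis by (simp only: summable_complex_of_real)
  qed
  then have ne: "min r 1 / 2 \<in> X" unfolding X_def using r by (intro CollectI conjI) auto
  have bdd: "bdd_above X" unfolding X_def by auto
  define x0 where "x0 = Sup X"
  have x0: "0 < x0" using cSup_upper[OF ne bdd] r unfolding x0_def by auto
  have x01: "x0 \<le> 1" unfolding x0_def
  proof (rule cSup_least)
    show "X \<noteq> {}" using ne by blast
  qed (auto simp: X_def)
  have sx: "?s x" if x: "0 \<le> x" "x < x0" for x
  proof -
    obtain y where "y \<in> X" "x < y" using less_cSupD[of X x] x(2) ne unfolding x0_def by blast
    then show ?thesis using mono[of y x] x(1) unfolding X_def by auto
  qed
  obtain \<delta> where \<delta>: "\<delta> > 0" "?s (x0 + \<delta>)" using step[OF x0 x01 sx] by blast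
  have "x0 = 1"
  proof (rule ccontr)
    assume "x0 \<noteq> 1"
    then have "min (x0 + \<delta>) 1 \<in> X" unfolding X_def using x0 x01 \<delta> mono[OF \<delta>(2), of "min (x0+\<delta>) 1"] by auto
    then have "min (x0 + \<delta>) 1 \<le> x0" unfolding x0_def by (rule cSup_upper[OF _ bdd])
    then show False using \<open>x0 \<noteq> 1\<close> x01 \<delta> by auto
  qed
  then have "(\<lambda>k. complex_of_real (B k) * 1 ^ k) sums R 1"
    using \<delta> \<Omega>(3)[of 1] by (intro sumC[of "1 + \<delta>"] mono[OF \<delta>(2)]) auto
  then show ?thesis by simp
qed

section \<open>Complex Gaussian integrals\<close>

lemma gaussian_real_has_integral:
  fixes b g :: real
  assumes g: "g > 0"
  shows "has_bochner_integral lborel (\<lambda>v. exp (b * v - g * v\<^sup>2)) (sqrt (pi / g) * exp (b\<^sup>2 / (4 * g)))"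
proof -
  let ?\<mu> = "b / (2 * g)" and ?\<sigma> = "1 / sqrt (2 * g)"
  have sq: "?\<sigma>\<^sup>2 = 1 / (2 * g)" using g by (simp add: power_divide)
  have \<sigma>: "?\<sigma> > 0" using g by simp
  have "exp (b * v - g * v\<^sup>2) = sqrt (pi / g) * exp (b\<^sup>2 / (4 * g)) * normal_density ?\<mu> ?\<sigma> v" for v
  proof -
    have "b * v - g * v\<^sup>2 = b\<^sup>2 / (4 * g) + (- (v - ?\<mu>)\<^sup>2 / (2 * ?\<sigma>\<^sup>2))"
      unfolding sq using g by (simp add: field_simps power2_eq_square)
    then have "exp (b * v - g * v\<^sup>2) = exp (b\<^sup>2 / (4 * g)) * exp (- (v - ?\<mu>)\<^sup>2 / (2 * ?\<sigma>\<^sup>2))"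
      by (metis exp_add)
    moreover have "sqrt (2 * pi * ?\<sigma>\<^sup>2) = sqrt (pi / g)" unfolding sq using g by (simp add: field_simps)
    moreover have "sqrt (pi / g) \<noteq> 0" using g by simp
    ultimately show ?thesis unfolding normal_density_def by simp
  qed
  moreover have "has_bochner_integral lborel (normal_density ?\<mu> ?\<sigma>) 1"
    using \<sigma> by (simp add: has_bochner_integral_iff)
  then have "has_bochner_integral lborel (\<lambda>v. sqrt (pi / g) * exp (b\<^sup>2 / (4 * g)) * normal_density ?\<mu> ?\<sigma> v)
     (sqrt (pi / g) * exp (b\<^sup>2 / (4 * g)) * 1)" by (rule has_bochner_integral_mult_right)
  ultimately show ?thesis by simp
qed

lemma norm_gaussian: "norm (exp (b * complex_of_real v - \<gamma> * (complex_of_real v)\<^sup>2)) = exp (Re b * v - Re \<gamma> * v\<^sup>2)"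
  by (simp flip: of_real_power)

lemma gaussian_integrable:
  assumes "Re \<gamma> > 0"
  shows "integrable lborel (\<lambda>v. exp (b * complex_of_real v - \<gamma> * (complex_of_real v)\<^sup>2))"
proof (rule Bochner_Integration.integrable_bound)
  show "integrable lborel (\<lambda>v. exp (Re b * v - Re \<gamma> * v\<^sup>2))"
    using gaussian_real_has_integral[OF assms] by (simp add: has_bochner_integral_iff)
qed (auto simp: norm_gaussian)

text \<open>
  The majorant depends on \<open>b\<close> and \<open>\<gamma>\<close> only through bounds for their real parts, as the local domination
  in a holomorphic parameter integral demands.
\<close>

lemma norm_gaussian_le:
  assumes "\<bar>Re b\<bar> \<le> B" "g \<le> Re \<gamma>"
  shows "norm (exp (b * complex_of_real v - \<gamma> * (complex_of_real v)\<^sup>2)) \<le> exp (B * v - g * v\<^sup>2) + exp (- B * v - g * v\<^sup>2)"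
proof -
  have "Re b * v \<le> \<bar>Re b\<bar> * \<bar>v\<bar>" by (metis abs_ge_self abs_mult)
  also have "\<dots> \<le> B * \<bar>v\<bar>" using assms by (intro mult_right_mono) auto
  finally have 1: "Re b * v \<le> B * \<bar>v\<bar>" .
  have 2: "g * v\<^sup>2 \<le> Re \<gamma> * v\<^sup>2" using assms by (intro mult_right_mono) auto
  have "exp (Re b * v - Re \<gamma> * v\<^sup>2) \<le> exp (B * \<bar>v\<bar> - g * v\<^sup>2)" using 1 2 by simp
  also have "\<dots> \<le> exp (B * v - g * v\<^sup>2) + exp (- B * v - g * v\<^sup>2)"
    by (cases "v \<ge> 0") auto
  finally show ?thesis by (simp add: norm_gaussian)
qed

lemma integrable_gaussian_majorant:
  fixes B g :: real
  assumes "g > 0"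
  shows "integrable lborel (\<lambda>v. exp (B * v - g * v\<^sup>2) + exp (- B * v - g * v\<^sup>2))"
  using gaussian_real_has_integral[OF assms, of B] gaussian_real_has_integral[OF assms, of "-B"]
  by (auto simp: has_bochner_integral_iff)

text \<open>
  Both sides are entire in \<open>b\<close> and holomorphic in \<open>\<gamma>\<close> on the right half plane, where \<open>\<pi> / \<gamma>\<close> avoids the
  branch cut of the square root. The real formula therefore continues first in \<open>b\<close>, for real \<open>\<gamma>\<close>, and
  then in \<open>\<gamma>\<close>.
\<close>

theorem gaussian_has_integral:
  assumes \<gamma>: "Re \<gamma> > 0"
  shows "has_bochner_integral lborel (\<lambda>v. exp (b * complex_of_real v - \<gamma> * (complex_of_real v)\<^sup>2))
           (csqrt (of_real pi / \<gamma>) * exp (b\<^sup>2 / (4 * \<gamma>)))"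
proof -
  let ?I = "\<lambda>b \<gamma>. LINT v|lborel. exp (b * complex_of_real v - \<gamma> * (complex_of_real v)\<^sup>2)"
  have meas: "(\<lambda>v. exp (b * complex_of_real v - \<gamma> * (complex_of_real v)\<^sup>2)) \<in> borel_measurable lborel" for b \<gamma>
    by measurable
  have real_real: "?I (of_real x) (of_real g) = csqrt (of_real pi / of_real g) * exp ((of_real x)\<^sup>2 / (4 * of_real g))"
    if "g > 0" for x g :: real
  proof -
    have "?I (of_real x) (of_real g) = (LINT v|lborel. complex_of_real (exp (x * v - g * v\<^sup>2)))"
      by (intro Bochner_Integration.integral_cong) (auto simp flip: exp_of_real)
    also have "\<dots> = complex_of_real (sqrt (pi / g) * exp (x\<^sup>2 / (4 * g)))"
      using gaussian_real_has_integral[OF that, of x] by (simp add: has_bochner_integral_iff)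
    also have "\<dots> = complex_of_real (sqrt (pi / g)) * exp ((of_real x)\<^sup>2 / (4 * of_real g))"
      by (simp flip: exp_of_real)
    also have "complex_of_real (sqrt (pi / g)) = csqrt (of_real pi / of_real g)"
      using that by (subst of_real_divide[symmetric], subst csqrt_of_real_nonneg) auto
    finally show ?thesis .
  qed
  have holb: "(\<lambda>b. ?I b \<gamma>) holomorphic_on UNIV" if "Re \<gamma> > 0" for \<gamma>
  proof (rule holomorphic_on_integral)
    show "(\<lambda>b. exp (b * complex_of_real v - \<gamma> * (complex_of_real v)\<^sup>2)) holomorphic_on UNIV" for v
      by (intro holomorphic_intros)
    fix b :: complex
    have "norm (exp (z * complex_of_real v - \<gamma> * (complex_of_real v)\<^sup>2)) \<le>
        exp ((\<bar>Re b\<bar> + 1) * v - Re \<gamma> * v\<^sup>2) + exp (- (\<bar>Re b\<bar> + 1) * v - Re \<gamma> * v\<^sup>2)"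
      if "z \<in> ball b 1" for z v
    proof (rule norm_gaussian_le)
      have "\<bar>Re (z - b)\<bar> \<le> 1" using abs_Re_le_cmod[of "z - b"] that by (simp add: dist_norm norm_minus_commute)
      then show "\<bar>Re z\<bar> \<le> \<bar>Re b\<bar> + 1" by simp
    qed simp
    then show "\<exists>r>0. \<exists>G. integrable lborel G \<and> ball b r \<subseteq> UNIV \<and>
      (\<forall>z\<in>ball b r. \<forall>v\<in>space lborel. norm (exp (z * complex_of_real v - \<gamma> * (complex_of_real v)\<^sup>2)) \<le> G v)"
      using integrable_gaussian_majorant[OF that, of "\<bar>Re b\<bar> + 1"] zero_less_one by blast
  qed (rule meas)
  have cplx_real: "?I b (of_real g) = csqrt (of_real pi / of_real g) * exp (b\<^sup>2 / (4 * of_real g))"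
    if "g > 0" for b and g :: real
    by (rule analytic_continuation_from_reals[where S = UNIV and f = "\<lambda>b. ?I b (of_real g)" and ?x0.0 = 0 and \<delta> = 1])
       (use holb[of "of_real g"] real_real that in \<open>auto intro!: holomorphic_intros\<close>)
  have holg: "(\<lambda>\<gamma>. ?I b \<gamma>) holomorphic_on {\<gamma>. Re \<gamma> > 0}"
  proof (rule holomorphic_on_integral)
    show "(\<lambda>\<gamma>. exp (b * complex_of_real v - \<gamma> * (complex_of_real v)\<^sup>2)) holomorphic_on {\<gamma>. Re \<gamma> > 0}" for v
      by (intro holomorphic_intros)
    fix \<gamma> assume "\<gamma> \<in> {\<gamma>. Re \<gamma> > 0}"
    then have \<gamma>: "Re \<gamma> > 0" by simp
    have re: "Re z \<ge> Re \<gamma> / 2" if "z \<in> ball \<gamma> (Re \<gamma> / 2)" for z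
      using abs_Re_le_cmod[of "\<gamma> - z"] that by (simp add: dist_norm)
    then have "norm (exp (b * complex_of_real v - z * (complex_of_real v)\<^sup>2)) \<le>
        exp (\<bar>Re b\<bar> * v - (Re \<gamma> / 2) * v\<^sup>2) + exp (- \<bar>Re b\<bar> * v - (Re \<gamma> / 2) * v\<^sup>2)"
      if "z \<in> ball \<gamma> (Re \<gamma> / 2)" for z v
      using that by (intro norm_gaussian_le) auto
    moreover have "ball \<gamma> (Re \<gamma> / 2) \<subseteq> {\<gamma>. Re \<gamma> > 0}" using re \<gamma> by fastforce
    ultimately show "\<exists>r>0. \<exists>G. integrable lborel G \<and> ball \<gamma> r \<subseteq> {\<gamma>. Re \<gamma> > 0} \<and>
      (\<forall>z\<in>ball \<gamma> r. \<forall>v\<in>space lborel. norm (exp (b * complex_of_real v - z * (complex_of_real v)\<^sup>2)) \<le> G v)"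
      using integrable_gaussian_majorant[of "Re \<gamma> / 2" "\<bar>Re b\<bar>"] \<gamma>
      by (intro exI[of _ "Re \<gamma> / 2"] conjI exI) auto
  qed (rule meas)
  have "?I b \<gamma> = csqrt (of_real pi / \<gamma>) * exp (b\<^sup>2 / (4 * \<gamma>))"
  proof (rule analytic_continuation_from_reals[where f = "\<lambda>\<gamma>. ?I b \<gamma>" and z = \<gamma> and
        g = "\<lambda>\<gamma>. csqrt (of_real pi / \<gamma>) * exp (b\<^sup>2 / (4 * \<gamma>))" and S = "{\<gamma>. Re \<gamma> > 0}" and ?x0.0 = 1 and \<delta> = 1])
    show "open {\<gamma>. Re \<gamma> > 0}" by (rule open_halfspace_Re_gt)
    show "connected {\<gamma>. Re \<gamma> > 0}" by (intro convex_connected convex_halfspace_Re_gt)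
    have "Re (of_real pi / \<gamma>) > 0" if "Re \<gamma> > 0" for \<gamma>
      using that by (simp add: Re_divide_of_real Re_divide sum_power2_gt_zero_iff)
    then show "(\<lambda>\<gamma>. csqrt (of_real pi / \<gamma>) * exp (b\<^sup>2 / (4 * \<gamma>))) holomorphic_on {\<gamma>. Re \<gamma> > 0}"
      by (intro holomorphic_intros) (force simp: complex_nonpos_Reals_iff)+
  qed (use \<gamma> holg cplx_real in auto)
  then show ?thesis using gaussian_integrable[OF \<gamma>] by (simp add: has_bochner_integral_iff)
qed

text \<open>
  Lebesgue measure on a Euclidean space is the image of a product measure indexed by the basis vectors,
  so the proof only translates basis vectors into coordinate indices.
\<close>

lemma lborel_vec_prod_integral:
  fixes \<phi> :: "'n::finite \<Rightarrow> real \<Rightarrow> 'b::{real_normed_field,banach,second_countable_topology}"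
  assumes int: "\<And>j. integrable lborel (\<phi> j)"
  shows "has_bochner_integral (lborel :: (real ^ 'n) measure) (\<lambda>x. \<Prod>j\<in>UNIV. \<phi> j (x $ j)) (\<Prod>j\<in>UNIV. (LINT s|lborel. \<phi> j s))"
proof -
  interpret product_sigma_finite "\<lambda>_::real^'n. lborel :: real measure" by standard
  let ?B = "Basis :: (real ^ 'n) set"
  \<comment> \<open>The coordinate to which a basis vector belongs.\<close>
  let ?ix = "\<lambda>b::real^'n. (THE j. b = axis j (1::real))"
  have ix: "?ix (axis j 1) = j" for j by (auto simp: axis_eq_axis)
  have inj: "inj_on (\<lambda>j::'n. axis j (1::real)) UNIV" by (auto simp: inj_on_def axis_eq_axis)
  have Bim: "?B = (\<lambda>j. axis j 1) ` UNIV" by (auto simp: Basis_vec_def)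
  have reind: "(\<Prod>b\<in>?B. F b) = (\<Prod>j\<in>UNIV. F (axis j 1))" for F :: "real^'n \<Rightarrow> 'b"
    unfolding Bim by (subst prod.reindex[OF inj]) simp
  have comp: "(\<Sum>b\<in>?B. f b * b $ j) = f (axis j 1)" for f :: "real^'n \<Rightarrow> real" and j
    unfolding Bim by (subst sum.reindex[OF inj]) (simp add: axis_def if_distrib[where f="\<lambda>x. _ * x"] cong: if_cong)
  have meas [measurable]: "\<phi> j \<in> borel_measurable borel" for j using int[of j] by (simp add: borel_measurable_integrable)
  have m1: "(\<lambda>x::real^'n. \<Prod>j\<in>UNIV. \<phi> j (x $ j)) \<in> borel_measurable borel" by measurable
  have m2: "(\<lambda>f. \<Sum>b\<in>?B. f b *\<^sub>R b) \<in> measurable (\<Pi>\<^sub>M b\<in>?B. lborel) borel" by measurable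
  have eqf: "(\<Prod>j\<in>UNIV. \<phi> j ((\<Sum>b\<in>?B. f b *\<^sub>R b) $ j)) = (\<Prod>b\<in>?B. \<phi> (?ix b) (f b))" for f
    by (simp add: reind comp ix)
  have intb: "integrable lborel (\<phi> (?ix b))" for b by (rule int)
  have "integrable (\<Pi>\<^sub>M b\<in>?B. lborel) (\<lambda>f. \<Prod>b\<in>?B. \<phi> (?ix b) (f b))"
    by (intro product_integrable_prod intb) auto
  moreover have "integral\<^sup>L (\<Pi>\<^sub>M b\<in>?B. lborel) (\<lambda>f. \<Prod>b\<in>?B. \<phi> (?ix b) (f b)) = (\<Prod>b\<in>?B. (LINT s|lborel. \<phi> (?ix b) s))"
    by (intro product_integral_prod intb) auto
  ultimately show ?thesis
    unfolding has_bochner_integral_iff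
    by (subst (1 2) lborel_eq) (simp add: integrable_distr_eq[OF m2 m1] integral_distr[OF m2 m1] reind ix comp)
qed

section \<open>The integral representation of Hermite polynomials\<close>

text \<open>
  The hypothesis bounds the partial sums of the norms, which dominates the partial sums of the series
  and also makes the series of integrals absolutely convergent.
\<close>

lemma sums_integral_dominated:
  fixes f :: "nat \<Rightarrow> 'a \<Rightarrow> complex"
  assumes meas: "\<And>i. f i \<in> borel_measurable M"
    and sums: "\<And>x. x \<in> space M \<Longrightarrow> (\<lambda>i. f i x) sums s x"
    and bound: "\<And>x N. x \<in> space M \<Longrightarrow> (\<Sum>i<N. norm (f i x)) \<le> G x"
    and G: "integrable M G"
  shows "integrable M (f i)" "integrable M s" "(\<lambda>i. LINT x|M. f i x) sums (LINT x|M. s x)"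
    "summable (\<lambda>i. norm (LINT x|M. f i x))"
proof -
  have nf: "norm (f i x) \<le> G x" if "x \<in> space M" for i x
  proof -
    have "norm (f i x) \<le> (\<Sum>i<Suc i. norm (f i x))" by (simp add: sum_nonneg)
    then show ?thesis using bound[OF that, of "Suc i"] by linarith
  qed
  have Gnn: "0 \<le> G x" if "x \<in> space M" for x using nf[OF that, of 0] norm_ge_zero order_trans by blast
  show int: "integrable M (f i)" for i
    by (rule Bochner_Integration.integrable_bound[OF G meas]) (use nf Gnn in \<open>force intro!: AE_I2\<close>)
  have smeas: "s \<in> borel_measurable M"
    by (rule borel_measurable_LIMSEQ_metric[where f = "\<lambda>N x. \<Sum>i<N. f i x"])
       (use meas sums in \<open>auto simp: sums_def\<close>)
  have bd: "norm (\<Sum>i<N. f i x) \<le> G x" if "x \<in> space M" for N x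
    using norm_sum[of "\<lambda>i. f i x" "{..<N}"] bound[OF that, of N] by linarith
  have lim: "AE x in M. (\<lambda>N. \<Sum>i<N. f i x) \<longlonglongrightarrow> s x" using sums by (auto simp: sums_def)
  have bdAE: "AE x in M. norm (\<Sum>i<N. f i x) \<le> G x" for N using bd by auto
  have pm: "(\<lambda>x. \<Sum>i<N. f i x) \<in> borel_measurable M" for N using meas by auto
  show "integrable M s"
    by (rule integrable_dominated_convergence[OF smeas pm G lim bdAE])
  have "(\<lambda>N. LINT x|M. (\<Sum>i<N. f i x)) \<longlonglongrightarrow> (LINT x|M. s x)"
    by (rule integral_dominated_convergence[OF smeas pm G lim bdAE])
  then show "(\<lambda>i. LINT x|M. f i x) sums (LINT x|M. s x)"
    unfolding sums_def using int by (simp add: Bochner_Integration.integral_sum)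
  show "summable (\<lambda>i. norm (LINT x|M. f i x))"
  proof (rule bounded_imp_summable[where B = "LINT x|M. G x"])
    fix n
    have "(\<Sum>i\<le>n. norm (LINT x|M. f i x)) \<le> (\<Sum>i\<le>n. (LINT x|M. norm (f i x)))"
      by (intro sum_mono integral_norm_bound)
    also have "\<dots> = (LINT x|M. (\<Sum>i\<le>n. norm (f i x)))"
      using int by (subst Bochner_Integration.integral_sum) auto
    also have "\<dots> \<le> (LINT x|M. G x)"
      using int G bound[of _ "Suc n"] by (intro integral_mono) (auto simp: lessThan_Suc_atMost)
    finally show "(\<Sum>i\<le>n. norm (LINT x|M. f i x)) \<le> (LINT x|M. G x)" .
  qed auto
qed

text \<open>
  An enumeration of the index set reduces this to sequences; absolute convergence makes the choice of the
  enumeration irrelevant.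
\<close>

lemma has_sum_integral_dominated:
  fixes f :: "'i::countable \<Rightarrow> 'a \<Rightarrow> complex"
  assumes inf: "infinite (UNIV :: 'i set)"
    and meas: "\<And>i. f i \<in> borel_measurable M"
    and sums: "\<And>x. x \<in> space M \<Longrightarrow> ((\<lambda>i. f i x) has_sum s x) UNIV"
    and bound: "\<And>x F. x \<in> space M \<Longrightarrow> finite F \<Longrightarrow> (\<Sum>i\<in>F. norm (f i x)) \<le> G x"
    and G: "integrable M G"
  shows "integrable M s" "((\<lambda>i. LINT x|M. f i x) has_sum (LINT x|M. s x)) UNIV"
proof -
  \<comment> \<open>A bijection from the natural numbers, as the index type is countable and infinite.\<close>
  let ?e = "from_nat_into (UNIV :: 'i set)"
  have e: "bij_betw ?e UNIV UNIV" using inf by (intro bij_betw_from_nat_into) auto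
  have 1: "(\<lambda>n. f (?e n) x) sums s x" if "x \<in> space M" for x
    using has_sum_imp_sums[of "\<lambda>n. f (?e n) x" "s x"] sums[OF that] has_sum_reindex_bij_betw[OF e, of "\<lambda>i. f i x" "s x"] by blast
  have 2: "(\<Sum>n<N. norm (f (?e n) x)) \<le> G x" if "x \<in> space M" for x N
  proof -
    have "(\<Sum>n<N. norm (f (?e n) x)) = (\<Sum>i\<in>?e ` {..<N}. norm (f i x))"
      using bij_betw_imp_inj_on[OF e] by (subst sum.reindex) (auto intro: inj_on_subset)
    also have "\<dots> \<le> G x" using that by (intro bound) auto
    finally show ?thesis .
  qed
  note d = sums_integral_dominated[of "\<lambda>n. f (?e n)" M s G, OF meas 1 2 G]
  show "integrable M s" by (rule d(2))
  have "((\<lambda>n. LINT x|M. f (?e n) x) has_sum (LINT x|M. s x)) UNIV"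
    by (rule norm_summable_imp_has_sum[OF d(4) d(3)])
  then show "((\<lambda>i. LINT x|M. f i x) has_sum (LINT x|M. s x)) UNIV"
    using has_sum_reindex_bij_betw[OF e, of "\<lambda>i. LINT x|M. f i x"] by blast
qed

text \<open>
  Hermite polynomials are defined by iterated real derivatives, whereas generating functions deliver
  complex Taylor coefficients; this identifies the two.
\<close>

lemma higher_deriv_real_restriction:
  fixes F :: "complex \<Rightarrow> complex" and \<phi> :: "real \<Rightarrow> real"
  assumes "F holomorphic_on UNIV" "\<And>t. F (of_real t) = of_real (\<phi> t)"
  shows "(deriv ^^ k) F (of_real t) = of_real ((deriv ^^ k) \<phi> t)"
  using assms
proof (induction k arbitrary: F \<phi>)
  case 0
  then show ?case by simp
next
  case (Suc k)
  have d: "deriv F (of_real t) = of_real (deriv \<phi> t)" for t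
  proof -
    have "(F has_field_derivative deriv F (of_real t)) (at (of_real t))"
      using holomorphic_derivI[OF Suc.prems(1)] by auto
    then have v: "((\<lambda>s. F (of_real s)) has_vector_derivative deriv F (of_real t)) (at t)"
      by (rule has_vector_derivative_real_field)
    then have v': "((\<lambda>s. complex_of_real (\<phi> s)) has_vector_derivative deriv F (of_real t)) (at t)"
      by (simp add: Suc.prems(2))
    have re: "((\<lambda>s. Re (complex_of_real (\<phi> s))) has_vector_derivative Re (deriv F (of_real t))) (at t)"
      by (rule bounded_linear.has_vector_derivative[OF bounded_linear_Re v'])
    then have "deriv \<phi> t = Re (deriv F (of_real t))"
      by (intro DERIV_imp_deriv) (simp add: has_real_derivative_iff_has_vector_derivative)
    moreover have im: "((\<lambda>s. Im (complex_of_real (\<phi> s))) has_vector_derivative Im (deriv F (of_real t))) (at t)"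
      by (rule bounded_linear.has_vector_derivative[OF bounded_linear_Im v'])
    then have "((\<lambda>s::real. 0::real) has_vector_derivative Im (deriv F (of_real t))) (at t)" by simp
    then have "Im (deriv F (of_real t)) = 0"
      using vector_derivative_unique_at has_vector_derivative_const by blast
    ultimately show ?thesis by (simp add: complex_eq_iff)
  qed
  have "deriv F holomorphic_on UNIV" using Suc.prems(1) by (rule holomorphic_deriv) auto
  from Suc.IH[OF this d] show ?case by (simp add: funpow_Suc_right del: funpow.simps)
qed

lemma power_series_coeff_eq_higher_deriv:
  fixes a :: "nat \<Rightarrow> complex"
  assumes "\<And>z. (\<lambda>k. a k * z ^ k) sums E z"
  shows "a k = (deriv ^^ k) E 0 / fact k"
proof -
  have "E has_fps_expansion Abs_fps a"
    using assms by (intro has_fps_expansionI) auto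
  from fps_nth_fps_expansion[OF this, of k] show ?thesis by simp
qed

lemma exp_series_sums: "(\<lambda>k. z ^ k / fact k) sums exp (z :: complex)"
  using exp_converges[of z] by (simp add: scaleR_conv_of_real divide_inverse mult.commute)

lemma sum_norm_exp_series_le:
  "(\<Sum>k<N. norm (z ^ k / fact k :: complex)) \<le> exp (norm z)"
proof -
  have "(\<Sum>k<N. norm (z ^ k / fact k :: complex)) = (\<Sum>k<N. norm z ^ k /\<^sub>R fact k)"
    by (intro sum.cong) (auto simp: norm_mult norm_inverse norm_power divide_inverse mult.commute)
  also have "\<dots> \<le> exp (norm z)"
    unfolding exp_def by (intro sum_le_suminf summable_exp_generic) (auto)
  finally show ?thesis .
qed

lemma integrable_exp_abs_gaussian:
  fixes B g C :: real
  assumes "g > 0"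
  shows "integrable lborel (\<lambda>u. exp (B * \<bar>u\<bar> + C - g * u\<^sup>2))"
proof (rule Bochner_Integration.integrable_bound)
  show "integrable lborel (\<lambda>u. exp C * (exp (B * u - g * u\<^sup>2) + exp (- B * u - g * u\<^sup>2)))"
    using integrable_gaussian_majorant[OF assms, of B] by simp
  show "AE u in lborel. norm (exp (B * \<bar>u\<bar> + C - g * u\<^sup>2))
      \<le> norm (exp C * (exp (B * u - g * u\<^sup>2) + exp (- B * u - g * u\<^sup>2)))"
  proof (intro AE_I2)
    fix u :: real
    have "exp (B * \<bar>u\<bar> + C - g * u\<^sup>2) = exp C * exp (B * \<bar>u\<bar> - g * u\<^sup>2)" by (simp add: exp_add[symmetric])
    also have "\<dots> \<le> exp C * (exp (B * u - g * u\<^sup>2) + exp (- B * u - g * u\<^sup>2))"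
      by (intro mult_left_mono) (cases "u \<ge> 0"; simp)+
    finally show "norm (exp (B * \<bar>u\<bar> + C - g * u\<^sup>2)) \<le> norm (exp C * (exp (B * u - g * u\<^sup>2) + exp (- B * u - g * u\<^sup>2)))"
      by simp
  qed
qed measurable

text \<open>
  This is the classical formula \<open>H\<^sub>k(x) = \<pi>\<^sup>-\<^sup>1\<^sup>/\<^sup>2 \<integral> (2 (x + i u))\<^sup>k exp (- u\<^sup>2) du\<close>. It shows at once the generating
  function and the growth of \<open>H\<^sub>k\<close>, and it reduces Mehler's formula to a Gaussian integral.
\<close>

definition hermite_moment :: "nat \<Rightarrow> real \<Rightarrow> complex" where
  "hermite_moment k x = (LINT u|lborel. (2 * Complex x u) ^ k * exp (- (complex_of_real u)\<^sup>2)) / of_real (sqrt pi)"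

lemma Complex_measurable [measurable]: "Complex x \<in> borel_measurable borel"
proof -
  have "Complex x = (\<lambda>u. of_real x + \<i> * of_real u)" by (auto simp: Complex_eq)
  then show ?thesis by simp
qed

lemma cmod_Complex_le: "cmod (Complex x u) \<le> \<bar>x\<bar> + \<bar>u\<bar>"
  using cmod_le[of "Complex x u"] by simp

lemma norm_exp_neg_sq: "norm (exp (- (complex_of_real u)\<^sup>2)) = exp (- u\<^sup>2)"
  by (simp flip: of_real_power)

text \<open>
  The exponential series is summed under the Gaussian integral, and the resulting integral is again
  Gaussian.
\<close>

lemma hermite_moment_generating:
  fixes x :: real and z :: complex
  shows "integrable lborel (\<lambda>u. (2 * Complex x u) ^ k * exp (- (complex_of_real u)\<^sup>2))"
    and "(\<lambda>k. hermite_moment k x / fact k * z ^ k) sums exp (2 * z * of_real x - z\<^sup>2)"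
proof -
  have sums: "(\<lambda>k. (2 * z * Complex x u) ^ k / fact k * exp (- (complex_of_real u)\<^sup>2)) sums
      (exp (2 * z * Complex x u) * exp (- (complex_of_real u)\<^sup>2))" for u and z :: complex
    by (rule sums_mult2[OF exp_series_sums])
  have bd: "(\<Sum>k<N. norm ((2 * z * Complex x u) ^ k / fact k * exp (- (complex_of_real u)\<^sup>2)))
      \<le> exp (2 * norm z * \<bar>u\<bar> + 2 * norm z * \<bar>x\<bar> - 1 * u\<^sup>2)" for u N and z :: complex
  proof -
    have "(\<Sum>k<N. norm ((2 * z * Complex x u) ^ k / fact k * exp (- (complex_of_real u)\<^sup>2)))
       = (\<Sum>k<N. norm ((2 * z * Complex x u) ^ k / fact k)) * exp (- u\<^sup>2)"
      by (simp only: norm_mult norm_exp_neg_sq sum_distrib_right)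
    also have "\<dots> \<le> exp (norm (2 * z * Complex x u)) * exp (- u\<^sup>2)"
      by (intro mult_right_mono sum_norm_exp_series_le) auto
    also have "\<dots> \<le> exp (2 * norm z * (\<bar>x\<bar> + \<bar>u\<bar>)) * exp (- u\<^sup>2)"
      by (intro mult_right_mono) (auto simp: norm_mult intro!: mult_left_mono cmod_Complex_le)
    finally show ?thesis by (simp add: algebra_simps flip: exp_add)
  qed
  have meas: "(\<lambda>u. (2 * z * Complex x u) ^ k / fact k * exp (- (complex_of_real u)\<^sup>2)) \<in> borel_measurable lborel" for k and z :: complex
    by measurable
  have int: "integrable lborel (\<lambda>u. exp (2 * norm z * \<bar>u\<bar> + 2 * norm z * \<bar>x\<bar> - 1 * u\<^sup>2))" for z :: complex
    by (rule integrable_exp_abs_gaussian) simp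
  note d = sums_integral_dominated[OF meas sums bd int]
  have "integrable lborel (\<lambda>u. fact k * ((2 * 1 * Complex x u) ^ k / fact k * exp (- (complex_of_real u)\<^sup>2)))"
    using d(1)[of 1 k] by (intro integrable_mult_right) simp
  then show "integrable lborel (\<lambda>u. (2 * Complex x u) ^ k * exp (- (complex_of_real u)\<^sup>2))" by simp
  have eq: "(LINT u|lborel. (2 * z * Complex x u) ^ k / fact k * exp (- (complex_of_real u)\<^sup>2))
      = of_real (sqrt pi) * (hermite_moment k x / fact k * z ^ k)" for k
  proof -
    have "(LINT u|lborel. (2 * z * Complex x u) ^ k / fact k * exp (- (complex_of_real u)\<^sup>2)) =
      (LINT u|lborel. (z ^ k / fact k) * ((2 * Complex x u) ^ k * exp (- (complex_of_real u)\<^sup>2)))"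
      by (intro Bochner_Integration.integral_cong) (auto simp: power_mult_distrib field_simps)
    then show ?thesis unfolding hermite_moment_def by simp
  qed
  have val: "(LINT u|lborel. exp (2 * z * Complex x u) * exp (- (complex_of_real u)\<^sup>2)) = of_real (sqrt pi) * exp (2 * z * of_real x - z\<^sup>2)"
  proof -
    have "(LINT u|lborel. exp (2 * z * Complex x u) * exp (- (complex_of_real u)\<^sup>2)) =
      (LINT u|lborel. exp (2 * z * of_real x) * exp ((2 * \<i> * z) * complex_of_real u - 1 * (complex_of_real u)\<^sup>2))"
      by (intro Bochner_Integration.integral_cong) (auto simp: Complex_eq algebra_simps simp flip: exp_add)
    also have "\<dots> = exp (2 * z * of_real x) * (csqrt (of_real pi / 1) * exp ((2 * \<i> * z)\<^sup>2 / (4 * 1)))"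
      using gaussian_has_integral[of 1 "2 * \<i> * z"] by (simp add: has_bochner_integral_iff)
    also have "\<dots> = of_real (sqrt pi) * exp (2 * z * of_real x - z\<^sup>2)"
      by (simp add: power_mult_distrib exp_diff exp_minus field_simps)
    finally show ?thesis .
  qed
  have "(\<lambda>k. of_real (sqrt pi) * (hermite_moment k x / fact k * z ^ k)) sums (of_real (sqrt pi) * exp (2 * z * of_real x - z\<^sup>2))"
    using d(3)[of z] unfolding eq val .
  then show "(\<lambda>k. hermite_moment k x / fact k * z ^ k) sums exp (2 * z * of_real x - z\<^sup>2)"
    by (subst (asm) sums_mult_iff) auto
qed

text \<open>
  Both sides are Taylor coefficients at \<open>z = 0\<close> of \<open>exp (- (x - z)\<^sup>2) = exp (- x\<^sup>2) exp (2 z x - z\<^sup>2)\<close>.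
\<close>

lemma hermite_moment_eq_poly: "hermite_moment k x = of_real (hermite_poly k x)"
proof -
  let ?g = "\<lambda>w::complex. exp (- w\<^sup>2)"
  have s: "(\<lambda>k. (exp (- (of_real x)\<^sup>2) * hermite_moment k x / fact k) * z ^ k) sums ?g ((-1) * z + of_real x)" for z
  proof -
    have "?g ((-1) * z + of_real x) = exp (- (of_real x)\<^sup>2) * exp (2 * z * of_real x - z\<^sup>2)"
      by (simp add: power2_eq_square algebra_simps flip: exp_add)
    then show ?thesis
      using sums_mult[OF hermite_moment_generating(2)[of x z], of "exp (- (of_real x)\<^sup>2)"] by (simp add: mult.assoc)
  qed
  have "exp (- (of_real x)\<^sup>2) * hermite_moment k x / fact k = (deriv ^^ k) (\<lambda>z. ?g ((-1) * z + of_real x)) 0 / fact k"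
    by (rule power_series_coeff_eq_higher_deriv[OF s])
  also have "(deriv ^^ k) (\<lambda>z. ?g ((-1) * z + of_real x)) 0 = (-1) ^ k * (deriv ^^ k) ?g ((-1) * 0 + of_real x)"
    by (rule higher_deriv_compose_linear'[where T = UNIV and S = UNIV]) (auto intro!: holomorphic_intros)
  also have "(deriv ^^ k) ?g ((-1) * 0 + of_real x) = (deriv ^^ k) ?g (of_real x)" by simp
  also have "(deriv ^^ k) ?g (of_real x) = of_real ((deriv ^^ k) (\<lambda>u. exp (- u\<^sup>2)) x)"
    by (rule higher_deriv_real_restriction) (auto intro!: holomorphic_intros simp flip: exp_of_real)
  finally have "hermite_moment k x = exp ((of_real x)\<^sup>2) * ((-1) ^ k * of_real ((deriv ^^ k) (\<lambda>u. exp (- u\<^sup>2)) x))"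
    by (simp add: exp_minus field_simps)
  then show ?thesis unfolding hermite_poly_def by (simp flip: exp_of_real)
qed

section \<open>Mehler's formula\<close>

text \<open>
  Replacing \<open>x + i u\<close> by \<open>|y| + |v|\<close> in the integral representation makes all terms nonnegative, and the
  majorant is summed like the generating function itself. The two signs of \<open>v\<close> account for the factor 2.
\<close>

lemma sum_norm_hermite_series_le:
  "(\<Sum>k<N. norm (\<zeta> ^ k / fact k * of_real (hermite_poly k y) :: complex)) \<le> 2 * exp (2 * norm \<zeta> * \<bar>y\<bar> + (norm \<zeta>)\<^sup>2)"
proof -
  have hb: "\<bar>hermite_poly k y\<bar> \<le> (LINT v|lborel. (2 * (\<bar>y\<bar> + \<bar>v\<bar>)) ^ k * exp (- v\<^sup>2)) / sqrt pi"
    and hi: "integrable lborel (\<lambda>v. (2 * (\<bar>y\<bar> + \<bar>v\<bar>)) ^ k * exp (- v\<^sup>2))" for k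
  proof -
    have b: "(2 * (\<bar>y\<bar> + \<bar>v\<bar>)) ^ k * exp (- v\<^sup>2) \<le> fact k * exp (2 * \<bar>v\<bar> + 2 * \<bar>y\<bar> - 1 * v\<^sup>2)" for v
    proof -
      define s where "s = 2 * (\<bar>y\<bar> + \<bar>v\<bar>)"
      have s0: "0 \<le> s" unfolding s_def by simp
      have "(\<Sum>i<Suc k. norm (of_real s ^ i / fact i :: complex)) \<le> exp (norm (of_real s :: complex))"
        by (rule sum_norm_exp_series_le)
      moreover have "0 \<le> (\<Sum>i<k. norm (of_real s ^ i / fact i :: complex))" by (intro sum_nonneg) auto
      ultimately have "norm (of_real s ^ k / fact k :: complex) \<le> exp s" using s0 by simp
      then have "s ^ k \<le> fact k * exp s"
        using s0 by (simp add: norm_divide norm_power divide_le_eq mult.commute)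
      then have "s ^ k * exp (- v\<^sup>2) \<le> fact k * exp s * exp (- v\<^sup>2)" by (intro mult_right_mono) auto
      then show ?thesis unfolding s_def by (simp add: exp_add[symmetric] algebra_simps)
    qed
    show hi: "integrable lborel (\<lambda>v. (2 * (\<bar>y\<bar> + \<bar>v\<bar>)) ^ k * exp (- v\<^sup>2))"
    proof (rule Bochner_Integration.integrable_bound)
      show "integrable lborel (\<lambda>v. fact k * exp (2 * \<bar>v\<bar> + 2 * \<bar>y\<bar> - 1 * v\<^sup>2))"
        by (intro integrable_mult_right integrable_exp_abs_gaussian) simp
    qed (use b in \<open>auto simp: abs_mult\<close>)
    have "\<bar>hermite_poly k y\<bar> = norm (hermite_moment k y)" by (simp add: hermite_moment_eq_poly)
    also have "\<dots> = norm (LINT u|lborel. (2 * Complex y u) ^ k * exp (- (complex_of_real u)\<^sup>2)) / sqrt pi"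
      unfolding hermite_moment_def by (simp add: norm_divide)
    also have "\<dots> \<le> (LINT v|lborel. (2 * (\<bar>y\<bar> + \<bar>v\<bar>)) ^ k * exp (- v\<^sup>2)) / sqrt pi"
    proof (intro divide_right_mono Bochner_Integration.integral_norm_bound_integral hi hermite_moment_generating(1))
      show "norm ((2 * Complex y u) ^ k * exp (- (complex_of_real u)\<^sup>2)) \<le> (2 * (\<bar>y\<bar> + \<bar>u\<bar>)) ^ k * exp (- u\<^sup>2)" for u
        unfolding norm_mult norm_exp_neg_sq norm_power
        using cmod_Complex_le[of y u] by (intro mult_right_mono power_mono) auto
    qed simp
    finally show "\<bar>hermite_poly k y\<bar> \<le> (LINT v|lborel. (2 * (\<bar>y\<bar> + \<bar>v\<bar>)) ^ k * exp (- v\<^sup>2)) / sqrt pi" .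
  qed
  let ?z = "norm \<zeta>"
  have "(\<Sum>k<N. norm (\<zeta> ^ k / fact k * of_real (hermite_poly k y) :: complex)) =
      (\<Sum>k<N. ?z ^ k / fact k * \<bar>hermite_poly k y\<bar>)"
    by (simp add: norm_mult norm_divide norm_power)
  also have "\<dots> \<le> (\<Sum>k<N. ?z ^ k / fact k * ((LINT v|lborel. (2 * (\<bar>y\<bar> + \<bar>v\<bar>)) ^ k * exp (- v\<^sup>2)) / sqrt pi))"
    by (intro sum_mono mult_left_mono hb) auto
  also have "\<dots> = (\<Sum>k<N. (LINT v|lborel. ?z ^ k / fact k * ((2 * (\<bar>y\<bar> + \<bar>v\<bar>)) ^ k * exp (- v\<^sup>2)))) / sqrt pi"
    by (simp add: sum_divide_distrib)
  also have "\<dots> = (LINT v|lborel. (\<Sum>k<N. ?z ^ k / fact k * ((2 * (\<bar>y\<bar> + \<bar>v\<bar>)) ^ k * exp (- v\<^sup>2)))) / sqrt pi"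
    using hi by (subst Bochner_Integration.integral_sum) auto
  also have "\<dots> \<le> (LINT v|lborel. exp (2 * ?z * \<bar>y\<bar>) * (exp ((2 * ?z) * v - 1 * v\<^sup>2) + exp (- (2 * ?z) * v - 1 * v\<^sup>2))) / sqrt pi"
  proof (intro divide_right_mono integral_mono)
    show "integrable lborel (\<lambda>v. \<Sum>k<N. ?z ^ k / fact k * ((2 * (\<bar>y\<bar> + \<bar>v\<bar>)) ^ k * exp (- v\<^sup>2)))"
      using hi by auto
    show "integrable lborel (\<lambda>v. exp (2 * ?z * \<bar>y\<bar>) * (exp ((2 * ?z) * v - 1 * v\<^sup>2) + exp (- (2 * ?z) * v - 1 * v\<^sup>2)))"
      by (intro integrable_mult_right integrable_gaussian_majorant) simp
    fix v :: real
    define q where "q = 2 * (\<bar>y\<bar> + \<bar>v\<bar>)"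
    have q: "0 \<le> q" unfolding q_def by simp
    have nq: "norm (of_real (?z * q) ^ k / fact k :: complex) = ?z ^ k * q ^ k / fact k" for k
      using q by (simp only: norm_divide norm_power norm_of_real norm_fact abs_of_nonneg mult_nonneg_nonneg norm_ge_zero power_mult_distrib)
    have "(\<Sum>k<N. ?z ^ k / fact k * (q ^ k * exp (- v\<^sup>2))) =
       (\<Sum>k<N. norm (of_real (?z * q) ^ k / fact k :: complex)) * exp (- v\<^sup>2)"
      unfolding sum_distrib_right nq by (intro sum.cong) auto
    also have "\<dots> \<le> exp (norm (of_real (?z * q) :: complex)) * exp (- v\<^sup>2)"
      by (intro mult_right_mono sum_norm_exp_series_le) auto
    also have "\<dots> = exp (?z * q) * exp (- v\<^sup>2)" unfolding norm_of_real using q by (subst abs_of_nonneg) auto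
    also have "\<dots> = exp (2 * ?z * \<bar>y\<bar>) * exp ((2 * ?z) * \<bar>v\<bar> - 1 * v\<^sup>2)"
      unfolding q_def by (simp add: exp_add[symmetric] algebra_simps)
    also have "\<dots> \<le> exp (2 * ?z * \<bar>y\<bar>) * (exp ((2 * ?z) * v - 1 * v\<^sup>2) + exp (- (2 * ?z) * v - 1 * v\<^sup>2))"
      by (intro mult_left_mono) (cases "v \<ge> 0"; simp)+
    finally show "(\<Sum>k<N. ?z ^ k / fact k * ((2 * (\<bar>y\<bar> + \<bar>v\<bar>)) ^ k * exp (- v\<^sup>2)))
       \<le> exp (2 * ?z * \<bar>y\<bar>) * (exp ((2 * ?z) * v - 1 * v\<^sup>2) + exp (- (2 * ?z) * v - 1 * v\<^sup>2))"
      unfolding q_def .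
  qed simp
  also have "\<dots> = 2 * exp (2 * ?z * \<bar>y\<bar> + ?z\<^sup>2)"
  proof -
    have i: "integrable lborel (\<lambda>v. exp (c * v - 1 * v\<^sup>2))"
      and v: "(LINT v|lborel. exp (c * v - 1 * v\<^sup>2)) = sqrt pi * exp (c\<^sup>2 / 4)" for c
      using gaussian_real_has_integral[of 1 c] by (simp_all add: has_bochner_integral_iff)
    have e: "(2 * ?z)\<^sup>2 / 4 = ?z\<^sup>2" "(- (2 * ?z))\<^sup>2 / 4 = ?z\<^sup>2" by (simp_all add: power_mult_distrib)
    have I: "(LINT v|lborel. exp (2 * ?z * \<bar>y\<bar>) * (exp ((2 * ?z) * v - 1 * v\<^sup>2) + exp (- (2 * ?z) * v - 1 * v\<^sup>2)))
      = exp (2 * ?z * \<bar>y\<bar>) * (sqrt pi * exp (?z\<^sup>2) + sqrt pi * exp (?z\<^sup>2))"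
      unfolding integral_mult_right_zero Bochner_Integration.integral_add[OF i i] v e ..
    have cancel: "a * (c * b + c * b) / c = 2 * (a * b)" if "c \<noteq> 0" for a b c :: real
      using that by (simp add: field_simps)
    have "sqrt pi \<noteq> 0" by simp
    from cancel[OF this] show ?thesis unfolding I exp_add .
  qed
  finally show ?thesis .
qed

definition mehler_kernel :: "real \<Rightarrow> real \<Rightarrow> real \<Rightarrow> real" where
  "mehler_kernel r x y = exp (- ((1 + r\<^sup>2) / (1 - r\<^sup>2)) * (x\<^sup>2 + y\<^sup>2) / 2 + 2 * r / (1 - r\<^sup>2) * x * y) / sqrt (pi * (1 - r\<^sup>2))"

lemma hermite_fun_mult:
  "hermite_fun k x * hermite_fun k y =
     hermite_poly k x * hermite_poly k y / (2 ^ k * fact k) * (exp (- (x\<^sup>2 + y\<^sup>2) / 2) / sqrt pi)"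
proof -
  define c where "c = 2 ^ k * fact k * sqrt pi"
  have c: "c > 0" unfolding c_def by simp
  have "c powr (- 1 / 2) * c powr (- 1 / 2) = c powr (- 1 / 2 + - 1 / 2)" by (rule powr_add[symmetric])
  also have "\<dots> = 1 / c" using c by (simp add: powr_neg_one)
  finally have cc: "c powr (- 1 / 2) * c powr (- 1 / 2) = 1 / c" .
  have ac: "(p * A * e) * (p * B * e') = (p * p) * (A * B) * (e * e')" for p A B e e' :: real by simp
  have "hermite_fun k x * hermite_fun k y = 1 / c * (hermite_poly k x * hermite_poly k y) * (exp (- x\<^sup>2 / 2) * exp (- y\<^sup>2 / 2))"
    unfolding hermite_fun_def c_def[symmetric] ac cc ..
  moreover have "exp (- x\<^sup>2 / 2) * exp (- y\<^sup>2 / 2) = exp (- (x\<^sup>2 + y\<^sup>2) / 2)"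
    by (simp add: exp_add[symmetric] field_simps)
  ultimately show ?thesis unfolding c_def by simp
qed

text \<open>
  One of the two Hermite polynomials is replaced by its integral representation. The sum over \<open>k\<close> is then
  the generating function of the other one at \<open>z = r (x + i u)\<close>, and what remains is a Gaussian integral
  in \<open>u\<close>. Its exponent has leading coefficient \<open>1 - r\<^sup>2\<close>, which is where \<open>r < 1\<close> enters.
\<close>

theorem mehler_formula:
  assumes r: "0 \<le> r" "r < 1"
  shows "(\<lambda>k. r ^ k * (hermite_fun k x * hermite_fun k y)) sums mehler_kernel r x y"
proof -
  have r2: "r\<^sup>2 < 1" using r by (simp add: power_less_one_iff abs_square_less_1)
  define f where "f k u = (of_real r * Complex x u) ^ k / fact k * of_real (hermite_poly k y) * exp (- (complex_of_real u)\<^sup>2)" for k u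
  define s where "s u = exp (2 * (of_real r * Complex x u) * of_real y - (of_real r * Complex x u)\<^sup>2) * exp (- (complex_of_real u)\<^sup>2)" for u
  have meas: "f k \<in> borel_measurable lborel" for k unfolding f_def by measurable
  have sums: "(\<lambda>k. f k u) sums s u" for u
    unfolding f_def s_def
    using hermite_moment_generating(2)[where z = "of_real r * Complex x u" and x = y]
    by (intro sums_mult2) (simp add: hermite_moment_eq_poly mult.commute)
  have bd: "(\<Sum>k<N. norm (f k u)) \<le> 2 * exp (2 * \<bar>y\<bar> * \<bar>u\<bar> + (2 * \<bar>y\<bar> * \<bar>x\<bar> + x\<^sup>2) - (1 - r\<^sup>2) * u\<^sup>2)" for N u
  proof -
    let ?\<zeta> = "of_real r * Complex x u"
    have n1: "norm ?\<zeta> \<le> \<bar>x\<bar> + \<bar>u\<bar>"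
    proof -
      have "norm ?\<zeta> = r * norm (Complex x u)" using r by (simp add: norm_mult)
      also have "\<dots> \<le> 1 * norm (Complex x u)" using r by (intro mult_right_mono) auto
      finally show ?thesis using cmod_Complex_le[of x u] by simp
    qed
    have n2: "(norm ?\<zeta>)\<^sup>2 \<le> x\<^sup>2 + r\<^sup>2 * u\<^sup>2"
    proof -
      have "(norm ?\<zeta>)\<^sup>2 = r\<^sup>2 * x\<^sup>2 + r\<^sup>2 * u\<^sup>2" by (simp add: norm_mult power_mult_distrib cmod_power2 algebra_simps)
      moreover have "r\<^sup>2 * x\<^sup>2 \<le> 1 * x\<^sup>2" using r2 by (intro mult_right_mono) auto
      ultimately show ?thesis by simp
    qed
    have "(\<Sum>k<N. norm (f k u)) = (\<Sum>k<N. norm (?\<zeta> ^ k / fact k * of_real (hermite_poly k y))) * exp (- u\<^sup>2)"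
      unfolding f_def by (simp only: norm_mult[of _ "exp _"] norm_exp_neg_sq sum_distrib_right)
    also have "\<dots> \<le> 2 * exp (2 * norm ?\<zeta> * \<bar>y\<bar> + (norm ?\<zeta>)\<^sup>2) * exp (- u\<^sup>2)"
      by (intro mult_right_mono sum_norm_hermite_series_le) auto
    also have "\<dots> = 2 * exp (2 * norm ?\<zeta> * \<bar>y\<bar> + (norm ?\<zeta>)\<^sup>2 - u\<^sup>2)" by (simp add: exp_add[symmetric])
    also have "\<dots> \<le> 2 * exp (2 * \<bar>y\<bar> * \<bar>u\<bar> + (2 * \<bar>y\<bar> * \<bar>x\<bar> + x\<^sup>2) - (1 - r\<^sup>2) * u\<^sup>2)"
      using n2 mult_right_mono[OF n1, of "\<bar>y\<bar>"] by (simp add: algebra_simps)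
    finally show ?thesis .
  qed
  have int: "integrable lborel (\<lambda>u. 2 * exp (2 * \<bar>y\<bar> * \<bar>u\<bar> + (2 * \<bar>y\<bar> * \<bar>x\<bar> + x\<^sup>2) - (1 - r\<^sup>2) * u\<^sup>2))"
    using r2 by (intro integrable_mult_right integrable_exp_abs_gaussian) simp
  note d = sums_integral_dominated[OF meas sums bd int]
  have fi: "(LINT u|lborel. f k u) = of_real (sqrt pi * (r ^ k * (hermite_poly k x * hermite_poly k y / (2 ^ k * fact k))))" for k
  proof -
    have I: "(LINT u|lborel. (2 * Complex x u) ^ k * exp (- (complex_of_real u)\<^sup>2)) = of_real (sqrt pi) * hermite_moment k x"
      unfolding hermite_moment_def by simp
    have "(LINT u|lborel. f k u) = (LINT u|lborel. (of_real (r ^ k * hermite_poly k y / (2 ^ k * fact k))) * ((2 * Complex x u) ^ k * exp (- (complex_of_real u)\<^sup>2)))"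
      unfolding f_def by (intro Bochner_Integration.integral_cong) (auto simp: power_mult_distrib)
    also have "\<dots> = of_real (r ^ k * hermite_poly k y / (2 ^ k * fact k)) * (of_real (sqrt pi) * hermite_moment k x)"
      unfolding I integral_mult_right_zero ..
    finally show ?thesis by (simp add: hermite_moment_eq_poly)
  qed
  define E where "E = exp (2 * r * x * y - r\<^sup>2 * x\<^sup>2 - r\<^sup>2 * (y - r * x)\<^sup>2 / (1 - r\<^sup>2))"
  have si: "(LINT u|lborel. s u) = of_real (sqrt (pi / (1 - r\<^sup>2)) * E)"
  proof -
    let ?b = "2 * \<i> * of_real (r * (y - r * x))" and ?g = "complex_of_real (1 - r\<^sup>2)"
    have "(LINT u|lborel. s u) = (LINT u|lborel. of_real (exp (2 * r * x * y - r\<^sup>2 * x\<^sup>2)) * exp (?b * complex_of_real u - ?g * (complex_of_real u)\<^sup>2))"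
      unfolding s_def
      by (intro Bochner_Integration.integral_cong)
         (auto simp: Complex_eq algebra_simps power2_eq_square simp flip: exp_add exp_of_real)
    also have "\<dots> = of_real (exp (2 * r * x * y - r\<^sup>2 * x\<^sup>2)) * (csqrt (of_real pi / ?g) * exp (?b\<^sup>2 / (4 * ?g)))"
      using gaussian_has_integral[of ?g ?b] r2 by (simp add: has_bochner_integral_iff)
    also have "csqrt (of_real pi / ?g) = of_real (sqrt (pi / (1 - r\<^sup>2)))"
      using r2 by (subst of_real_divide[symmetric], subst csqrt_of_real_nonneg) auto
    also have "?b\<^sup>2 / (4 * ?g) = of_real (- (r\<^sup>2 * (y - r * x)\<^sup>2 / (1 - r\<^sup>2)))"
    proof -
      define c where "c = r * (y - r * x)"
      define g where "g = 1 - r\<^sup>2"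
      have "(2 * \<i> * of_real c)\<^sup>2 / (4 * complex_of_real g) = of_real (- (c\<^sup>2 / g))"
        by (simp add: power_mult_distrib)
      then show ?thesis unfolding c_def g_def power_mult_distrib[of r] .
    qed
    finally have "(LINT u|lborel. s u) = of_real (exp (2 * r * x * y - r\<^sup>2 * x\<^sup>2)) *
        (of_real (sqrt (pi / (1 - r\<^sup>2))) * exp (of_real (- (r\<^sup>2 * (y - r * x)\<^sup>2 / (1 - r\<^sup>2)))))" .
    also have "\<dots> = of_real (sqrt (pi / (1 - r\<^sup>2)) * (exp (2 * r * x * y - r\<^sup>2 * x\<^sup>2) * exp (- (r\<^sup>2 * (y - r * x)\<^sup>2 / (1 - r\<^sup>2)))))"
      by (simp only: exp_of_real of_real_mult mult_ac)
    also have "exp (2 * r * x * y - r\<^sup>2 * x\<^sup>2) * exp (- (r\<^sup>2 * (y - r * x)\<^sup>2 / (1 - r\<^sup>2))) = E"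
      unfolding E_def exp_add[symmetric] by simp
    finally show ?thesis .
  qed
  have "(\<lambda>k. sqrt pi * (r ^ k * (hermite_poly k x * hermite_poly k y / (2 ^ k * fact k)))) sums (sqrt (pi / (1 - r\<^sup>2)) * E)"
    using d(3) unfolding fi si sums_of_real_iff .
  then have "(\<lambda>k. (exp (- (x\<^sup>2 + y\<^sup>2) / 2) / pi) * (sqrt pi * (r ^ k * (hermite_poly k x * hermite_poly k y / (2 ^ k * fact k))))) sums
     ((exp (- (x\<^sup>2 + y\<^sup>2) / 2) / pi) * (sqrt (pi / (1 - r\<^sup>2)) * E))" by (rule sums_mult)
  moreover have "(exp (- (x\<^sup>2 + y\<^sup>2) / 2) / pi) * (sqrt pi * (r ^ k * (hermite_poly k x * hermite_poly k y / (2 ^ k * fact k))))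
     = r ^ k * (hermite_fun k x * hermite_fun k y)" for k
    unfolding hermite_fun_mult by (simp add: field_simps)
  moreover have "(exp (- (x\<^sup>2 + y\<^sup>2) / 2) / pi) * (sqrt (pi / (1 - r\<^sup>2)) * E) = mehler_kernel r x y"
  proof -
    have p: "sqrt (pi / (1 - r\<^sup>2)) / pi = 1 / sqrt (pi * (1 - r\<^sup>2))"
    proof -
      have "sqrt (pi / g) / pi = 1 / sqrt (pi * g)" if "g > 0" for g
        using that by (simp add: real_sqrt_divide real_sqrt_mult field_simps)
      then show ?thesis using r2 by simp
    qed
    have ex: "- (x\<^sup>2 + y\<^sup>2) / 2 + (2 * r * x * y - r\<^sup>2 * x\<^sup>2 - r\<^sup>2 * (y - r * x)\<^sup>2 / (1 - r\<^sup>2)) =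
       - ((1 + r\<^sup>2) / (1 - r\<^sup>2)) * (x\<^sup>2 + y\<^sup>2) / 2 + 2 * r / (1 - r\<^sup>2) * x * y"
    proof -
      have "1 - r\<^sup>2 \<noteq> 0" using r2 by simp
      then show ?thesis by (simp add: divide_simps) (simp add: algebra_simps power2_eq_square)
    qed
    have "(exp (- (x\<^sup>2 + y\<^sup>2) / 2) / pi) * (sqrt (pi / (1 - r\<^sup>2)) * E) = (sqrt (pi / (1 - r\<^sup>2)) / pi) * (exp (- (x\<^sup>2 + y\<^sup>2) / 2) * E)"
      by simp
    also have "\<dots> = mehler_kernel r x y"
      unfolding p E_def exp_add[symmetric] ex mehler_kernel_def by simp
    finally show ?thesis .
  qed
  ultimately show ?thesis by simp
qed

text \<open>
  All terms of Mehler's series on the diagonal are nonnegative, so each is at most the sum. At \<open>r = 1/2\<close>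
  the kernel on the diagonal decays like \<open>exp (- x\<^sup>2 / 3)\<close>.
\<close>

lemma hermite_fun_bound:
  "\<bar>hermite_fun k x * hermite_fun k y\<bar> \<le> 2 ^ k * exp (- x\<^sup>2 / 6 - y\<^sup>2 / 6)"
proof -
  have sq: "(hermite_fun k x)\<^sup>2 \<le> 2 ^ k * exp (- x\<^sup>2 / 3)" for x
  proof -
    have s: "(\<lambda>k. (1/2) ^ k * (hermite_fun k x * hermite_fun k x)) sums mehler_kernel (1/2) x x"
      by (rule mehler_formula) auto
    have "(\<Sum>i\<in>{k}. (1/2) ^ i * (hermite_fun i x * hermite_fun i x)) \<le> (\<Sum>i. (1/2) ^ i * (hermite_fun i x * hermite_fun i x))"
      using s by (intro sum_le_suminf) (auto simp: sums_iff)
    then have "(1/2) ^ k * (hermite_fun k x)\<^sup>2 \<le> mehler_kernel (1/2) x x"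
      using s by (simp add: sums_iff power2_eq_square)
    also have "mehler_kernel (1/2) x x = exp (- x\<^sup>2 / 3) / sqrt (pi * (3 / 4))"
      unfolding mehler_kernel_def by (simp add: power2_eq_square field_simps)
    also have "\<dots> \<le> exp (- x\<^sup>2 / 3)"
    proof -
      have "1 \<le> sqrt (pi * (3 / 4))" using pi_gt3 by simp
      then show ?thesis by (simp add: divide_le_eq)
    qed
    finally have "(1/2) ^ k * (hermite_fun k x)\<^sup>2 \<le> exp (- x\<^sup>2 / 3)" .
    then have "2 ^ k * ((1/2) ^ k * (hermite_fun k x)\<^sup>2) \<le> 2 ^ k * exp (- x\<^sup>2 / 3)" by (intro mult_left_mono) auto
    then show ?thesis by (simp add: power_divide)
  qed
  have "(hermite_fun k x * hermite_fun k y)\<^sup>2 \<le> (2 ^ k * exp (- x\<^sup>2 / 3)) * (2 ^ k * exp (- y\<^sup>2 / 3))"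
    unfolding power_mult_distrib by (intro mult_mono sq) auto
  also have "\<dots> = (2 ^ k * exp (- x\<^sup>2 / 6 - y\<^sup>2 / 6))\<^sup>2"
    by (simp add: power2_eq_square exp_add[symmetric] exp_diff algebra_simps)
  finally show ?thesis by (metis abs_le_square_iff abs_of_nonneg exp_ge_zero mult_nonneg_nonneg zero_le_numeral zero_le_power)
qed

section \<open>The Mehler kernel on \<open>\<real>\<^sup>n\<close> and its rotation\<close>

lemma infinite_UNIV_fun_nat: "infinite (UNIV :: ('n::finite \<Rightarrow> nat) set)"
proof
  assume "finite (UNIV :: ('n \<Rightarrow> nat) set)"
  then have "finite (range (\<lambda>k::nat. (\<lambda>_::'n. k)))" by (rule finite_subset[OF subset_UNIV])
  then have "finite (UNIV :: nat set)" by (rule finite_imageD) (auto simp: inj_on_def fun_eq_iff)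
  then show False by simp
qed

lemma has_sum_geometric_multi:
  "((\<lambda>\<alpha>::'n::finite \<Rightarrow> nat. \<Prod>j\<in>UNIV. (1/2::real) ^ \<alpha> j) has_sum 2 ^ CARD('n)) UNIV"
proof -
  have g: "(\<lambda>k. norm ((1/2::real) ^ k)) summable_on UNIV" "infsum (\<lambda>k. (1/2::real) ^ k) UNIV = 2"
  proof -
    have s: "(\<lambda>k. (1/2::real) ^ k) sums 2" using geometric_sums[of "1/2::real"] by simp
    then have "((\<lambda>k. (1/2::real) ^ k) has_sum 2) UNIV"
      by (intro norm_summable_imp_has_sum) (auto simp: sums_iff)
    then show "(\<lambda>k. norm ((1/2::real) ^ k)) summable_on UNIV" "infsum (\<lambda>k. (1/2::real) ^ k) UNIV = 2"
      by (auto simp: infsumI has_sum_imp_summable)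
  qed
  have "infsum (\<lambda>\<alpha>::'n \<Rightarrow> nat. \<Prod>j\<in>UNIV. (1/2::real) ^ \<alpha> j) (PiE UNIV (\<lambda>_. UNIV)) = (\<Prod>j\<in>(UNIV::'n set). 2)"
    using g by (subst infsum_prod_PiE_abs) auto
  then have i: "infsum (\<lambda>\<alpha>::'n \<Rightarrow> nat. \<Prod>j\<in>UNIV. (1/2::real) ^ \<alpha> j) UNIV = 2 ^ CARD('n)"
    by simp
  then have "(\<lambda>\<alpha>::'n \<Rightarrow> nat. \<Prod>j\<in>UNIV. (1/2::real) ^ \<alpha> j) summable_on UNIV"
    using infsum_not_exists by fastforce
  from has_sum_infsum[OF this] show ?thesis unfolding i .
qed

text \<open>
  The bound for products of Hermite functions costs a factor \<open>2\<^sup>k\<close>, so weights up to \<open>1/4\<close> leave a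
  geometric series of ratio \<open>1/2\<close> in every coordinate. This crude range suffices, as larger weights are
  reached by analytic continuation.
\<close>

lemma mehler_vec:
  fixes r :: "'n::finite \<Rightarrow> real" and x y :: "real ^ 'n"
  assumes r: "\<And>j. 0 \<le> r j" "\<And>j. r j \<le> 1/4"
  shows mehler_vec_majorant: "finite F \<Longrightarrow> (\<Sum>\<alpha>\<in>F. norm ((\<Prod>j\<in>UNIV. r j ^ \<alpha> j) * (hermite_Phi \<alpha> x * hermite_Phi \<alpha> y)))
           \<le> 2 ^ CARD('n) * (exp (- (x \<bullet> x) / 6) * exp (- (y \<bullet> y) / 6))"
    and mehler_vec_has_sum: "((\<lambda>\<alpha>. (\<Prod>j\<in>UNIV. r j ^ \<alpha> j) * (hermite_Phi \<alpha> x * hermite_Phi \<alpha> y)) has_sum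
           (\<Prod>j\<in>UNIV. mehler_kernel (r j) (x $ j) (y $ j))) UNIV"
proof -
  let ?t = "\<lambda>j k. r j ^ k * (hermite_fun k (x $ j) * hermite_fun k (y $ j))"
  let ?G = "exp (- (x \<bullet> x) / 6) * exp (- (y \<bullet> y) / 6)"
  have eq: "(\<Prod>j\<in>UNIV. r j ^ \<alpha> j) * (hermite_Phi \<alpha> x * hermite_Phi \<alpha> y) = (\<Prod>j\<in>UNIV. ?t j (\<alpha> j))" for \<alpha>
    unfolding hermite_Phi_def by (simp add: prod.distrib)
  have G: "(\<Prod>j\<in>UNIV. exp (- (x $ j)\<^sup>2 / 6 - (y $ j)\<^sup>2 / 6)) = ?G"
    unfolding exp_sum[OF finite, symmetric] exp_add[symmetric]
    by (simp add: inner_vec_def sum_subtractf sum_negf sum_divide_distrib power2_eq_square)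
  have tb: "norm (?t j k) \<le> (1/2) ^ k * exp (- (x $ j)\<^sup>2 / 6 - (y $ j)\<^sup>2 / 6)" for j k
  proof -
    have "norm (?t j k) = r j ^ k * \<bar>hermite_fun k (x $ j) * hermite_fun k (y $ j)\<bar>"
      using r(1)[of j] by (simp add: abs_mult)
    also have "\<dots> \<le> (1/4) ^ k * (2 ^ k * exp (- (x $ j)\<^sup>2 / 6 - (y $ j)\<^sup>2 / 6))"
      using r by (intro mult_mono power_mono hermite_fun_bound) auto
    also have "(1/4::real) ^ k * (2 ^ k * exp (- (x $ j)\<^sup>2 / 6 - (y $ j)\<^sup>2 / 6)) = ((1/4) * 2) ^ k * exp (- (x $ j)\<^sup>2 / 6 - (y $ j)\<^sup>2 / 6)"
      by (simp only: power_mult_distrib mult.assoc)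
    finally show ?thesis by simp
  qed
  have b: "norm (\<Prod>j\<in>UNIV. ?t j (\<alpha> j)) \<le> (\<Prod>j\<in>UNIV. (1/2) ^ \<alpha> j) * ?G" for \<alpha>
  proof -
    have "norm (\<Prod>j\<in>UNIV. ?t j (\<alpha> j)) = (\<Prod>j\<in>UNIV. norm (?t j (\<alpha> j)))" by (rule prod_norm[symmetric])
    also have "\<dots> \<le> (\<Prod>j\<in>UNIV. (1/2) ^ \<alpha> j * exp (- (x $ j)\<^sup>2 / 6 - (y $ j)\<^sup>2 / 6))"
      by (intro prod_mono conjI tb norm_ge_zero)
    also have "\<dots> = (\<Prod>j\<in>UNIV. (1/2) ^ \<alpha> j) * ?G" unfolding prod.distrib G ..
    finally show ?thesis .
  qed
  have fin: "(\<Sum>\<alpha>\<in>F. (\<Prod>j\<in>UNIV. (1/2::real) ^ \<alpha> j)) \<le> 2 ^ CARD('n)" if "finite F" for F :: "('n \<Rightarrow> nat) set"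
    using that by (intro finite_sum_le_has_sum[OF has_sum_geometric_multi]) (auto intro!: prod_nonneg)
  show "(\<Sum>\<alpha>\<in>F. norm ((\<Prod>j\<in>UNIV. r j ^ \<alpha> j) * (hermite_Phi \<alpha> x * hermite_Phi \<alpha> y))) \<le> 2 ^ CARD('n) * ?G" if "finite F"
  proof -
    have "(\<Sum>\<alpha>\<in>F. norm (\<Prod>j\<in>UNIV. ?t j (\<alpha> j))) \<le> (\<Sum>\<alpha>\<in>F. (\<Prod>j\<in>UNIV. (1/2) ^ \<alpha> j) * ?G)" by (intro sum_mono b)
    also have "\<dots> = (\<Sum>\<alpha>\<in>F. (\<Prod>j\<in>UNIV. (1/2::real) ^ \<alpha> j)) * ?G" by (rule sum_distrib_right[symmetric])
    also have "\<dots> \<le> 2 ^ CARD('n) * ?G" by (intro mult_right_mono fin that) auto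
    finally show ?thesis unfolding eq .
  qed
  have abs1: "(\<lambda>k. norm (?t j k)) summable_on UNIV" and inf1: "infsum (?t j) UNIV = mehler_kernel (r j) (x $ j) (y $ j)" for j
  proof -
    have gs: "summable (\<lambda>k. (1/2) ^ k * exp (- (x $ j)\<^sup>2 / 6 - (y $ j)\<^sup>2 / 6))"
      by (intro summable_mult2 summable_geometric) simp
    have sn: "summable (\<lambda>k. norm (?t j k))"
      by (rule summable_comparison_test'[OF gs, of 0]) (use tb[of j] in auto)
    have "(\<lambda>k. ?t j k) sums mehler_kernel (r j) (x $ j) (y $ j)"
      using r(1)[of j] r(2)[of j] by (intro mehler_formula) auto
    with sn have "(?t j has_sum mehler_kernel (r j) (x $ j) (y $ j)) UNIV" by (rule norm_summable_imp_has_sum)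
    then show "infsum (?t j) UNIV = mehler_kernel (r j) (x $ j) (y $ j)" by (rule infsumI)
    show "(\<lambda>k. norm (?t j k)) summable_on UNIV" using sn by (simp add: norm_summable_imp_summable_on)
  qed
  have "infsum (\<lambda>\<alpha>. \<Prod>j\<in>UNIV. ?t j (\<alpha> j)) (PiE UNIV (\<lambda>_. UNIV)) = (\<Prod>j\<in>UNIV. infsum (?t j) UNIV)"
    using abs1 by (intro infsum_prod_PiE_abs) auto
  then have i: "infsum (\<lambda>\<alpha>. \<Prod>j\<in>UNIV. ?t j (\<alpha> j)) UNIV = (\<Prod>j\<in>UNIV. mehler_kernel (r j) (x $ j) (y $ j))"
    unfolding inf1 by simp
  have "(\<lambda>\<alpha>::'n \<Rightarrow> nat. (\<Prod>j\<in>UNIV. (1/2::real) ^ \<alpha> j) * ?G) summable_on UNIV"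
    using has_sum_imp_summable[OF has_sum_geometric_multi] by (intro summable_on_cmult_left) auto
  then have "(\<lambda>\<alpha>. norm (\<Prod>j\<in>UNIV. ?t j (\<alpha> j))) summable_on UNIV"
    by (rule Infinite_Sum.abs_summable_on_comparison_test') (rule b)
  then have "(\<lambda>\<alpha>. \<Prod>j\<in>UNIV. ?t j (\<alpha> j)) summable_on UNIV" by (rule abs_summable_summable)
  from has_sum_infsum[OF this] show "((\<lambda>\<alpha>. (\<Prod>j\<in>UNIV. r j ^ \<alpha> j) * (hermite_Phi \<alpha> x * hermite_Phi \<alpha> y)) has_sum
           (\<Prod>j\<in>UNIV. mehler_kernel (r j) (x $ j) (y $ j))) UNIV"
    unfolding eq i .
qed

text \<open>
  This is the Mehler kernel at the imaginary weight \<open>i \<rho>\<close>. It stays regular when a real weight \<open>\<rho>\<close>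
  passes through 1, and it is holomorphic in \<open>\<rho>\<close> where \<open>1 + \<rho>\<^sup>2\<close> has positive real part.
\<close>

definition rotated_mehler_kernel :: "complex \<Rightarrow> real \<Rightarrow> real \<Rightarrow> complex" where
  "rotated_mehler_kernel \<rho> x y =
     exp ((\<rho>\<^sup>2 - 1) / (1 + \<rho>\<^sup>2) * of_real ((x\<^sup>2 + y\<^sup>2) / 2) + 2 * \<i> * \<rho> / (1 + \<rho>\<^sup>2) * of_real (x * y)) / csqrt (of_real pi * (1 + \<rho>\<^sup>2))"

lemma rotated_mehler_kernel_measurable [measurable]:
  "(\<lambda>x. rotated_mehler_kernel \<rho> (f x) (g x)) \<in> borel_measurable M"
  if [measurable]: "f \<in> borel_measurable M" "g \<in> borel_measurable M"
  unfolding rotated_mehler_kernel_def by measurable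

text \<open>
  The Fourier transform multiplies the \<open>k\<close>-th Hermite function by \<open>(- i)\<^sup>k\<close>, so it must turn the weight
  \<open>i r\<close> into \<open>r\<close>. The proof evaluates the Gaussian integral; the exponents match because
  \<open>A\<^sup>2 + B\<^sup>2 = 1\<close>.
\<close>

lemma fourier_rotated_mehler_kernel:
  fixes r x y :: real
  assumes r: "0 \<le> r" "r < 1"
  shows "has_bochner_integral lborel (\<lambda>\<xi>. rotated_mehler_kernel (of_real r) \<xi> y * exp (- \<i> * of_real (x * \<xi>)))
     (of_real (sqrt (2 * pi) * mehler_kernel r x y))"
proof -
  have r2: "r\<^sup>2 < 1" using r by (simp add: abs_square_less_1)
  define A where "A = (1 - r\<^sup>2) / (1 + r\<^sup>2)"
  define B where "B = 2 * r / (1 + r\<^sup>2)"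
  define D where "D = sqrt (pi * (1 + r\<^sup>2))"
  have p: "1 + r\<^sup>2 > 0" "1 - r\<^sup>2 > 0" using r2 by (auto intro: add_pos_nonneg)
  have A: "A > 0" unfolding A_def using p by simp
  have D: "csqrt (of_real pi * (1 + (of_real r)\<^sup>2)) = of_real D"
  proof -
    have "of_real pi * (1 + (of_real r)\<^sup>2) = complex_of_real (pi * (1 + r\<^sup>2))" by simp
    then show ?thesis unfolding D_def using p by (simp only: csqrt_of_real_nonneg) (subst csqrt_of_real_nonneg; simp)
  qed
  let ?b = "\<i> * of_real (B * y - x)" and ?g = "complex_of_real (A / 2)"
  have eq: "rotated_mehler_kernel (of_real r) \<xi> y * exp (- \<i> * of_real (x * \<xi>)) =
      of_real (exp (- A * y\<^sup>2 / 2) / D) * exp (?b * of_real \<xi> - ?g * (of_real \<xi>)\<^sup>2)" for \<xi>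
  proof -
    have c1: "((complex_of_real r)\<^sup>2 - 1) / (1 + (of_real r)\<^sup>2) = of_real (- A)"
      unfolding A_def by (simp add: minus_divide_left)
    have c2: "2 * \<i> * complex_of_real r / (1 + (of_real r)\<^sup>2) = \<i> * of_real B"
      unfolding B_def by simp
    have "rotated_mehler_kernel (of_real r) \<xi> y * exp (- \<i> * of_real (x * \<xi>)) =
      exp (of_real (- A) * of_real ((\<xi>\<^sup>2 + y\<^sup>2) / 2) + \<i> * of_real B * of_real (\<xi> * y) + (- \<i> * of_real (x * \<xi>))) / of_real D"
      unfolding rotated_mehler_kernel_def c1 c2 D by (simp only: exp_add[symmetric] times_divide_eq_left)
    also have "of_real (- A) * of_real ((\<xi>\<^sup>2 + y\<^sup>2) / 2) + \<i> * of_real B * of_real (\<xi> * y) + (- \<i> * of_real (x * \<xi>)) =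
       of_real (- A * y\<^sup>2 / 2) + (?b * of_real \<xi> - ?g * (of_real \<xi>)\<^sup>2)"
      by (simp add: field_simps)
    finally show ?thesis unfolding exp_add by (simp flip: exp_of_real)
  qed
  have hb: "has_bochner_integral lborel (\<lambda>\<xi>. exp (?b * of_real \<xi> - ?g * (of_real \<xi>)\<^sup>2)) (csqrt (of_real pi / ?g) * exp (?b\<^sup>2 / (4 * ?g)))"
    using A by (intro gaussian_has_integral) simp
  have v1: "csqrt (of_real pi / ?g) = of_real (sqrt (2 * pi / A))"
    using A by (subst of_real_divide[symmetric], subst csqrt_of_real_nonneg) (auto simp: field_simps)
  have v2: "exp (?b\<^sup>2 / (4 * ?g)) = of_real (exp (- (B * y - x)\<^sup>2 / (2 * A)))"
  proof -
    have "?b\<^sup>2 / (4 * ?g) = of_real (- (B * y - x)\<^sup>2 / (2 * A))" by (simp add: power_mult_distrib)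
    then show ?thesis by (simp only: exp_of_real)
  qed
  have val: "exp (- A * y\<^sup>2 / 2) / D * (sqrt (2 * pi / A) * exp (- (B * y - x)\<^sup>2 / (2 * A))) = sqrt (2 * pi) * mehler_kernel r x y"
  proof -
    have q: "sqrt (2 * pi / A) / D = sqrt (2 * pi) / sqrt (pi * (1 - r\<^sup>2))"
    proof -
      have "sqrt (2 * pi / (u / v)) / sqrt (pi * v) = sqrt (2 * pi) / sqrt (pi * u)" if "u > 0" "v > 0" for u v
        using that by (simp add: real_sqrt_divide real_sqrt_mult field_simps)
      then show ?thesis unfolding A_def D_def using p by blast
    qed
    have e: "- A * y\<^sup>2 / 2 + (- (B * y - x)\<^sup>2 / (2 * A)) =
        - ((1 + r\<^sup>2) / (1 - r\<^sup>2)) * (x\<^sup>2 + y\<^sup>2) / 2 + 2 * r / (1 - r\<^sup>2) * x * y"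
    proof -
      have e1: "A\<^sup>2 + B\<^sup>2 = 1"
        unfolding A_def B_def using p by (simp add: divide_simps power_divide) (simp add: algebra_simps power2_eq_square)
      have e2: "1 / A = (1 + r\<^sup>2) / (1 - r\<^sup>2)" unfolding A_def by simp
      have "(u / P) / (Q / P) = u / Q" if "P > 0" for u P Q :: real using that by simp
      then have e3: "B / A = 2 * r / (1 - r\<^sup>2)" unfolding A_def B_def using p(1) .
      have "- A * y\<^sup>2 / 2 + (- (B * y - x)\<^sup>2 / (2 * A)) = - ((A\<^sup>2 + B\<^sup>2) * y\<^sup>2 + x\<^sup>2) / (2 * A) + B / A * x * y"
        using A by (simp add: field_simps power2_eq_square)
      also have "\<dots> = - (1 / A) * (x\<^sup>2 + y\<^sup>2) / 2 + B / A * x * y" unfolding e1 using A by (simp add: field_simps)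
      finally show ?thesis unfolding e2 e3 .
    qed
    have ac: "u / D * (w * u') = (w / D) * (u * u')" for u u' w by simp
    show ?thesis unfolding ac q exp_add[symmetric] e mehler_kernel_def by simp
  qed
  have "has_bochner_integral lborel (\<lambda>\<xi>. of_real (exp (- A * y\<^sup>2 / 2) / D) * exp (?b * of_real \<xi> - ?g * (of_real \<xi>)\<^sup>2))
     (of_real (exp (- A * y\<^sup>2 / 2) / D) * (csqrt (of_real pi / ?g) * exp (?b\<^sup>2 / (4 * ?g))))"
    using hb by (rule has_bochner_integral_mult_right)
  then show ?thesis unfolding eq v1 v2 of_real_mult[symmetric] val .
qed

section \<open>The Fourier transform on \<open>L\<^sup>2\<close>\<close>

lemma borel_measurable_vec_nth_comp [measurable (raw)]:
  fixes f :: "'a \<Rightarrow> real ^ 'n::finite"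
  assumes "f \<in> borel_measurable M"
  shows "(\<lambda>x. f x $ j) \<in> borel_measurable M"
  by (rule borel_measurable_continuous_on[OF _ assms]) (intro continuous_intros)

lemma borel_measurable_cnj_comp [measurable (raw)]:
  fixes f :: "'a \<Rightarrow> complex"
  assumes "f \<in> borel_measurable M"
  shows "(\<lambda>x. cnj (f x)) \<in> borel_measurable M"
  by (rule borel_measurable_continuous_on[OF _ assms]) (intro continuous_intros)

lemma gaussian_vec_has_integral:
  fixes b \<gamma> :: "'n::finite \<Rightarrow> complex"
  assumes "\<And>j. Re (\<gamma> j) > 0"
  shows "has_bochner_integral (lborel :: (real ^ 'n) measure)
    (\<lambda>v. \<Prod>j\<in>UNIV. exp (b j * of_real (v $ j) - \<gamma> j * (of_real (v $ j))\<^sup>2))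
    (\<Prod>j\<in>UNIV. csqrt (of_real pi / \<gamma> j) * exp ((b j)\<^sup>2 / (4 * \<gamma> j)))"
proof -
  have g: "has_bochner_integral lborel (\<lambda>v. exp (b j * of_real v - \<gamma> j * (of_real v)\<^sup>2))
      (csqrt (of_real pi / \<gamma> j) * exp ((b j)\<^sup>2 / (4 * \<gamma> j)))" for j
    using assms by (rule gaussian_has_integral)
  then have "integrable lborel (\<lambda>v. exp (b j * complex_of_real v - \<gamma> j * (of_real v)\<^sup>2))"
    "(LINT v|lborel. exp (b j * complex_of_real v - \<gamma> j * (of_real v)\<^sup>2)) = csqrt (of_real pi / \<gamma> j) * exp ((b j)\<^sup>2 / (4 * \<gamma> j))" for j
    by (auto simp: has_bochner_integral_iff)
  with lborel_vec_prod_integral[of "\<lambda>j v. exp (b j * of_real v - \<gamma> j * (of_real v)\<^sup>2)"]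
  show ?thesis by simp
qed

lemma fubini_bounded_kernel:
  fixes F \<Psi> :: "'a::euclidean_space \<Rightarrow> complex" and k :: "'a \<Rightarrow> 'a \<Rightarrow> complex"
  assumes F: "integrable lborel F" and \<Psi>: "integrable lborel \<Psi>"
    and k [measurable]: "(\<lambda>p. k (fst p) (snd p)) \<in> borel_measurable (borel \<Otimes>\<^sub>M borel)"
    and k1: "\<And>x y. norm (k x y) \<le> 1"
  shows "(LINT x|lborel. F x * (LINT y|lborel. \<Psi> y * k x y)) = (LINT y|lborel. (LINT x|lborel. F x * k x y) * \<Psi> y)"
proof -
  have [measurable]: "F \<in> borel_measurable borel" "\<Psi> \<in> borel_measurable borel"
    using F \<Psi> by (auto dest: borel_measurable_integrable)
  have k2 [measurable]: "k x \<in> borel_measurable borel" for x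
    using measurable_compose[OF measurable_Pair1' k, of x] by simp
  have i1: "integrable lborel (\<lambda>y. F x * \<Psi> y * k x y)" for x
  proof (rule Bochner_Integration.integrable_bound)
    show "integrable lborel (\<lambda>y. F x * \<Psi> y)" using \<Psi> by simp
    show "(\<lambda>y. F x * \<Psi> y * k x y) \<in> borel_measurable lborel" by measurable
    show "AE y in lborel. norm (F x * \<Psi> y * k x y) \<le> norm (F x * \<Psi> y)"
      using k1 by (intro AE_I2) (simp add: norm_mult mult_left_le)
  qed
  have mp: "(\<lambda>p. F (fst p) * \<Psi> (snd p) * k (fst p) (snd p)) \<in> borel_measurable (lborel \<Otimes>\<^sub>M lborel)"
    by measurable
  have "integrable (lborel \<Otimes>\<^sub>M lborel) (\<lambda>p. F (fst p) * \<Psi> (snd p) * k (fst p) (snd p))"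
  proof (rule lborel_pair.Fubini_integrable[OF mp])
    show "AE x in lborel. integrable lborel (\<lambda>y. F (fst (x, y)) * \<Psi> (snd (x, y)) * k (fst (x, y)) (snd (x, y)))"
      using i1 by simp
    show "integrable lborel (\<lambda>x. LINT y|lborel. norm (F (fst (x, y)) * \<Psi> (snd (x, y)) * k (fst (x, y)) (snd (x, y))))"
    proof (rule Bochner_Integration.integrable_bound)
      show "integrable lborel (\<lambda>x. norm (F x) * (LINT y|lborel. norm (\<Psi> y)))" using F by simp
      show "(\<lambda>x. LINT y|lborel. norm (F (fst (x, y)) * \<Psi> (snd (x, y)) * k (fst (x, y)) (snd (x, y)))) \<in> borel_measurable lborel"
        by measurable
      show "AE x in lborel. norm (LINT y|lborel. norm (F (fst (x, y)) * \<Psi> (snd (x, y)) * k (fst (x, y)) (snd (x, y))))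
         \<le> norm (norm (F x) * (LINT y|lborel. norm (\<Psi> y)))"
      proof (rule AE_I2)
        fix x
        have "(LINT y|lborel. norm (F x * \<Psi> y * k x y)) \<le> (LINT y|lborel. norm (F x) * norm (\<Psi> y))"
          using integrable_norm[OF i1[of x]] \<Psi> k1 by (intro integral_mono) (auto simp: norm_mult mult_left_le)
        then show "norm (LINT y|lborel. norm (F (fst (x, y)) * \<Psi> (snd (x, y)) * k (fst (x, y)) (snd (x, y))))
         \<le> norm (norm (F x) * (LINT y|lborel. norm (\<Psi> y)))" by (simp add: abs_mult)
      qed
    qed
  qed
  then have "integrable (lborel \<Otimes>\<^sub>M lborel) (\<lambda>(x, y). F x * \<Psi> y * k x y)" by (simp add: case_prod_unfold)
  from lborel_pair.Fubini_integral[OF this]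
  have "(LINT y|lborel. (LINT x|lborel. F x * \<Psi> y * k x y)) = (LINT x|lborel. (LINT y|lborel. F x * \<Psi> y * k x y))" .
  moreover have "(LINT y|lborel. F x * \<Psi> y * k x y) = F x * (LINT y|lborel. \<Psi> y * k x y)" for x
    by (subst integral_mult_right_zero[symmetric]) (simp add: mult.assoc)
  moreover have "(LINT x|lborel. F x * \<Psi> y * k x y) = (LINT x|lborel. F x * k x y) * \<Psi> y" for y
    by (subst integral_mult_left_zero[symmetric]) (simp add: mult_ac)
  ultimately show ?thesis by simp
qed

abbreviation (input) fourier_const :: "'n::finite itself \<Rightarrow> complex" where
  "fourier_const _ \<equiv> complex_of_real ((2 * pi) powr (- real CARD('n) / 2))"

lemma fourier_L1_lborel:
  fixes F :: "real ^ 'n::finite \<Rightarrow> complex"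
  assumes [measurable]: "F \<in> borel_measurable borel"
  shows "fourier_L1 F y = fourier_const TYPE('n) * (LINT x|lborel. F x * exp (- \<i> * complex_of_real (x \<bullet> y)))"
  unfolding fourier_L1_def by (subst integral_completion) auto

lemma fourier_L1_measurable [measurable]:
  fixes F :: "real ^ 'n::finite \<Rightarrow> complex"
  assumes [measurable]: "F \<in> borel_measurable borel"
  shows "fourier_L1 F \<in> borel_measurable borel"
proof -
  have "fourier_L1 F = (\<lambda>y. fourier_const TYPE('n) * (LINT x|lborel. F x * exp (- \<i> * complex_of_real (x \<bullet> y))))"
    using fourier_L1_lborel[OF assms] by auto
  also have "\<dots> \<in> borel_measurable borel" by measurable
  finally show ?thesis .
qed

lemma fourier_L1_multiplication:
  fixes F \<Psi> :: "real ^ 'n::finite \<Rightarrow> complex"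
  assumes F: "integrable lborel F" and \<Psi>: "integrable lborel \<Psi>"
  shows "(LINT x|lborel. F x * fourier_L1 \<Psi> x) = (LINT y|lborel. fourier_L1 F y * \<Psi> y)"
proof -
  have m: "F \<in> borel_measurable borel" "\<Psi> \<in> borel_measurable borel"
    using F \<Psi> by (auto dest: borel_measurable_integrable)
  let ?k = "\<lambda>x y :: real ^ 'n. exp (- \<i> * complex_of_real (x \<bullet> y))"
  let ?c = "fourier_const TYPE('n)"
  have "(LINT x|lborel. F x * fourier_L1 \<Psi> x) = (LINT x|lborel. ?c * (F x * (LINT y|lborel. \<Psi> y * ?k x y)))"
    unfolding fourier_L1_lborel[OF m(2)] by (intro Bochner_Integration.integral_cong) (auto simp: inner_commute)
  also have "\<dots> = ?c * (LINT x|lborel. F x * (LINT y|lborel. \<Psi> y * ?k x y))" by (rule integral_mult_right_zero)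
  also have "(LINT x|lborel. F x * (LINT y|lborel. \<Psi> y * ?k x y)) = (LINT y|lborel. (LINT x|lborel. F x * ?k x y) * \<Psi> y)"
    by (rule fubini_bounded_kernel[OF F \<Psi>]) auto
  also have "?c * \<dots> = (LINT y|lborel. fourier_L1 F y * \<Psi> y)"
    unfolding fourier_L1_lborel[OF m(1)] by (subst integral_mult_right_zero[symmetric]) (simp add: mult.assoc)
  finally show ?thesis .
qed

lemma integrable_mult_L2:
  fixes u v :: "'a \<Rightarrow> complex"
  assumes [measurable]: "u \<in> borel_measurable M" "v \<in> borel_measurable M"
    and "integrable M (\<lambda>x. (norm (u x))\<^sup>2)" "integrable M (\<lambda>x. (norm (v x))\<^sup>2)"
  shows "integrable M (\<lambda>x. u x * v x)"
proof (rule Bochner_Integration.integrable_bound)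
  show "integrable M (\<lambda>x. (norm (u x))\<^sup>2 + (norm (v x))\<^sup>2)" using assms by simp
  show "AE x in M. norm (u x * v x) \<le> norm ((norm (u x))\<^sup>2 + (norm (v x))\<^sup>2)"
  proof (rule AE_I2)
    fix x
    have "2 * (norm (u x) * norm (v x)) \<le> (norm (u x))\<^sup>2 + (norm (v x))\<^sup>2"
      using sum_squares_bound[of "norm (u x)" "norm (v x)"] by simp
    moreover have "0 \<le> norm (u x) * norm (v x)" by simp
    ultimately have "norm (u x) * norm (v x) \<le> (norm (u x))\<^sup>2 + (norm (v x))\<^sup>2" by linarith
    then show "norm (u x * v x) \<le> norm ((norm (u x))\<^sup>2 + (norm (v x))\<^sup>2)" by (simp add: norm_mult)
  qed
qed measurable

lemma L2_convergence_integral: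
  fixes F :: "nat \<Rightarrow> 'a \<Rightarrow> complex"
  assumes [measurable]: "\<And>m. F m \<in> borel_measurable M" "f \<in> borel_measurable M" "\<Psi> \<in> borel_measurable M"
    and iF: "\<And>m. integrable M (\<lambda>x. F m x * \<Psi> x)" and if': "integrable M (\<lambda>x. f x * \<Psi> x)"
    and \<Psi>: "integrable M (\<lambda>x. (norm (\<Psi> x))\<^sup>2)"
    and lim: "(\<lambda>m. \<integral>\<^sup>+x. ennreal ((norm (F m x - f x))\<^sup>2) \<partial>M) \<longlonglongrightarrow> 0"
  shows "(\<lambda>m. LINT x|M. F m x * \<Psi> x) \<longlonglongrightarrow> (LINT x|M. f x * \<Psi> x)"
proof -
  define P where "P = (\<integral>\<^sup>+x. ennreal ((norm (\<Psi> x))\<^sup>2) \<partial>M)"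
  have P: "P < top" unfolding P_def using \<Psi> by (simp add: integrable_iff_bounded)
  let ?d = "\<lambda>m. (LINT x|M. F m x * \<Psi> x) - (LINT x|M. f x * \<Psi> x)"
  have bd: "ennreal ((norm (?d m))\<^sup>2) \<le> (\<integral>\<^sup>+x. ennreal ((norm (F m x - f x))\<^sup>2) \<partial>M) * P" for m
  proof -
    have e: "?d m = (LINT x|M. (F m x - f x) * \<Psi> x)"
      using iF if' by (simp add: left_diff_distrib)
    have "ennreal (norm (?d m)) \<le> (\<integral>\<^sup>+x. norm ((F m x - f x) * \<Psi> x) \<partial>M)"
      unfolding e using iF if' by (intro integral_norm_bound_ennreal) (simp add: left_diff_distrib)
    also have "\<dots> = (\<integral>\<^sup>+x. ennreal (norm (F m x - f x)) * ennreal (norm (\<Psi> x)) \<partial>M)"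
      by (simp add: norm_mult ennreal_mult)
    finally have "(ennreal (norm (?d m)))\<^sup>2 \<le> (\<integral>\<^sup>+x. ennreal (norm (F m x - f x)) * ennreal (norm (\<Psi> x)) \<partial>M)\<^sup>2"
      by (rule power_mono) simp
    also have "\<dots> \<le> (\<integral>\<^sup>+x. (ennreal (norm (F m x - f x)))\<^sup>2 \<partial>M) * (\<integral>\<^sup>+x. (ennreal (norm (\<Psi> x)))\<^sup>2 \<partial>M)"
      by (rule Cauchy_Schwarz_nn_integral) measurable
    finally show ?thesis unfolding P_def by (simp add: ennreal_power)
  qed
  have "(\<lambda>m. P * (\<integral>\<^sup>+x. ennreal ((norm (F m x - f x))\<^sup>2) \<partial>M)) \<longlonglongrightarrow> P * 0"
    by (rule ennreal_tendsto_cmult[OF P lim])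
  then have lim0: "(\<lambda>m. P * (\<integral>\<^sup>+x. ennreal ((norm (F m x - f x))\<^sup>2) \<partial>M)) \<longlonglongrightarrow> 0" by simp
  have "(\<lambda>m. ennreal ((norm (?d m))\<^sup>2)) \<longlonglongrightarrow> ennreal 0"
  proof (rule tendsto_sandwich[OF _ _ tendsto_const])
    show "(\<lambda>m. P * (\<integral>\<^sup>+x. ennreal ((norm (F m x - f x))\<^sup>2) \<partial>M)) \<longlonglongrightarrow> ennreal 0" using lim0 by simp
    show "\<forall>\<^sub>F m in sequentially. ennreal ((norm (?d m))\<^sup>2) \<le> P * (\<integral>\<^sup>+x. ennreal ((norm (F m x - f x))\<^sup>2) \<partial>M)"
      using bd by (simp only: mult.commute[of P] eventually_sequentiallyI)
  qed simp
  then have "(\<lambda>m. (norm (?d m))\<^sup>2) \<longlonglongrightarrow> 0"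
    by (subst (asm) tendsto_ennreal_iff) auto
  then have "(\<lambda>m. sqrt ((norm (?d m))\<^sup>2)) \<longlonglongrightarrow> sqrt 0" by (rule tendsto_real_sqrt)
  then have "(\<lambda>m. norm (?d m)) \<longlonglongrightarrow> 0" by simp
  then show ?thesis by (simp add: LIM_zero_iff tendsto_norm_zero_iff)
qed

lemma borel_representative:
  fixes f :: "real ^ 'n::finite \<Rightarrow> complex"
  assumes "f \<in> borel_measurable lebesgue"
  obtains f' where "f' \<in> borel_measurable borel" "AE x in lborel. f x = f' x"
proof -
  have "(\<lambda>x. Re (f x)) \<in> borel_measurable lebesgue" "(\<lambda>x. Im (f x)) \<in> borel_measurable lebesgue"
    using assms by measurable
  from this[THEN completion_ex_borel_measurable_real]
  obtain a b where a: "a \<in> borel_measurable lborel" "AE x in lborel. Re (f x) = a x"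
    and b: "b \<in> borel_measurable lborel" "AE x in lborel. Im (f x) = b x"
    by blast
  show ?thesis
  proof
    show "(\<lambda>x. Complex (a x) (b x)) \<in> borel_measurable borel"
      using a(1) b(1) unfolding Complex_eq by simp
    show "AE x in lborel. f x = Complex (a x) (b x)"
      using a(2) b(2) by eventually_elim (simp add: complex_eq_iff)
  qed
qed

lemma fourier_L1_cong_AE:
  fixes f :: "real ^ 'n::finite \<Rightarrow> complex"
  assumes "AE x in lborel. f x = f' x" "f \<in> borel_measurable lebesgue" "f' \<in> borel_measurable borel"
  shows "fourier_L1 f = fourier_L1 f'"
proof
  fix y :: "real ^ 'n"
  have [measurable]: "f \<in> borel_measurable lebesgue" "f' \<in> borel_measurable lebesgue"
    "(\<lambda>x. exp (- \<i> * complex_of_real (x \<bullet> y))) \<in> borel_measurable lebesgue"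
    using assms by (auto intro: measurable_completion)
  have "(LINT x|lebesgue. f x * exp (- \<i> * complex_of_real (x \<bullet> y))) = (LINT x|lebesgue. f' x * exp (- \<i> * complex_of_real (x \<bullet> y)))"
  proof (rule integral_cong_AE)
    show "(\<lambda>x. f x * exp (- \<i> * complex_of_real (x \<bullet> y))) \<in> borel_measurable lebesgue"
      "(\<lambda>x. f' x * exp (- \<i> * complex_of_real (x \<bullet> y))) \<in> borel_measurable lebesgue"
      by (intro borel_measurable_times; fact)+
    show "AE x in lebesgue. f x * exp (- \<i> * complex_of_real (x \<bullet> y)) = f' x * exp (- \<i> * complex_of_real (x \<bullet> y))"
      using AE_completion[OF assms(1)] by eventually_elim simp
  qed
  then show "fourier_L1 f y = fourier_L1 f' y" unfolding fourier_L1_def by simp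
qed

text \<open>
  The approximating sequence can be chosen Borel measurable as well, because \<open>fourier_L1\<close> does not see null
  sets.
\<close>

lemma has_fourier_L2_borel:
  fixes f g :: "real ^ 'n::finite \<Rightarrow> complex"
  assumes fg: "has_fourier_L2 f g" and f': "f' \<in> borel_measurable borel" "AE x in lborel. f x = f' x"
    and g': "g' \<in> borel_measurable borel" "AE x in lborel. g x = g' x"
  obtains F where "\<And>m. F m \<in> borel_measurable borel" "\<And>m. integrable lborel (F m)"
    "\<And>m. integrable lborel (\<lambda>x. (norm (F m x))\<^sup>2)"
    "(\<lambda>m. \<integral>\<^sup>+x. ennreal ((norm (F m x - f' x))\<^sup>2) \<partial>lborel) \<longlonglongrightarrow> 0"
    "(\<lambda>m. \<integral>\<^sup>+x. ennreal ((norm (fourier_L1 (F m) x - g' x))\<^sup>2) \<partial>lborel) \<longlonglongrightarrow> 0"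
    "integrable lborel (\<lambda>x. (norm (f' x))\<^sup>2)" "integrable lborel (\<lambda>x. (norm (g' x))\<^sup>2)"
proof -
  have sq: "integrable lborel (\<lambda>x. (norm (u' x))\<^sup>2)"
    if "u \<in> L2" "u' \<in> borel_measurable borel" "AE x in lborel. u x = u' x" for u u' :: "real ^ 'n \<Rightarrow> complex"
  proof -
    have "integrable lebesgue (\<lambda>x. (norm (u x))\<^sup>2)" using that(1) unfolding L2_def by auto
    then have "(\<integral>\<^sup>+x. ennreal (norm ((norm (u x))\<^sup>2)) \<partial>lebesgue) < \<infinity>" by (simp add: integrable_iff_bounded)
    then have "(\<integral>\<^sup>+x. ennreal (norm ((norm (u x))\<^sup>2)) \<partial>lborel) < \<infinity>" by (simp only: nn_integral_completion)
    also have "(\<integral>\<^sup>+x. ennreal (norm ((norm (u x))\<^sup>2)) \<partial>lborel) = (\<integral>\<^sup>+x. ennreal (norm ((norm (u' x))\<^sup>2)) \<partial>lborel)"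
      by (rule nn_integral_cong_AE) (use that(3) in auto)
    finally show ?thesis using that(2) by (intro integrableI_bounded) auto
  qed
  obtain F0 where F0: "\<And>m. F0 m \<in> L2" "\<And>m. integrable lebesgue (F0 m)" "L2_tendsto F0 f" "L2_tendsto (\<lambda>m. fourier_L1 (F0 m)) g"
    and fL: "f \<in> L2" and gL: "g \<in> L2"
    using fg unfolding has_fourier_L2_def by blast
  have F0m: "F0 m \<in> borel_measurable lebesgue" for m using F0(1) unfolding L2_def by blast
  have "\<exists>u'. u' \<in> borel_measurable borel \<and> (AE x in lborel. F0 m x = u' x)" for m
    using borel_representative[OF F0m[of m]] by blast
  then obtain F where F: "\<And>m. F m \<in> borel_measurable borel" "\<And>m. AE x in lborel. F0 m x = F m x" by metis
  have "integrable lborel (F m)" for m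
  proof -
    have "(\<integral>\<^sup>+x. ennreal (norm (F0 m x)) \<partial>lebesgue) < \<infinity>" using F0(2)[of m] by (simp add: integrable_iff_bounded)
    then have "(\<integral>\<^sup>+x. ennreal (norm (F0 m x)) \<partial>lborel) < \<infinity>" by (simp only: nn_integral_completion)
    also have "(\<integral>\<^sup>+x. ennreal (norm (F0 m x)) \<partial>lborel) = (\<integral>\<^sup>+x. ennreal (norm (F m x)) \<partial>lborel)"
      by (rule nn_integral_cong_AE) (use F(2)[of m] in auto)
    finally show ?thesis using F(1)[of m] by (intro integrableI_bounded) auto
  qed
  moreover have "integrable lborel (\<lambda>x. (norm (F m x))\<^sup>2)" for m by (rule sq[OF F0(1) F])
  moreover have "(\<lambda>m. \<integral>\<^sup>+x. ennreal ((norm (F m x - f' x))\<^sup>2) \<partial>lborel) \<longlonglongrightarrow> 0"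
  proof -
    have "(\<integral>\<^sup>+x. ennreal ((norm (F0 m x - f x))\<^sup>2) \<partial>lebesgue) = (\<integral>\<^sup>+x. ennreal ((norm (F m x - f' x))\<^sup>2) \<partial>lborel)" for m
      unfolding nn_integral_completion by (rule nn_integral_cong_AE) (use F(2)[of m] f'(2) in eventually_elim, simp)
    then show ?thesis using F0(3) unfolding L2_tendsto_def by simp
  qed
  moreover have "(\<lambda>m. \<integral>\<^sup>+x. ennreal ((norm (fourier_L1 (F m) x - g' x))\<^sup>2) \<partial>lborel) \<longlonglongrightarrow> 0"
  proof -
    have "fourier_L1 (F0 m) = fourier_L1 (F m)" for m by (rule fourier_L1_cong_AE[OF F(2) F0m F(1)])
    then have "(\<integral>\<^sup>+x. ennreal ((norm (fourier_L1 (F0 m) x - g x))\<^sup>2) \<partial>lebesgue) = (\<integral>\<^sup>+x. ennreal ((norm (fourier_L1 (F m) x - g' x))\<^sup>2) \<partial>lborel)" for m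
      unfolding nn_integral_completion by (intro nn_integral_cong_AE) (use g'(2) in eventually_elim, simp)
    then show ?thesis using F0(4) unfolding L2_tendsto_def by simp
  qed
  ultimately show ?thesis using that F(1) sq[OF fL f'] sq[OF gL g'] by blast
qed

lemma fourier_L1_diff:
  fixes F H :: "real ^ 'n::finite \<Rightarrow> complex"
  assumes F: "integrable lborel F" and H: "integrable lborel H"
  shows "fourier_L1 (\<lambda>x. F x - H x) y = fourier_L1 F y - fourier_L1 H y"
proof -
  have m: "F \<in> borel_measurable borel" "H \<in> borel_measurable borel" "(\<lambda>x. F x - H x) \<in> borel_measurable borel"
    using borel_measurable_integrable[OF F] borel_measurable_integrable[OF H] by simp_all
  have i: "integrable lborel (\<lambda>x. G x * exp (- \<i> * complex_of_real (x \<bullet> y)))" if "integrable lborel G" for G :: "real ^ 'n \<Rightarrow> complex"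
  proof (rule Bochner_Integration.integrable_bound[OF that])
    have [measurable]: "G \<in> borel_measurable borel" using borel_measurable_integrable[OF that] by simp
    show "(\<lambda>x. G x * exp (- \<i> * complex_of_real (x \<bullet> y))) \<in> borel_measurable lborel" by measurable
  qed (simp add: norm_mult)
  show ?thesis
    unfolding fourier_L1_lborel[OF m(1)] fourier_L1_lborel[OF m(2)] fourier_L1_lborel[OF m(3)]
    using i[OF F] i[OF H] by (simp add: left_diff_distrib right_diff_distrib)
qed

text \<open>
  With the damping factor Fubini's theorem applies, and the left-hand side is, up to constants, the double
  integral of \<open>F(x) cnj (F(x')) G(x, x')\<close> with a Gaussian \<open>G\<close> in \<open>x - x'\<close>. By
  \<open>|F(x)| |F(x')| \<le> (|F(x)|\<^sup>2 + |F(x')|\<^sup>2) / 2\<close> this is at most the \<open>L\<^sup>2\<close> norm of \<open>F\<close> times the total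
  mass of \<open>G\<close>, and with the constants of the Fourier transform the total is exactly 1 for every \<open>\<epsilon>\<close>.
\<close>

lemma gaussian_damped_fourier_norm:
  fixes F :: "real ^ 'n::finite \<Rightarrow> complex" and \<epsilon> :: real
  assumes F: "integrable lborel F" and F2: "integrable lborel (\<lambda>x. (norm (F x))\<^sup>2)" and \<epsilon>: "\<epsilon> > 0"
  shows "(\<integral>\<^sup>+y. ennreal ((norm (fourier_L1 F y))\<^sup>2 * (\<Prod>j\<in>UNIV. exp (- \<epsilon> * (y $ j)\<^sup>2))) \<partial>lborel)
     \<le> (\<integral>\<^sup>+x. ennreal ((norm (F x))\<^sup>2) \<partial>lborel)"
proof -
  note [measurable] = borel_measurable_integrable[OF F]
  have Fm [measurable]: "F \<in> borel_measurable borel" using borel_measurable_integrable[OF F] by simp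
  let ?c = "fourier_const TYPE('n)"
  let ?c' = "(2 * pi) powr (- real CARD('n) / 2) :: real"
  define E where "E y = (\<Prod>j\<in>(UNIV :: 'n set). exp (- \<epsilon> * (y $ j)\<^sup>2))" for y :: "real ^ 'n"
  define G where "G x x' = (\<Prod>j\<in>(UNIV :: 'n set). exp (- (x $ j - x' $ j)\<^sup>2 / (4 * \<epsilon>)))" for x x' :: "real ^ 'n"
  let ?k = "\<lambda>x y :: real ^ 'n. exp (- \<i> * complex_of_real (x \<bullet> y))"
  let ?k' = "\<lambda>x y :: real ^ 'n. exp (\<i> * complex_of_real (x \<bullet> y))"
  have E0: "E y \<ge> 0" for y unfolding E_def by (intro prod_nonneg) auto
  have G0: "G x y \<ge> 0" for x y unfolding G_def by (intro prod_nonneg) auto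
  have [measurable]: "E \<in> borel_measurable borel" unfolding E_def by measurable
  have [measurable]: "(\<lambda>p. G (fst p) (snd p)) \<in> borel_measurable (borel \<Otimes>\<^sub>M borel)" unfolding G_def by measurable
  have [measurable (raw)]: "(\<lambda>p. G (u p) (v p)) \<in> borel_measurable M"
    if [measurable]: "u \<in> borel_measurable M" "v \<in> borel_measurable M" for u v and M :: "((real ^ 'n) \<times> (real ^ 'n)) measure"
    unfolding G_def by measurable
  have Gm [measurable]: "G x \<in> borel_measurable borel" "(\<lambda>x'. G x' x) \<in> borel_measurable borel" for x unfolding G_def by measurable
  \<comment> \<open>The Fourier transform of the damping factor, modulated by a character.\<close>
  have gau: "has_bochner_integral lborel (\<lambda>y. of_real (E y) * (?k x y * ?k' x' y)) (of_real (sqrt (pi / \<epsilon>) ^ CARD('n) * G x x'))" for x x'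
  proof -
    have "(\<Prod>j\<in>UNIV. exp (\<i> * of_real (x' $ j - x $ j) * of_real (y $ j) - of_real \<epsilon> * (of_real (y $ j))\<^sup>2)) = of_real (E y) * (?k x y * ?k' x' y)" for y
      unfolding E_def of_real_prod exp_of_real[symmetric] inner_vec_def of_real_sum sum_distrib_left exp_sum[OF finite] prod.distrib[symmetric] exp_add[symmetric]
      by (intro prod.cong refl arg_cong[where f = exp]) (simp add: algebra_simps)
    moreover have "(\<Prod>j\<in>(UNIV::'n set). csqrt (of_real pi / of_real \<epsilon>) * exp ((\<i> * of_real (x' $ j - x $ j))\<^sup>2 / (4 * of_real \<epsilon>))) = of_real (sqrt (pi / \<epsilon>) ^ CARD('n) * G x x')"
    proof -
      have "csqrt (of_real pi / of_real \<epsilon>) = of_real (sqrt (pi / \<epsilon>))"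
        using \<epsilon> by (subst of_real_divide[symmetric], subst csqrt_of_real_nonneg) auto
      moreover have "exp ((\<i> * of_real (x' $ j - x $ j))\<^sup>2 / (4 * of_real \<epsilon>)) = complex_of_real (exp (- (x $ j - x' $ j)\<^sup>2 / (4 * \<epsilon>)))" for j
        unfolding exp_of_real[symmetric] by (rule arg_cong[where f = exp]) (simp add: power_mult_distrib power2_commute)
      ultimately show ?thesis unfolding G_def by (simp add: prod.distrib)
    qed
    ultimately show ?thesis
      using gaussian_vec_has_integral[of "\<lambda>j. of_real \<epsilon>" "\<lambda>j. \<i> * of_real (x' $ j - x $ j)"] \<epsilon> by simp
  qed
  have Eint: "integrable lborel (\<lambda>y. complex_of_real (E y))"
    using gau[of 0 0] by (simp add: has_bochner_integral_iff)
  have Gint: "(\<integral>\<^sup>+x'. ennreal (G x x') \<partial>lborel) = ennreal (sqrt (4 * pi * \<epsilon>) ^ CARD('n))" for x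
  proof -
    have 1: "has_bochner_integral lborel (\<lambda>s. exp (- (x $ j - s)\<^sup>2 / (4 * \<epsilon>))) (sqrt (4 * pi * \<epsilon>))" for j
    proof -
      have "exp (- (x $ j - s)\<^sup>2 / (4 * \<epsilon>)) = exp (- (x $ j)\<^sup>2 / (4 * \<epsilon>)) * exp ((x $ j / (2 * \<epsilon>)) * s - (1 / (4 * \<epsilon>)) * s\<^sup>2)" for s
        unfolding exp_add[symmetric] using \<epsilon> by (intro arg_cong[where f = exp]) (simp add: field_simps power2_eq_square)
      moreover have "has_bochner_integral lborel (\<lambda>s. exp (- (x $ j)\<^sup>2 / (4 * \<epsilon>)) * exp ((x $ j / (2 * \<epsilon>)) * s - (1 / (4 * \<epsilon>)) * s\<^sup>2))
        (exp (- (x $ j)\<^sup>2 / (4 * \<epsilon>)) * (sqrt (pi / (1 / (4 * \<epsilon>))) * exp ((x $ j / (2 * \<epsilon>))\<^sup>2 / (4 * (1 / (4 * \<epsilon>))))))"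
        using \<epsilon> by (intro has_bochner_integral_mult_right gaussian_real_has_integral) simp
      moreover have "exp (- (x $ j)\<^sup>2 / (4 * \<epsilon>)) * (sqrt (pi / (1 / (4 * \<epsilon>))) * exp ((x $ j / (2 * \<epsilon>))\<^sup>2 / (4 * (1 / (4 * \<epsilon>))))) = sqrt (4 * pi * \<epsilon>)"
      proof -
        have "(x $ j / (2 * \<epsilon>))\<^sup>2 / (4 * (1 / (4 * \<epsilon>))) = - (- (x $ j)\<^sup>2 / (4 * \<epsilon>))" using \<epsilon> by (simp add: power_divide power2_eq_square)
        then have e: "exp ((x $ j / (2 * \<epsilon>))\<^sup>2 / (4 * (1 / (4 * \<epsilon>)))) = exp (- (- (x $ j)\<^sup>2 / (4 * \<epsilon>)))" by (rule arg_cong)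
        have "exp q * (s * exp (- q)) = s" for q s :: real by (simp add: exp_minus)
        then have "exp (- (x $ j)\<^sup>2 / (4 * \<epsilon>)) * (sqrt (pi / (1 / (4 * \<epsilon>))) * exp (- (- (x $ j)\<^sup>2 / (4 * \<epsilon>)))) = sqrt (pi / (1 / (4 * \<epsilon>)))" .
        then show ?thesis unfolding e by (simp add: mult_ac)
      qed
      ultimately show ?thesis by simp
    qed
    have "has_bochner_integral lborel (G x) (\<Prod>j\<in>(UNIV::'n set). (LINT s|lborel. exp (- (x $ j - s)\<^sup>2 / (4 * \<epsilon>))))"
      unfolding G_def using 1 by (intro lborel_vec_prod_integral) (auto simp: has_bochner_integral_iff)
    also have "(\<Prod>j\<in>(UNIV::'n set). (LINT s|lborel. exp (- (x $ j - s)\<^sup>2 / (4 * \<epsilon>)))) = sqrt (4 * pi * \<epsilon>) ^ CARD('n)"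
      using 1 by (simp add: has_bochner_integral_iff)
    finally show ?thesis using G0 by (simp add: has_bochner_integral_iff nn_integral_eq_integral)
  qed
  define h where "h x = (LINT x'|lborel. cnj (F x') * of_real (G x x'))" for x
  have Fc: "integrable lborel (\<lambda>x. cnj (F x))" using F by simp
  have cnjF: "cnj (fourier_L1 F y) = ?c * (LINT x'|lborel. cnj (F x') * ?k' x' y)" for y
  proof -
    have "cnj (LINT x|lborel. F x * ?k x y) = (LINT x|lborel. cnj (F x * ?k x y))" by (rule Bochner_Integration.integral_cnj[symmetric])
    then show ?thesis unfolding fourier_L1_lborel[OF Fm] by (simp add: exp_cnj)
  qed
  have Fbd: "norm (fourier_L1 F y) \<le> ?c' * (LINT x|lborel. norm (F x))" for y
  proof -
    have "norm (LINT x|lborel. F x * ?k x y) \<le> (LINT x|lborel. norm (F x * ?k x y))" by (rule integral_norm_bound)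
    then show ?thesis unfolding fourier_L1_lborel[OF Fm] by (simp add: norm_mult mult_left_mono)
  qed
  define B where "B = ?c' * (LINT x|lborel. norm (F x))"
  define \<Psi> where "\<Psi> y = cnj (fourier_L1 F y) * of_real (E y)" for y
  have Em: "integrable lborel E"
    using integrable_Re[OF Eint] by simp
  have [measurable]: "fourier_L1 F \<in> borel_measurable borel" by (rule fourier_L1_measurable[OF Fm])
  have [measurable]: "(\<lambda>y. cnj (fourier_L1 F y)) \<in> borel_measurable borel"
    by (rule borel_measurable_continuous_on[OF _ fourier_L1_measurable[OF Fm]]) (intro continuous_intros)
  have [measurable]: "\<Psi> \<in> borel_measurable borel" unfolding \<Psi>_def by measurable
  have \<Psi>int: "integrable lborel \<Psi>"
  proof (rule Bochner_Integration.integrable_bound)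
    show "integrable lborel (\<lambda>y. B * E y)" using Em by simp
    show "AE y in lborel. norm (\<Psi> y) \<le> norm (B * E y)"
    proof (rule AE_I2)
      fix y
      have "norm (\<Psi> y) \<le> B * E y" unfolding \<Psi>_def norm_mult using E0[of y] Fbd[of y] by (simp add: B_def mult_right_mono)
      then show "norm (\<Psi> y) \<le> norm (B * E y)" by simp
    qed
  qed simp
  have \<Psi>hat: "(LINT y|lborel. \<Psi> y * ?k x y) = ?c * (of_real (sqrt (pi / \<epsilon>) ^ CARD('n)) * h x)" for x
  proof -
    have gv: "(LINT y|lborel. (of_real (E y) * ?k x y) * ?k' x' y) = of_real (sqrt (pi / \<epsilon>) ^ CARD('n) * G x x')" for x'
      using gau[of x x'] by (simp add: has_bochner_integral_iff mult.assoc)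
    have "(LINT y|lborel. \<Psi> y * ?k x y) = (LINT y|lborel. ?c * ((LINT x'|lborel. cnj (F x') * ?k' x' y) * (of_real (E y) * ?k x y)))"
      unfolding \<Psi>_def cnjF by (intro Bochner_Integration.integral_cong) (auto simp: mult_ac)
    also have "\<dots> = ?c * (LINT y|lborel. (LINT x'|lborel. cnj (F x') * ?k' x' y) * (of_real (E y) * ?k x y))"
      by (rule integral_mult_right_zero)
    also have "(LINT y|lborel. (LINT x'|lborel. cnj (F x') * ?k' x' y) * (of_real (E y) * ?k x y))
       = (LINT x'|lborel. cnj (F x') * (LINT y|lborel. (of_real (E y) * ?k x y) * ?k' x' y))"
    proof (rule fubini_bounded_kernel[symmetric, OF Fc])
      show "integrable lborel (\<lambda>y. of_real (E y) * ?k x y)"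
        by (rule Bochner_Integration.integrable_bound[OF Em]) (auto simp: norm_mult)
    qed auto
    also have "\<dots> = (LINT x'|lborel. cnj (F x') * of_real (sqrt (pi / \<epsilon>) ^ CARD('n) * G x x'))"
      by (simp only: gv)
    also have "(LINT x'|lborel. cnj (F x') * of_real (sqrt (pi / \<epsilon>) ^ CARD('n) * G x x')) = of_real (sqrt (pi / \<epsilon>) ^ CARD('n)) * h x"
      unfolding h_def by (subst integral_mult_right_zero[symmetric]) (simp add: mult_ac)
    finally show ?thesis .
  qed
  define I where "I = (LINT y|lborel. (norm (fourier_L1 F y))\<^sup>2 * E y)"
  have sqE: "of_real ((norm (fourier_L1 F y))\<^sup>2 * E y) = fourier_L1 F y * \<Psi> y" for y
    unfolding \<Psi>_def mult.assoc[symmetric] of_real_mult complex_norm_square ..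
  have Iint: "integrable lborel (\<lambda>y. (norm (fourier_L1 F y))\<^sup>2 * E y)"
  proof (rule Bochner_Integration.integrable_bound)
    show "integrable lborel (\<lambda>y. B\<^sup>2 * E y)" using Em by simp
    show "AE y in lborel. norm ((norm (fourier_L1 F y))\<^sup>2 * E y) \<le> norm (B\<^sup>2 * E y)"
      using Fbd E0 unfolding B_def[symmetric] by (intro AE_I2) (auto simp: abs_mult intro!: mult_right_mono power_mono)
  qed measurable
  have "complex_of_real I = (LINT y|lborel. fourier_L1 F y * \<Psi> y)"
    unfolding I_def sqE[symmetric] by (rule integral_complex_of_real[symmetric])
  also have "\<dots> = ?c * (LINT y|lborel. (LINT x|lborel. F x * ?k x y) * \<Psi> y)"
    unfolding fourier_L1_lborel[OF Fm] by (subst integral_mult_right_zero[symmetric]) (simp add: mult.assoc)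
  also have "(LINT y|lborel. (LINT x|lborel. F x * ?k x y) * \<Psi> y) = (LINT x|lborel. F x * (LINT y|lborel. \<Psi> y * ?k x y))"
    by (rule fubini_bounded_kernel[symmetric, OF F \<Psi>int]) auto
  also have "\<dots> = (LINT x|lborel. (?c * of_real (sqrt (pi / \<epsilon>) ^ CARD('n))) * (F x * h x))"
    unfolding \<Psi>hat by (intro Bochner_Integration.integral_cong) (auto simp: mult_ac)
  also have "\<dots> = (?c * of_real (sqrt (pi / \<epsilon>) ^ CARD('n))) * (LINT x|lborel. F x * h x)" by (rule integral_mult_right_zero)
  finally have I: "complex_of_real I = of_real (?c' * (?c' * sqrt (pi / \<epsilon>) ^ CARD('n))) * (LINT x|lborel. F x * h x)"
    by (simp add: mult.assoc)
  define N where "N = (\<integral>\<^sup>+x. ennreal ((norm (F x))\<^sup>2) \<partial>lborel)"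
  define g where "g = sqrt (4 * pi * \<epsilon>) ^ CARD('n)"
  have Fh: "ennreal (norm (LINT x|lborel. F x * h x)) \<le> N * ennreal g"
  proof (cases "integrable lborel (\<lambda>x. F x * h x)")
    case False
    then show ?thesis by (simp add: not_integrable_integral_eq)
  next
    case True
    have Gx: "(\<integral>\<^sup>+x'. ennreal ((norm (F x))\<^sup>2 / 2 * G x x') \<partial>lborel) = ennreal ((norm (F x))\<^sup>2) * ennreal (g / 2)" for x
    proof -
      have "(\<integral>\<^sup>+x'. ennreal ((norm (F x))\<^sup>2 / 2 * G x x') \<partial>lborel) = (\<integral>\<^sup>+x'. ennreal ((norm (F x))\<^sup>2 / 2) * ennreal (G x x') \<partial>lborel)"
        by (intro nn_integral_cong ennreal_mult) (auto simp: G0)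
      also have "\<dots> = ennreal ((norm (F x))\<^sup>2 / 2) * ennreal g" unfolding Gint[of x, folded g_def, symmetric] by (rule nn_integral_cmult) simp
      also have "\<dots> = ennreal ((norm (F x))\<^sup>2 * (g / 2))" using \<epsilon> unfolding g_def by (subst ennreal_mult[symmetric]) auto
      also have "\<dots> = ennreal ((norm (F x))\<^sup>2) * ennreal (g / 2)" using \<epsilon> unfolding g_def by (intro ennreal_mult) auto
      finally show ?thesis .
    qed
    have "ennreal (norm (LINT x|lborel. F x * h x)) \<le> (\<integral>\<^sup>+x. norm (F x * h x) \<partial>lborel)"
      by (rule integral_norm_bound_ennreal[OF True])
    also have "\<dots> \<le> (\<integral>\<^sup>+x. (\<integral>\<^sup>+x'. (ennreal ((norm (F x))\<^sup>2 / 2 * G x x') + ennreal ((norm (F x'))\<^sup>2 / 2 * G x x')) \<partial>lborel) \<partial>lborel)"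
    proof (rule nn_integral_mono)
      fix x
      have Gle: "G x x' \<le> 1" for x' unfolding G_def using \<epsilon> by (intro prod_le_1) (auto simp: divide_nonneg_nonneg)
      have i: "integrable lborel (\<lambda>x'. cnj (F x') * of_real (G x x'))"
      proof (rule Bochner_Integration.integrable_bound[OF F])
        show "AE x' in lborel. norm (cnj (F x') * complex_of_real (G x x')) \<le> norm (F x')"
          using G0 Gle by (intro AE_I2) (simp add: norm_mult mult_left_le)
      qed measurable
      have "ennreal (norm (F x * h x)) = ennreal (norm (F x)) * ennreal (norm (h x))" by (simp add: norm_mult ennreal_mult)
      also have "\<dots> \<le> ennreal (norm (F x)) * (\<integral>\<^sup>+x'. norm (cnj (F x') * of_real (G x x')) \<partial>lborel)"
        unfolding h_def by (intro mult_left_mono integral_norm_bound_ennreal i) simp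
      also have "\<dots> = (\<integral>\<^sup>+x'. ennreal (norm (F x)) * norm (cnj (F x') * of_real (G x x')) \<partial>lborel)"
        by (rule nn_integral_cmult[symmetric]) measurable
      also have "\<dots> \<le> (\<integral>\<^sup>+x'. (ennreal ((norm (F x))\<^sup>2 / 2 * G x x') + ennreal ((norm (F x'))\<^sup>2 / 2 * G x x')) \<partial>lborel)"
      proof (rule nn_integral_mono)
        fix x'
        have "norm (F x) * norm (F x') \<le> (norm (F x))\<^sup>2 / 2 + (norm (F x'))\<^sup>2 / 2"
          using sum_squares_bound[of "norm (F x)" "norm (F x')"] by simp
        then have "norm (F x) * norm (F x') * G x x' \<le> ((norm (F x))\<^sup>2 / 2 + (norm (F x'))\<^sup>2 / 2) * G x x'"
          using G0 by (intro mult_right_mono)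
        then have "norm (F x) * norm (cnj (F x') * of_real (G x x')) \<le> (norm (F x))\<^sup>2 / 2 * G x x' + (norm (F x'))\<^sup>2 / 2 * G x x'"
          using G0[of x x'] by (simp add: norm_mult algebra_simps)
        then show "ennreal (norm (F x)) * ennreal (norm (cnj (F x') * of_real (G x x'))) \<le> ennreal ((norm (F x))\<^sup>2 / 2 * G x x') + ennreal ((norm (F x'))\<^sup>2 / 2 * G x x')"
          using G0[of x x'] by (simp add: ennreal_mult[symmetric] ennreal_plus[symmetric] ennreal_leI del: ennreal_plus)
      qed
      finally show "ennreal (norm (F x * h x)) \<le> (\<integral>\<^sup>+x'. (ennreal ((norm (F x))\<^sup>2 / 2 * G x x') + ennreal ((norm (F x'))\<^sup>2 / 2 * G x x')) \<partial>lborel)" .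
    qed
    also have "\<dots> = (\<integral>\<^sup>+x. (\<integral>\<^sup>+x'. ennreal ((norm (F x))\<^sup>2 / 2 * G x x') \<partial>lborel) \<partial>lborel) + (\<integral>\<^sup>+x. (\<integral>\<^sup>+x'. ennreal ((norm (F x'))\<^sup>2 / 2 * G x x') \<partial>lborel) \<partial>lborel)"
      by (simp add: nn_integral_add)
    also have "(\<integral>\<^sup>+x. (\<integral>\<^sup>+x'. ennreal ((norm (F x'))\<^sup>2 / 2 * G x x') \<partial>lborel) \<partial>lborel) = (\<integral>\<^sup>+x'. (\<integral>\<^sup>+x. ennreal ((norm (F x'))\<^sup>2 / 2 * G x x') \<partial>lborel) \<partial>lborel)"
      by (rule lborel_pair.Fubini') (simp add: case_prod_beta)
    also have "(\<integral>\<^sup>+x'. (\<integral>\<^sup>+x. ennreal ((norm (F x'))\<^sup>2 / 2 * G x x') \<partial>lborel) \<partial>lborel) = (\<integral>\<^sup>+x'. (\<integral>\<^sup>+x. ennreal ((norm (F x'))\<^sup>2 / 2 * G x' x) \<partial>lborel) \<partial>lborel)"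
      unfolding G_def by (simp add: power2_commute)
    also have "(\<integral>\<^sup>+x. (\<integral>\<^sup>+x'. ennreal ((norm (F x))\<^sup>2 / 2 * G x x') \<partial>lborel) \<partial>lborel) = N * ennreal (g / 2)"
      unfolding Gx N_def by (rule nn_integral_multc) measurable
    also have "N * ennreal (g / 2) + N * ennreal (g / 2) = N * ennreal g"
    proof -
      have "ennreal (g / 2) + ennreal (g / 2) = ennreal g"
        using \<epsilon> unfolding g_def by (subst ennreal_plus[symmetric]) auto
      then show ?thesis by (simp only: distrib_left[symmetric])
    qed
    finally show ?thesis .
  qed
  \<comment> \<open>The total mass of G cancels the constants of the two Fourier transforms and of the damping factor.\<close>
  have const: "?c' * (?c' * sqrt (pi / \<epsilon>) ^ CARD('n)) * g = 1"
  proof -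
    have s: "sqrt (pi / \<epsilon>) * sqrt (4 * pi * \<epsilon>) = 2 * pi"
    proof -
      have "sqrt (pi / \<epsilon>) * sqrt (4 * pi * \<epsilon>) = sqrt ((2 * pi)\<^sup>2)"
        unfolding real_sqrt_mult[symmetric] using \<epsilon> by (simp add: power2_eq_square)
      also have "\<dots> = 2 * pi" by (rule real_sqrt_unique) auto
      finally show ?thesis .
    qed
    have "?c' * ?c' = (2 * pi) powr (- real CARD('n))" unfolding powr_add[symmetric] by simp
    also have "\<dots> = inverse ((2 * pi) ^ CARD('n))" by (simp add: powr_minus powr_realpow)
    finally have c2: "?c' * ?c' = inverse ((2 * pi) ^ CARD('n))" .
    have "?c' * (?c' * sqrt (pi / \<epsilon>) ^ CARD('n)) * g = (?c' * ?c') * (sqrt (pi / \<epsilon>) * sqrt (4 * pi * \<epsilon>)) ^ CARD('n)"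
      unfolding g_def power_mult_distrib by (simp only: mult.assoc)
    also have "\<dots> = 1" unfolding c2 s by (rule left_inverse) simp
    finally show ?thesis .
  qed
  have I0: "I \<ge> 0" unfolding I_def using E0 by (intro integral_nonneg_AE AE_I2) auto
  have "I = norm (complex_of_real I)" using I0 by simp
  also have "\<dots> = ?c' * (?c' * sqrt (pi / \<epsilon>) ^ CARD('n)) * norm (LINT x|lborel. F x * h x)"
    unfolding I norm_mult norm_of_real by (subst abs_of_nonneg) (use \<epsilon> in auto)
  finally have "ennreal I = ennreal (?c' * (?c' * sqrt (pi / \<epsilon>) ^ CARD('n))) * ennreal (norm (LINT x|lborel. F x * h x))"
    using \<epsilon> by (simp add: ennreal_mult)
  also have "\<dots> \<le> ennreal (?c' * (?c' * sqrt (pi / \<epsilon>) ^ CARD('n))) * (N * ennreal g)"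
    by (intro mult_left_mono Fh) simp
  also have "\<dots> = N * ennreal (?c' * (?c' * sqrt (pi / \<epsilon>) ^ CARD('n)) * g)"
    using \<epsilon> unfolding g_def by (subst ennreal_mult) (auto simp: mult_ac)
  also have "\<dots> = N" unfolding const by simp
  finally have "ennreal I \<le> N" .
  moreover have "(\<integral>\<^sup>+y. ennreal ((norm (fourier_L1 F y))\<^sup>2 * E y) \<partial>lborel) = ennreal I"
    unfolding I_def using E0 by (intro nn_integral_eq_integral Iint AE_I2) auto
  ultimately show ?thesis unfolding N_def E_def by simp
qed

text \<open>
  The damping is removed by Fatou's lemma. The inequality makes the transform continuous in \<open>L\<^sup>2\<close>.
\<close>

lemma plancherel_inequality:
  fixes F :: "real ^ 'n::finite \<Rightarrow> complex"
  assumes F: "integrable lborel F" and F2: "integrable lborel (\<lambda>x. (norm (F x))\<^sup>2)"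
  shows "(\<integral>\<^sup>+y. ennreal ((norm (fourier_L1 F y))\<^sup>2) \<partial>lborel) \<le> (\<integral>\<^sup>+x. ennreal ((norm (F x))\<^sup>2) \<partial>lborel)"
proof -
  have [measurable]: "F \<in> borel_measurable borel" using borel_measurable_integrable[OF F] by simp
  let ?u = "\<lambda>m y. ennreal ((norm (fourier_L1 F y))\<^sup>2 * (\<Prod>j\<in>UNIV. exp (- inverse (real (Suc m)) * (y $ j)\<^sup>2)))"
  have "(\<integral>\<^sup>+y. ennreal ((norm (fourier_L1 F y))\<^sup>2) \<partial>lborel) = (\<integral>\<^sup>+y. liminf (\<lambda>m. ?u m y) \<partial>lborel)"
  proof (rule nn_integral_cong)
    fix y
    have "(\<lambda>m. (norm (fourier_L1 F y))\<^sup>2 * (\<Prod>j\<in>UNIV. exp (- inverse (real (Suc m)) * (y $ j)\<^sup>2)))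
        \<longlonglongrightarrow> (norm (fourier_L1 F y))\<^sup>2 * (\<Prod>j\<in>(UNIV::'n set). exp (- 0 * (y $ j)\<^sup>2))"
      by (intro tendsto_mult tendsto_prod tendsto_exp tendsto_minus tendsto_const LIMSEQ_inverse_real_of_nat)
    then have "(\<lambda>m. ?u m y) \<longlonglongrightarrow> ennreal ((norm (fourier_L1 F y))\<^sup>2)" by (intro tendsto_ennrealI) simp
    then show "ennreal ((norm (fourier_L1 F y))\<^sup>2) = liminf (\<lambda>m. ?u m y)"
      by (simp add: lim_imp_Liminf)
  qed
  also have "\<dots> \<le> liminf (\<lambda>m. integral\<^sup>N lborel (?u m))"
    by (rule nn_integral_liminf) measurable
  also have "\<dots> \<le> (\<integral>\<^sup>+x. ennreal ((norm (F x))\<^sup>2) \<partial>lborel)"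
  proof (rule Liminf_le)
    show "\<forall>\<^sub>F m in sequentially. integral\<^sup>N lborel (?u m) \<le> (\<integral>\<^sup>+x. ennreal ((norm (F x))\<^sup>2) \<partial>lborel)"
      by (intro always_eventually allI gaussian_damped_fourier_norm[OF F F2]) simp
  qed simp
  finally show ?thesis .
qed

lemma ennreal_norm_add_square_le:
  "ennreal ((norm (a + b :: complex))\<^sup>2) \<le> 2 * ennreal ((norm a)\<^sup>2) + 2 * ennreal ((norm b)\<^sup>2)"
proof -
  have "(norm (a + b))\<^sup>2 \<le> (norm a + norm b)\<^sup>2" by (intro power_mono norm_triangle_ineq) auto
  also have "\<dots> \<le> 2 * (norm a)\<^sup>2 + 2 * (norm b)\<^sup>2"
    using sum_squares_bound[of "norm a" "norm b"] by (simp add: power2_sum)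
  finally have "ennreal ((norm (a + b))\<^sup>2) \<le> ennreal (2 * (norm a)\<^sup>2 + 2 * (norm b)\<^sup>2)" by (rule ennreal_leI)
  then show ?thesis by (simp add: ennreal_mult)
qed

lemma nn_integral_norm_add_square_le:
  fixes a b :: "'a \<Rightarrow> complex"
  assumes [measurable]: "a \<in> borel_measurable M" "b \<in> borel_measurable M"
  shows "(\<integral>\<^sup>+x. ennreal ((norm (a x + b x))\<^sup>2) \<partial>M)
     \<le> 2 * (\<integral>\<^sup>+x. ennreal ((norm (a x))\<^sup>2) \<partial>M) + 2 * (\<integral>\<^sup>+x. ennreal ((norm (b x))\<^sup>2) \<partial>M)"
proof -
  have "(\<integral>\<^sup>+x. ennreal ((norm (a x + b x))\<^sup>2) \<partial>M) \<le> (\<integral>\<^sup>+x. (2 * ennreal ((norm (a x))\<^sup>2) + 2 * ennreal ((norm (b x))\<^sup>2)) \<partial>M)"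
    by (intro nn_integral_mono ennreal_norm_add_square_le)
  then show ?thesis by (simp add: nn_integral_add nn_integral_cmult)
qed

text \<open>
  Any two approximating sequences of \<open>f\<close> differ by a sequence tending to zero in \<open>L\<^sup>2\<close>, and by the
  Plancherel inequality so do their transforms.
\<close>

theorem has_fourier_L2_unique:
  fixes f g h :: "real ^ 'n::finite \<Rightarrow> complex"
  assumes g: "has_fourier_L2 f g" and h: "has_fourier_L2 f h"
  shows "AE x in lborel. g x = h x"
proof -
  have m: "f \<in> borel_measurable lebesgue" "g \<in> borel_measurable lebesgue" "h \<in> borel_measurable lebesgue"
    using g h unfolding has_fourier_L2_def L2_def by auto
  obtain f' where f': "f' \<in> borel_measurable borel" "AE x in lborel. f x = f' x" by (rule borel_representative[OF m(1)])
  obtain g' where g': "g' \<in> borel_measurable borel" "AE x in lborel. g x = g' x" by (rule borel_representative[OF m(2)])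
  obtain h' where h': "h' \<in> borel_measurable borel" "AE x in lborel. h x = h' x" by (rule borel_representative[OF m(3)])
  note [measurable] = f'(1) g'(1) h'(1)
  obtain G where G: "\<And>m. G m \<in> borel_measurable borel" "\<And>m. integrable lborel (G m)"
    "\<And>m. integrable lborel (\<lambda>x. (norm (G m x))\<^sup>2)"
    "(\<lambda>m. \<integral>\<^sup>+x. ennreal ((norm (G m x - f' x))\<^sup>2) \<partial>lborel) \<longlonglongrightarrow> 0"
    "(\<lambda>m. \<integral>\<^sup>+x. ennreal ((norm (fourier_L1 (G m) x - g' x))\<^sup>2) \<partial>lborel) \<longlonglongrightarrow> 0"
    "integrable lborel (\<lambda>x. (norm (f' x))\<^sup>2)" "integrable lborel (\<lambda>x. (norm (g' x))\<^sup>2)"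
    by (rule has_fourier_L2_borel[OF g f' g' that])
  obtain H where H: "\<And>m. H m \<in> borel_measurable borel" "\<And>m. integrable lborel (H m)"
    "\<And>m. integrable lborel (\<lambda>x. (norm (H m x))\<^sup>2)"
    "(\<lambda>m. \<integral>\<^sup>+x. ennreal ((norm (H m x - f' x))\<^sup>2) \<partial>lborel) \<longlonglongrightarrow> 0"
    "(\<lambda>m. \<integral>\<^sup>+x. ennreal ((norm (fourier_L1 (H m) x - h' x))\<^sup>2) \<partial>lborel) \<longlonglongrightarrow> 0"
    "integrable lborel (\<lambda>x. (norm (f' x))\<^sup>2)" "integrable lborel (\<lambda>x. (norm (h' x))\<^sup>2)"
    by (rule has_fourier_L2_borel[OF h f' h' that])
  note [measurable] = G(1) H(1)
  let ?N = "\<lambda>u. \<integral>\<^sup>+x. ennreal ((norm (u x :: complex))\<^sup>2) \<partial>(lborel :: (real ^ 'n) measure)"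
  have neg: "?N (\<lambda>x. a x - b x) = ?N (\<lambda>x. b x - a x)" for a b by (simp add: norm_minus_commute)
  have GH: "?N (\<lambda>x. fourier_L1 (G m) x - fourier_L1 (H m) x) \<le>
      2 * ?N (\<lambda>x. G m x - f' x) + 2 * ?N (\<lambda>x. H m x - f' x)" for m
  proof -
    have i2: "integrable lborel (\<lambda>x. (norm (G m x - H m x))\<^sup>2)"
    proof (rule Bochner_Integration.integrable_bound)
      show "integrable lborel (\<lambda>x. 2 * (norm (G m x))\<^sup>2 + 2 * (norm (H m x))\<^sup>2)" using G(3) H(3) by simp
      show "AE x in lborel. norm ((norm (G m x - H m x))\<^sup>2) \<le> norm (2 * (norm (G m x))\<^sup>2 + 2 * (norm (H m x))\<^sup>2)"
      proof (rule AE_I2)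
        fix x
        have "(norm (G m x - H m x))\<^sup>2 \<le> (norm (G m x) + norm (H m x))\<^sup>2" by (intro power_mono norm_triangle_ineq4) auto
        also have "\<dots> \<le> 2 * (norm (G m x))\<^sup>2 + 2 * (norm (H m x))\<^sup>2"
          using sum_squares_bound[of "norm (G m x)" "norm (H m x)"] by (simp add: power2_sum)
        finally show "norm ((norm (G m x - H m x))\<^sup>2) \<le> norm (2 * (norm (G m x))\<^sup>2 + 2 * (norm (H m x))\<^sup>2)" by simp
      qed
    qed measurable
    have "?N (\<lambda>x. fourier_L1 (G m) x - fourier_L1 (H m) x) = ?N (fourier_L1 (\<lambda>x. G m x - H m x))"
      by (simp add: fourier_L1_diff[OF G(2) H(2)])
    also have "\<dots> \<le> ?N (\<lambda>x. G m x - H m x)"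
      using G(2) H(2) i2 by (intro plancherel_inequality) auto
    also have "\<dots> = ?N (\<lambda>x. (G m x - f' x) + (f' x - H m x))" by simp
    also have "\<dots> \<le> 2 * ?N (\<lambda>x. G m x - f' x) + 2 * ?N (\<lambda>x. f' x - H m x)"
      by (rule nn_integral_norm_add_square_le) measurable
    finally show ?thesis unfolding neg[of f'] .
  qed
  have chain: "X \<le> 2 * a + 2 * (2 * e + 2 * d)"
    if "X \<le> 2 * a + 2 * b" "b \<le> 2 * c + 2 * d" "c \<le> e" for X a b c d e :: ennreal
  proof -
    have "2 * c + 2 * d \<le> 2 * e + 2 * d" using that(3) by (intro add_mono mult_left_mono) auto
    then have "b \<le> 2 * e + 2 * d" by (rule order_trans[OF that(2)])
    then have "2 * a + 2 * b \<le> 2 * a + 2 * (2 * e + 2 * d)" by (intro add_mono mult_left_mono) auto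
    then show ?thesis by (rule order_trans[OF that(1)])
  qed
  have "?N (\<lambda>x. g' x - h' x) \<le> 2 * ?N (\<lambda>x. fourier_L1 (G m) x - g' x)
      + 2 * (2 * (2 * ?N (\<lambda>x. G m x - f' x) + 2 * ?N (\<lambda>x. H m x - f' x)) + 2 * ?N (\<lambda>x. fourier_L1 (H m) x - h' x))" for m
  proof (rule chain[OF _ _ GH])
    have "?N (\<lambda>x. g' x - h' x) = ?N (\<lambda>x. (g' x - fourier_L1 (G m) x) + (fourier_L1 (G m) x - h' x))" by simp
    also have "\<dots> \<le> 2 * ?N (\<lambda>x. g' x - fourier_L1 (G m) x) + 2 * ?N (\<lambda>x. fourier_L1 (G m) x - h' x)"
      by (rule nn_integral_norm_add_square_le) measurable
    finally show "?N (\<lambda>x. g' x - h' x) \<le> 2 * ?N (\<lambda>x. fourier_L1 (G m) x - g' x) + 2 * ?N (\<lambda>x. fourier_L1 (G m) x - h' x)"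
      unfolding neg[of g' "fourier_L1 (G m)"] .
    have "?N (\<lambda>x. fourier_L1 (G m) x - h' x) = ?N (\<lambda>x. (fourier_L1 (G m) x - fourier_L1 (H m) x) + (fourier_L1 (H m) x - h' x))" by simp
    also have "\<dots> \<le> 2 * ?N (\<lambda>x. fourier_L1 (G m) x - fourier_L1 (H m) x) + 2 * ?N (\<lambda>x. fourier_L1 (H m) x - h' x)"
      by (rule nn_integral_norm_add_square_le) measurable
    finally show "?N (\<lambda>x. fourier_L1 (G m) x - h' x) \<le> 2 * ?N (\<lambda>x. fourier_L1 (G m) x - fourier_L1 (H m) x) + 2 * ?N (\<lambda>x. fourier_L1 (H m) x - h' x)" .
  qed
  note bound = this
  have lim: "(\<lambda>m. 2 * ?N (\<lambda>x. fourier_L1 (G m) x - g' x)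
      + 2 * (2 * (2 * ?N (\<lambda>x. G m x - f' x) + 2 * ?N (\<lambda>x. H m x - f' x)) + 2 * ?N (\<lambda>x. fourier_L1 (H m) x - h' x)))
      \<longlonglongrightarrow> 2 * 0 + 2 * (2 * (2 * 0 + 2 * 0) + 2 * 0)"
    by (intro tendsto_add ennreal_tendsto_cmult G(4,5) H(4,5)) (simp_all add: less_top)
  have "?N (\<lambda>x. g' x - h' x) \<le> 2 * 0 + 2 * (2 * (2 * 0 + 2 * 0) + 2 * 0)"
    by (rule tendsto_lowerbound[OF lim always_eventually[OF allI[OF bound]] sequentially_bot])
  then have "?N (\<lambda>x. g' x - h' x) = 0" by simp
  then have "AE x in lborel. ennreal ((norm (g' x - h' x))\<^sup>2) = 0"
    by (subst (asm) nn_integral_0_iff_AE) auto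
  then show ?thesis using g'(2) h'(2) by eventually_elim simp
qed

text \<open>
  The multiplication formula on \<open>L\<^sup>1\<close> passes to the \<open>L\<^sup>2\<close> limit on both sides.
\<close>

lemma has_fourier_L2_multiplication:
  fixes f g :: "real ^ 'n::finite \<Rightarrow> complex"
  assumes fg: "has_fourier_L2 f g" and f': "f' \<in> borel_measurable borel" "AE x in lborel. f x = f' x"
    and g': "g' \<in> borel_measurable borel" "AE x in lborel. g x = g' x"
    and \<Psi>: "integrable lborel \<Psi>" "integrable lborel (\<lambda>x. (norm (\<Psi> x))\<^sup>2)"
  shows "(LINT x|lborel. f' x * fourier_L1 \<Psi> x) = (LINT x|lborel. g' x * \<Psi> x)"
proof -
  have [measurable]: "\<Psi> \<in> borel_measurable borel" using borel_measurable_integrable[OF \<Psi>(1)] by simp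
  obtain F where F: "\<And>m. F m \<in> borel_measurable borel" "\<And>m. integrable lborel (F m)"
    "\<And>m. integrable lborel (\<lambda>x. (norm (F m x))\<^sup>2)"
    "(\<lambda>m. \<integral>\<^sup>+x. ennreal ((norm (F m x - f' x))\<^sup>2) \<partial>lborel) \<longlonglongrightarrow> 0"
    "(\<lambda>m. \<integral>\<^sup>+x. ennreal ((norm (fourier_L1 (F m) x - g' x))\<^sup>2) \<partial>lborel) \<longlonglongrightarrow> 0"
    "integrable lborel (\<lambda>x. (norm (f' x))\<^sup>2)" "integrable lborel (\<lambda>x. (norm (g' x))\<^sup>2)"
    by (rule has_fourier_L2_borel[OF fg f' g' that])
  note [measurable] = F(1) f'(1) g'(1)
  have hat2: "integrable lborel (\<lambda>x. (norm (fourier_L1 U x))\<^sup>2)"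
    if U: "integrable lborel U" "integrable lborel (\<lambda>x. (norm (U x))\<^sup>2)" for U :: "real ^ 'n \<Rightarrow> complex"
  proof (rule integrableI_bounded)
    have [measurable]: "U \<in> borel_measurable borel" using borel_measurable_integrable[OF U(1)] by simp
    show "(\<lambda>x. (norm (fourier_L1 U x))\<^sup>2) \<in> borel_measurable lborel" by measurable
    have "(\<integral>\<^sup>+x. ennreal ((norm (U x))\<^sup>2) \<partial>lborel) < \<infinity>" using U(2) by (simp add: integrable_iff_bounded)
    then show "(\<integral>\<^sup>+x. ennreal (norm ((norm (fourier_L1 U x))\<^sup>2)) \<partial>lborel) < \<infinity>"
      using plancherel_inequality[OF U] by (simp add: order_le_less_trans)
  qed
  have "(\<lambda>m. LINT x|lborel. F m x * fourier_L1 \<Psi> x) \<longlonglongrightarrow> (LINT x|lborel. f' x * fourier_L1 \<Psi> x)"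
    using F(3,6) hat2[OF \<Psi>] by (intro L2_convergence_integral F(4) integrable_mult_L2) auto
  moreover have "(\<lambda>m. LINT x|lborel. fourier_L1 (F m) x * \<Psi> x) \<longlonglongrightarrow> (LINT x|lborel. g' x * \<Psi> x)"
    using hat2[OF F(2) F(3)] F(7) \<Psi>(2) by (intro L2_convergence_integral F(5) integrable_mult_L2) auto
  moreover have "(LINT x|lborel. F m x * fourier_L1 \<Psi> x) = (LINT x|lborel. fourier_L1 (F m) x * \<Psi> x)" for m
    by (rule fourier_L1_multiplication[OF F(2) \<Psi>(1)])
  ultimately show ?thesis using LIMSEQ_unique by auto
qed

section \<open>The coefficient series for small weights\<close>

lemma exp_neg_inner_eq_prod:
  "exp (- a * (x \<bullet> x)) = (\<Prod>j\<in>UNIV. exp (- a * (x $ j)\<^sup>2))" for x :: "real ^ 'n::finite" and a :: real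
  unfolding exp_sum[OF finite, symmetric] by (simp add: inner_vec_def sum_distrib_left power2_eq_square sum_negf)

lemma integrable_exp_neg_inner:
  assumes "a > 0"
  shows "integrable lborel (\<lambda>x :: real ^ 'n::finite. exp (- a * (x \<bullet> x)))"
proof -
  have "integrable lborel (\<lambda>s. exp (- a * s\<^sup>2))"
    using gaussian_real_has_integral[OF assms, of 0] by (simp add: has_bochner_integral_iff)
  then have "has_bochner_integral lborel (\<lambda>x::real^'n. \<Prod>j\<in>UNIV. exp (- a * (x $ j)\<^sup>2)) (\<Prod>j\<in>(UNIV::'n set). (LINT s|lborel. exp (- a * s\<^sup>2)))"
    by (rule lborel_vec_prod_integral)
  then show ?thesis unfolding exp_neg_inner_eq_prod by (simp add: has_bochner_integral_iff)
qed

lemma integrable_L2_times_gaussian: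
  fixes f :: "real ^ 'n::finite \<Rightarrow> complex"
  assumes [measurable]: "f \<in> borel_measurable borel" and f2: "integrable lborel (\<lambda>x. (norm (f x))\<^sup>2)" and a: "a > 0"
  shows "integrable lborel (\<lambda>x. norm (f x) * exp (- a * (x \<bullet> x)))"
proof -
  have "(norm (complex_of_real (exp (- a * (x \<bullet> x)))))\<^sup>2 = exp (- (2 * a) * (x \<bullet> x))" for x :: "real ^ 'n"
    by (simp add: power2_eq_square flip: exp_add)
  then have "integrable lborel (\<lambda>x::real^'n. (norm (complex_of_real (exp (- a * (x \<bullet> x)))))\<^sup>2)"
    using integrable_exp_neg_inner[of "2 * a"] a by simp
  then have "integrable lborel (\<lambda>x. f x * complex_of_real (exp (- a * (x \<bullet> x))))"
    using f2 by (intro integrable_mult_L2) auto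
  from integrable_norm[OF this] show ?thesis by (simp add: norm_mult)
qed

definition rotated_mehler_vec :: "('n::finite \<Rightarrow> complex) \<Rightarrow> real ^ 'n \<Rightarrow> real ^ 'n \<Rightarrow> complex" where
  "rotated_mehler_vec \<rho> x y = (\<Prod>j\<in>UNIV. rotated_mehler_kernel (\<rho> j) (x $ j) (y $ j))"

text \<open>
  Boundedness makes the integrable kernel square integrable, so that it may serve as a test function in the
  multiplication formula.
\<close>

lemma rotated_mehler_kernel_real_le_1:
  assumes "0 \<le> r" "r < 1"
  shows "norm (rotated_mehler_kernel (of_real r) x y) \<le> 1"
proof -
  have r2: "r\<^sup>2 < 1" using assms by (simp add: abs_square_less_1)
  have p: "1 + r\<^sup>2 > 0" by (simp add: add_pos_nonneg)
  have "complex_of_real pi * (1 + (of_real r)\<^sup>2) = of_real (pi * (1 + r\<^sup>2))" by simp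
  then have d: "csqrt (complex_of_real pi * (1 + (of_real r)\<^sup>2)) = of_real (sqrt (pi * (1 + r\<^sup>2)))"
    using p by (simp only:) (subst csqrt_of_real_nonneg; simp)
  have "1 \<le> pi * (1 + r\<^sup>2)"
  proof -
    have "1 * 1 \<le> pi * (1 + r\<^sup>2)" using pi_gt3 by (intro mult_mono) auto
    then show ?thesis by simp
  qed
  then have s: "sqrt (pi * (1 + r\<^sup>2)) \<ge> 1" by simp
  have e: "((complex_of_real r)\<^sup>2 - 1) / (1 + (of_real r)\<^sup>2) * of_real ((x\<^sup>2 + y\<^sup>2) / 2) + 2 * \<i> * of_real r / (1 + (of_real r)\<^sup>2) * of_real (x * y)
     = of_real ((r\<^sup>2 - 1) / (1 + r\<^sup>2) * ((x\<^sup>2 + y\<^sup>2) / 2)) + \<i> * of_real (2 * r / (1 + r\<^sup>2) * (x * y))"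
    by simp
  have "norm (rotated_mehler_kernel (of_real r) x y) = exp ((r\<^sup>2 - 1) / (1 + r\<^sup>2) * ((x\<^sup>2 + y\<^sup>2) / 2)) / sqrt (pi * (1 + r\<^sup>2))"
    unfolding rotated_mehler_kernel_def d e norm_divide norm_exp_eq_Re norm_of_real using p by simp
  also have "\<dots> \<le> 1 / 1"
  proof (rule frac_le)
    have "(r\<^sup>2 - 1) / (1 + r\<^sup>2) * ((x\<^sup>2 + y\<^sup>2) / 2) \<le> 0"
      using r2 p by (intro mult_nonpos_nonneg divide_nonpos_pos) auto
    then show "exp ((r\<^sup>2 - 1) / (1 + r\<^sup>2) * ((x\<^sup>2 + y\<^sup>2) / 2)) \<le> 1" by simp
  qed (use s in auto)
  finally show ?thesis by simp
qed

lemma rotated_mehler_vec_fourier: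
  fixes r :: "'n::finite \<Rightarrow> real" and y :: "real ^ 'n"
  assumes r: "\<And>j. 0 \<le> r j" "\<And>j. r j < 1"
  defines "\<Psi> \<equiv> \<lambda>\<xi>. rotated_mehler_vec (\<lambda>j. of_real (r j)) \<xi> y"
  shows "integrable lborel \<Psi>" and "integrable lborel (\<lambda>\<xi>. (norm (\<Psi> \<xi>))\<^sup>2)"
    and "fourier_L1 \<Psi> x = of_real (\<Prod>j\<in>UNIV. mehler_kernel (r j) (x $ j) (y $ j))"
proof -
  have hb: "has_bochner_integral lborel (\<lambda>\<xi>. rotated_mehler_kernel (of_real (r j)) \<xi> (y $ j) * exp (- \<i> * of_real (x' $ j * \<xi>)))
     (of_real (sqrt (2 * pi) * mehler_kernel (r j) (x' $ j) (y $ j)))" for j and x' :: "real ^ 'n"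
    by (rule fourier_rotated_mehler_kernel[OF r])
  have hbv: "has_bochner_integral lborel (\<lambda>\<xi>. \<Psi> \<xi> * exp (- \<i> * of_real (\<xi> \<bullet> x')))
     (\<Prod>j\<in>UNIV. of_real (sqrt (2 * pi) * mehler_kernel (r j) (x' $ j) (y $ j)))" for x' :: "real ^ 'n"
  proof -
    have "has_bochner_integral lborel (\<lambda>\<xi>::real^'n. \<Prod>j\<in>UNIV. rotated_mehler_kernel (of_real (r j)) (\<xi> $ j) (y $ j) * exp (- \<i> * of_real (x' $ j * \<xi> $ j)))
      (\<Prod>j\<in>UNIV. (LINT \<xi>|lborel. rotated_mehler_kernel (of_real (r j)) \<xi> (y $ j) * exp (- \<i> * of_real (x' $ j * \<xi>))))"
      using hb[of _ x'] by (intro lborel_vec_prod_integral) (auto simp: has_bochner_integral_iff)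
    moreover have "(\<Prod>j\<in>UNIV. rotated_mehler_kernel (of_real (r j)) (\<xi> $ j) (y $ j) * exp (- \<i> * of_real (x' $ j * \<xi> $ j))) = \<Psi> \<xi> * exp (- \<i> * of_real (\<xi> \<bullet> x'))" for \<xi> :: "real ^ 'n"
      unfolding prod.distrib \<Psi>_def rotated_mehler_vec_def exp_sum[OF finite, symmetric] inner_vec_def
      by (simp add: sum_distrib_left sum_negf mult.commute)
    moreover have "(LINT \<xi>|lborel. rotated_mehler_kernel (of_real (r j)) \<xi> (y $ j) * exp (- \<i> * of_real (x' $ j * \<xi>))) = of_real (sqrt (2 * pi) * mehler_kernel (r j) (x' $ j) (y $ j))" for j
      using hb[of j x'] by (simp add: has_bochner_integral_iff)
    ultimately show ?thesis by simp
  qed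
  show i: "integrable lborel \<Psi>" using hbv[of 0] by (simp add: has_bochner_integral_iff)
  have m [measurable]: "\<Psi> \<in> borel_measurable borel" using borel_measurable_integrable[OF i] by simp
  have le1: "norm (\<Psi> \<xi>) \<le> 1" for \<xi>
    unfolding \<Psi>_def rotated_mehler_vec_def prod_norm[symmetric] by (intro prod_le_1) (auto intro: rotated_mehler_kernel_real_le_1 r)
  show "integrable lborel (\<lambda>\<xi>. (norm (\<Psi> \<xi>))\<^sup>2)"
  proof (rule Bochner_Integration.integrable_bound[OF i])
    show "AE \<xi> in lborel. norm ((norm (\<Psi> \<xi>))\<^sup>2) \<le> norm (\<Psi> \<xi>)"
      using le1 by (intro AE_I2) (simp add: power2_eq_square mult_left_le)
  qed measurable
  have "fourier_L1 \<Psi> x = fourier_const TYPE('n) * of_real (\<Prod>j\<in>UNIV. sqrt (2 * pi) * mehler_kernel (r j) (x $ j) (y $ j))"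
    unfolding fourier_L1_lborel[OF m] using hbv[of x] by (simp add: has_bochner_integral_iff)
  also have "(\<Prod>j\<in>UNIV. sqrt (2 * pi) * mehler_kernel (r j) (x $ j) (y $ j)) = sqrt (2 * pi) ^ CARD('n) * (\<Prod>j\<in>UNIV. mehler_kernel (r j) (x $ j) (y $ j))"
    by (simp add: prod.distrib)
  finally have eq: "fourier_L1 \<Psi> x = of_real (((2 * pi) powr (- real CARD('n) / 2) * sqrt (2 * pi) ^ CARD('n)) * (\<Prod>j\<in>UNIV. mehler_kernel (r j) (x $ j) (y $ j)))"
    by (simp only: of_real_mult mult.assoc)
  have "sqrt (2 * pi) ^ CARD('n) = (2 * pi) powr (real CARD('n) / 2)"
    by (simp add: powr_half_sqrt[symmetric] powr_realpow[symmetric] powr_powr)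
  then have "(2 * pi) powr (- real CARD('n) / 2) * sqrt (2 * pi) ^ CARD('n) = 1"
    by (simp add: powr_add[symmetric])
  then show "fourier_L1 \<Psi> x = of_real (\<Prod>j\<in>UNIV. mehler_kernel (r j) (x $ j) (y $ j))" unfolding eq by simp
qed

lemma hermite_Phi_measurable [measurable]: "hermite_Phi \<alpha> \<in> borel_measurable borel"
proof -
  have "hermite_poly k \<in> borel_measurable borel" for k
  proof -
    have "(\<lambda>x. Re (hermite_moment k x)) \<in> borel_measurable borel"
      unfolding hermite_moment_def Complex_eq by measurable
    then show ?thesis by (simp add: hermite_moment_eq_poly)
  qed
  then have [measurable]: "hermite_fun k \<in> borel_measurable borel" for k
    unfolding hermite_fun_def by measurable
  show ?thesis unfolding hermite_Phi_def by measurable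
qed

lemma hermite_coeff_lborel:
  fixes f :: "real ^ 'n::finite \<Rightarrow> complex"
  assumes fm: "f \<in> borel_measurable lebesgue" and f': "f' \<in> borel_measurable borel" "AE x in lborel. f x = f' x"
  shows "hermite_coeff f \<alpha> = (LINT x|lborel. f' x * of_real (hermite_Phi \<alpha> x))"
proof -
  note [measurable] = f'(1)
  have \<Phi>L: "(\<lambda>x. complex_of_real (hermite_Phi \<alpha> x)) \<in> borel_measurable lebesgue" by (rule measurable_completion) measurable
  have f'L: "f' \<in> borel_measurable lebesgue" by (rule measurable_completion) measurable
  have "hermite_coeff f \<alpha> = (LINT x|lebesgue. f' x * of_real (hermite_Phi \<alpha> x))"
    unfolding hermite_coeff_def
  proof (rule integral_cong_AE)
    show "AE x in lebesgue. f x * complex_of_real (hermite_Phi \<alpha> x) = f' x * complex_of_real (hermite_Phi \<alpha> x)"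
      using AE_completion[OF f'(2)] by eventually_elim simp
  qed (intro borel_measurable_times fm f'L \<Phi>L)+
  also have "\<dots> = (LINT x|lborel. f' x * of_real (hermite_Phi \<alpha> x))" by (rule integral_completion) measurable
  finally show ?thesis .
qed

lemma integrable_prod_lborel:
  fixes u v :: "real ^ 'n::finite \<Rightarrow> real"
  assumes u: "integrable lborel u" and v: "integrable lborel v"
  shows "integrable (lborel \<Otimes>\<^sub>M lborel) (\<lambda>p. u (fst p) * v (snd p))"
proof -
  have [measurable]: "u \<in> borel_measurable borel" "v \<in> borel_measurable borel"
    using borel_measurable_integrable[OF u] borel_measurable_integrable[OF v] by simp_all
  show ?thesis
  proof (rule lborel_pair.Fubini_integrable)
    show "(\<lambda>p. u (fst p) * v (snd p)) \<in> borel_measurable (lborel \<Otimes>\<^sub>M lborel)" by measurable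
    show "integrable lborel (\<lambda>x. LINT y|lborel. norm (u (fst (x, y)) * v (snd (x, y))))"
      using u by (simp add: abs_mult)
    show "AE x in lborel. integrable lborel (\<lambda>y. u (fst (x, y)) * v (snd (x, y)))" using v by simp
  qed
qed

text \<open>
  The series is the form of the Mehler kernel at \<open>f\<close>. The Mehler kernel is the Fourier transform of the
  rotated kernel in \<open>x\<close>, and moving the transform over to \<open>f\<close> produces the factor \<open>c\<close>. This is done
  for fixed \<open>y\<close>, which is why the rotated form appears as an iterated integral.
\<close>

theorem small_weight_identity:
  fixes f :: "real ^ 'n::finite \<Rightarrow> complex" and r :: "'n \<Rightarrow> real"
  assumes ff: "has_fourier_L2 f (\<lambda>x. c * f x)" and f': "f' \<in> borel_measurable borel" "AE x in lborel. f x = f' x"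
    and r: "\<And>j. 0 \<le> r j" "\<And>j. r j \<le> 1/4"
  shows "((\<lambda>\<alpha>. complex_of_real ((\<Prod>j\<in>UNIV. r j ^ \<alpha> j) * (norm (hermite_coeff f \<alpha>))\<^sup>2)) has_sum
     (c * (LINT y|lborel. (LINT x|lborel. f' x * cnj (f' y) * rotated_mehler_vec (\<lambda>j. of_real (r j)) x y)))) UNIV"
proof -
  note [measurable] = f'(1)
  have fm: "f \<in> borel_measurable lebesgue" using ff unfolding has_fourier_L2_def L2_def by auto
  have cf: "(\<lambda>x. c * f' x) \<in> borel_measurable borel" "AE x in lborel. c * f x = c * f' x"
    using f'(2) by auto
  obtain F where "\<And>m. F m \<in> borel_measurable borel" "\<And>m. integrable lborel (F m)"
    "\<And>m. integrable lborel (\<lambda>x. (norm (F m x))\<^sup>2)"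
    "(\<lambda>m. \<integral>\<^sup>+x. ennreal ((norm (F m x - f' x))\<^sup>2) \<partial>lborel) \<longlonglongrightarrow> 0"
    "(\<lambda>m. \<integral>\<^sup>+x. ennreal ((norm (fourier_L1 (F m) x - c * f' x))\<^sup>2) \<partial>lborel) \<longlonglongrightarrow> 0"
    and f2: "integrable lborel (\<lambda>x. (norm (f' x))\<^sup>2)" and "integrable lborel (\<lambda>x. (norm (c * f' x))\<^sup>2)"
    by (rule has_fourier_L2_borel[OF ff f' cf that])
  define M where "M x y = (\<Prod>j\<in>UNIV. mehler_kernel (r j) (x $ j) (y $ j))" for x y :: "real ^ 'n"
  define w where "w x = norm (f' x) * exp (- (1/6) * (x \<bullet> x))" for x
  have wi: "integrable lborel w" unfolding w_def by (rule integrable_L2_times_gaussian[OF f'(1) f2]) simp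
  let ?P = "lborel \<Otimes>\<^sub>M lborel :: ((real ^ 'n) \<times> (real ^ 'n)) measure"
  let ?u = "\<lambda>\<alpha> p. f' (fst p) * cnj (f' (snd p)) * of_real ((\<Prod>j\<in>UNIV. r j ^ \<alpha> j) * (hermite_Phi \<alpha> (fst p) * hermite_Phi \<alpha> (snd p)))"
  let ?G = "\<lambda>p. 2 ^ CARD('n) * (w (fst p) * w (snd p))"
  have meas: "?u \<alpha> \<in> borel_measurable ?P" for \<alpha> by measurable
  have hs: "((\<lambda>\<alpha>. ?u \<alpha> p) has_sum (f' (fst p) * cnj (f' (snd p)) * of_real (M (fst p) (snd p)))) UNIV" for p
    unfolding M_def by (intro has_sum_cmult_right has_sum_of_real mehler_vec_has_sum r)
  have bd: "(\<Sum>\<alpha>\<in>F. norm (?u \<alpha> p)) \<le> ?G p" if "finite F" for F p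
  proof -
    have "(\<Sum>\<alpha>\<in>F. norm (?u \<alpha> p)) = norm (f' (fst p)) * norm (f' (snd p)) * (\<Sum>\<alpha>\<in>F. norm ((\<Prod>j\<in>UNIV. r j ^ \<alpha> j) * (hermite_Phi \<alpha> (fst p) * hermite_Phi \<alpha> (snd p))))"
      unfolding sum_distrib_left by (intro sum.cong refl) (simp only: norm_mult complex_mod_cnj norm_of_real real_norm_def)
    also have "\<dots> \<le> norm (f' (fst p)) * norm (f' (snd p)) * (2 ^ CARD('n) * (exp (- (fst p \<bullet> fst p) / 6) * exp (- (snd p \<bullet> snd p) / 6)))"
      by (intro mult_left_mono mehler_vec_majorant r that) auto
    also have "\<dots> = ?G p" unfolding w_def by simp
    finally show ?thesis .
  qed
  have Gi: "integrable ?P ?G" by (intro integrable_mult_right integrable_prod_lborel wi)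
  note D = has_sum_integral_dominated[OF infinite_UNIV_fun_nat meas hs bd Gi]
  have ui: "integrable ?P (?u \<alpha>)" for \<alpha>
  proof (rule Bochner_Integration.integrable_bound[OF Gi meas])
    have le: "norm (?u \<alpha> p) \<le> ?G p" for p using bd[of "{\<alpha>}" p] by simp
    show "AE p in ?P. norm (?u \<alpha> p) \<le> norm (?G p)"
      unfolding real_norm_def by (intro AE_I2 order_trans[OF le abs_ge_self])
  qed
  have term_eq: "(LINT p|?P. ?u \<alpha> p) = complex_of_real ((\<Prod>j\<in>UNIV. r j ^ \<alpha> j) * (norm (hermite_coeff f \<alpha>))\<^sup>2)" for \<alpha>
  proof -
    let ?p = "\<Prod>j\<in>UNIV. r j ^ \<alpha> j"
    have cc: "(LINT x|lborel. f' x * of_real (hermite_Phi \<alpha> x)) = hermite_coeff f \<alpha>"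
      by (rule hermite_coeff_lborel[symmetric, OF fm f'])
    have cc': "(LINT y|lborel. cnj (f' y) * of_real (hermite_Phi \<alpha> y)) = cnj (hermite_coeff f \<alpha>)"
      unfolding cc[symmetric] by (subst Bochner_Integration.integral_cnj[symmetric]) simp
    have "(LINT p|?P. ?u \<alpha> p) = (LINT x|lborel. (LINT y|lborel. ?u \<alpha> (x, y)))"
      by (rule lborel_pair.integral_fst'[OF ui, symmetric])
    also have "\<dots> = (LINT x|lborel. (of_real ?p * cnj (hermite_coeff f \<alpha>)) * (f' x * of_real (hermite_Phi \<alpha> x)))"
    proof (rule Bochner_Integration.integral_cong[OF refl])
      fix x
      have "(LINT y|lborel. ?u \<alpha> (x, y)) = (LINT y|lborel. (of_real ?p * (f' x * of_real (hermite_Phi \<alpha> x))) * (cnj (f' y) * of_real (hermite_Phi \<alpha> y)))"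
        by (intro Bochner_Integration.integral_cong) (auto simp: mult_ac)
      also have "\<dots> = (of_real ?p * (f' x * of_real (hermite_Phi \<alpha> x))) * cnj (hermite_coeff f \<alpha>)"
        unfolding cc'[symmetric] by (rule integral_mult_right_zero)
      finally show "(LINT y|lborel. ?u \<alpha> (x, y)) = (of_real ?p * cnj (hermite_coeff f \<alpha>)) * (f' x * of_real (hermite_Phi \<alpha> x))"
        by (simp only: mult_ac)
    qed
    also have "\<dots> = (of_real ?p * cnj (hermite_coeff f \<alpha>)) * hermite_coeff f \<alpha>"
      unfolding cc[symmetric] by (rule integral_mult_right_zero)
    also have "\<dots> = of_real (?p * (norm (hermite_coeff f \<alpha>))\<^sup>2)"
      unfolding of_real_mult complex_norm_square by (simp only: mult_ac)
    finally show ?thesis .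
  qed
  have r1: "r j < 1" for j using r(2)[of j] by simp
  have inner: "(LINT x|lborel. f' x * of_real (M x y)) = c * (LINT x|lborel. f' x * rotated_mehler_vec (\<lambda>j. of_real (r j)) x y)" for y
  proof -
    note \<Psi> = rotated_mehler_vec_fourier[of r, OF r(1) r1]
    have "(LINT x|lborel. f' x * of_real (M x y)) = (LINT x|lborel. f' x * fourier_L1 (\<lambda>\<xi>. rotated_mehler_vec (\<lambda>j. of_real (r j)) \<xi> y) x)"
      unfolding \<Psi>(3) M_def ..
    also have "\<dots> = (LINT x|lborel. (c * f' x) * rotated_mehler_vec (\<lambda>j. of_real (r j)) x y)"
      by (rule has_fourier_L2_multiplication[OF ff f' cf \<Psi>(1,2)])
    also have "\<dots> = c * (LINT x|lborel. f' x * rotated_mehler_vec (\<lambda>j. of_real (r j)) x y)"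
      unfolding mult.assoc by (rule integral_mult_right_zero)
    finally show ?thesis .
  qed
  have "(LINT p|?P. f' (fst p) * cnj (f' (snd p)) * of_real (M (fst p) (snd p)))
      = (LINT y|lborel. (LINT x|lborel. f' x * cnj (f' y) * of_real (M x y)))"
  proof -
    have "integrable ?P (\<lambda>(x, y). f' x * cnj (f' y) * of_real (M x y))" using D(1) by (simp add: case_prod_unfold)
    from lborel_pair.integral_snd[OF this] show ?thesis by (simp add: case_prod_unfold)
  qed
  also have "\<dots> = (LINT y|lborel. c * (LINT x|lborel. f' x * cnj (f' y) * rotated_mehler_vec (\<lambda>j. of_real (r j)) x y))"
  proof (rule Bochner_Integration.integral_cong[OF refl])
    fix y
    have pull: "(LINT x|lborel. f' x * cnj (f' y) * k x) = cnj (f' y) * (LINT x|lborel. f' x * k x)" for k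
      by (subst integral_mult_right_zero[symmetric]) (simp only: mult_ac)
    show "(LINT x|lborel. f' x * cnj (f' y) * of_real (M x y)) = c * (LINT x|lborel. f' x * cnj (f' y) * rotated_mehler_vec (\<lambda>j. of_real (r j)) x y)"
      unfolding pull inner by (simp only: mult_ac)
  qed
  also have "\<dots> = c * (LINT y|lborel. (LINT x|lborel. f' x * cnj (f' y) * rotated_mehler_vec (\<lambda>j. of_real (r j)) x y))"
    by (rule integral_mult_right_zero)
  finally have S: "(LINT p|?P. f' (fst p) * cnj (f' (snd p)) * of_real (M (fst p) (snd p)))
    = c * (LINT y|lborel. (LINT x|lborel. f' x * cnj (f' y) * rotated_mehler_vec (\<lambda>j. of_real (r j)) x y))" .
  show ?thesis using D(2) unfolding term_eq S .
qed

section \<open>Gaussian decay from the double integral\<close>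

lemma nn_integral_gaussian_vec:
  fixes b :: "real ^ 'n::finite" and g :: real
  assumes g: "g > 0"
  shows "(\<integral>\<^sup>+v. ennreal (exp (b \<bullet> v - g * (v \<bullet> v))) \<partial>lborel) = ennreal (sqrt (pi / g) ^ CARD('n) * exp (b \<bullet> b / (4 * g)))"
proof -
  have 1: "has_bochner_integral lborel (\<lambda>v. exp (b $ j * v - g * v\<^sup>2)) (sqrt (pi / g) * exp ((b $ j)\<^sup>2 / (4 * g)))" for j
    by (rule gaussian_real_has_integral[OF g])
  then have "has_bochner_integral lborel (\<lambda>v::real^'n. \<Prod>j\<in>UNIV. exp (b $ j * v $ j - g * (v $ j)\<^sup>2))
      (\<Prod>j\<in>UNIV. (LINT s|lborel. exp (b $ j * s - g * s\<^sup>2)))"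
    by (intro lborel_vec_prod_integral) (auto simp: has_bochner_integral_iff)
  moreover have "(\<Prod>j\<in>UNIV. exp (b $ j * v $ j - g * (v $ j)\<^sup>2)) = exp (b \<bullet> v - g * (v \<bullet> v))" for v
    unfolding exp_sum[OF finite, symmetric] by (simp add: inner_vec_def sum_subtractf sum_distrib_left power2_eq_square)
  moreover have "(\<Prod>j\<in>UNIV. (LINT s|lborel. exp (b $ j * s - g * s\<^sup>2))) = sqrt (pi / g) ^ CARD('n) * exp (b \<bullet> b / (4 * g))"
  proof -
    have "(LINT s|lborel. exp (b $ j * s - g * s\<^sup>2)) = sqrt (pi / g) * exp ((b $ j)\<^sup>2 / (4 * g))" for j
      using 1[of j] by (simp add: has_bochner_integral_iff)
    moreover have "(\<Prod>j\<in>UNIV. exp ((b $ j)\<^sup>2 / (4 * g))) = exp (b \<bullet> b / (4 * g))"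
      unfolding exp_sum[OF finite, symmetric] by (simp add: inner_vec_def sum_divide_distrib power2_eq_square)
    ultimately show ?thesis by (simp add: prod.distrib)
  qed
  ultimately have "has_bochner_integral lborel (\<lambda>v. exp (b \<bullet> v - g * (v \<bullet> v))) (sqrt (pi / g) ^ CARD('n) * exp (b \<bullet> b / (4 * g)))"
    by simp
  then show ?thesis by (simp add: has_bochner_integral_iff nn_integral_eq_integral)
qed

text \<open>
  The kernel \<open>exp (a (x \<bullet> x'))\<close> is, up to a constant, \<open>\<integral> k(x, v) k(x', v) dv\<close> for a real Gaussian \<open>k\<close>. So
  finiteness of the double integral means that \<open>\<Theta>(v) = \<integral> |f(x)| k(x, v) dx\<close> is square integrable. Pairing
  \<open>\<Theta>\<close> with a wide Gaussian in \<open>v\<close> is then finite by Cauchy-Schwarz, and it returns \<open>|f|\<close> integrated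
  against a Gaussian weight whose exponent is as close to \<open>a / 2\<close> as desired.
\<close>

lemma weighted_integrable_of_double_integral:
  fixes f :: "real ^ 'n::finite \<Rightarrow> complex"
  assumes [measurable]: "f \<in> borel_measurable borel" and a: "0 < a1" "a1 < a"
    and K: "(\<integral>\<^sup>+x. (\<integral>\<^sup>+y. ennreal (norm (f x) * norm (f y) * exp (a * \<bar>x \<bullet> y\<bar>)) \<partial>lborel) \<partial>lborel) < \<infinity>"
  shows "integrable lborel (\<lambda>x. norm (f x) * exp (a1 / 2 * (x \<bullet> x)))"
proof -
  let ?n = "CARD('n)"
  define k where "k x v = exp (- (a / 2) * (x \<bullet> x) + sqrt (2 * a) * (x \<bullet> v) - 1/2 * (v \<bullet> v))" for x v :: "real ^ 'n"
  define \<Theta> where "\<Theta> v = (\<integral>\<^sup>+x. ennreal (norm (f x) * k x v) \<partial>lborel)" for v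
  have k0: "k x v > 0" for x v unfolding k_def by simp
  have [measurable (raw)]: "(\<lambda>p. k (u p) (v p)) \<in> borel_measurable M"
    if [measurable]: "u \<in> borel_measurable M" "v \<in> borel_measurable M" for u v and M :: "((real ^ 'n) \<times> (real ^ 'n)) measure"
    unfolding k_def by measurable
  have [measurable]: "(\<lambda>x. k x v) \<in> borel_measurable borel" "k x \<in> borel_measurable borel" for x v unfolding k_def by measurable
  have \<Theta>m [measurable]: "\<Theta> \<in> borel_measurable borel"
  proof -
    have "(\<lambda>v. \<integral>\<^sup>+x. (\<lambda>(v, x). ennreal (norm (f x) * k x v)) (v, x) \<partial>lborel) \<in> borel_measurable lborel"
      by (rule sigma_finite_measure.borel_measurable_nn_integral_fst) (auto simp: sigma_finite_lborel case_prod_unfold)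
    then show ?thesis unfolding \<Theta>_def by simp
  qed
  have kk: "(\<integral>\<^sup>+v. ennreal (k x v * k x' v) \<partial>lborel) = ennreal (sqrt pi ^ ?n * exp (a * (x \<bullet> x')))" for x x'
  proof -
    have "k x v * k x' v = exp (- (a / 2) * (x \<bullet> x + x' \<bullet> x')) * exp ((sqrt (2 * a) *\<^sub>R (x + x')) \<bullet> v - 1 * (v \<bullet> v))" for v
      unfolding k_def exp_add[symmetric] by (rule arg_cong[where f = exp]) (simp add: algebra_simps inner_add_left inner_commute)
    then have "(\<integral>\<^sup>+v. ennreal (k x v * k x' v) \<partial>lborel) =
       (\<integral>\<^sup>+v. ennreal (exp (- (a / 2) * (x \<bullet> x + x' \<bullet> x'))) * ennreal (exp ((sqrt (2 * a) *\<^sub>R (x + x')) \<bullet> v - 1 * (v \<bullet> v))) \<partial>lborel)"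
      by (simp only: ennreal_mult exp_ge_zero)
    also have "\<dots> = ennreal (exp (- (a / 2) * (x \<bullet> x + x' \<bullet> x'))) * (\<integral>\<^sup>+v. ennreal (exp ((sqrt (2 * a) *\<^sub>R (x + x')) \<bullet> v - 1 * (v \<bullet> v))) \<partial>lborel)"
      by (rule nn_integral_cmult) measurable
    also have "\<dots> = ennreal (exp (- (a / 2) * (x \<bullet> x + x' \<bullet> x')) * (sqrt (pi / 1) ^ ?n * exp ((sqrt (2 * a) *\<^sub>R (x + x')) \<bullet> (sqrt (2 * a) *\<^sub>R (x + x')) / (4 * 1))))"
      by (subst nn_integral_gaussian_vec) (simp_all add: ennreal_mult)
    also have "exp (- (a / 2) * (x \<bullet> x + x' \<bullet> x')) * (sqrt (pi / 1) ^ ?n * exp ((sqrt (2 * a) *\<^sub>R (x + x')) \<bullet> (sqrt (2 * a) *\<^sub>R (x + x')) / (4 * 1)))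
       = sqrt pi ^ ?n * exp (- (a / 2) * (x \<bullet> x + x' \<bullet> x') + (sqrt (2 * a) *\<^sub>R (x + x')) \<bullet> (sqrt (2 * a) *\<^sub>R (x + x')) / 4)"
      unfolding exp_add by simp
    also have "- (a / 2) * (x \<bullet> x + x' \<bullet> x') + (sqrt (2 * a) *\<^sub>R (x + x')) \<bullet> (sqrt (2 * a) *\<^sub>R (x + x')) / 4 = a * (x \<bullet> x')"
    proof -
      have "sqrt (2 * a) * sqrt (2 * a) = 2 * a" using a by simp
      then have "(sqrt (2 * a) *\<^sub>R (x + x')) \<bullet> (sqrt (2 * a) *\<^sub>R (x + x')) = 2 * a * ((x + x') \<bullet> (x + x'))"
        by (simp only: inner_scaleR_left inner_scaleR_right mult.assoc[symmetric])
      then show ?thesis by (simp add: inner_add_left inner_add_right inner_commute algebra_simps)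
    qed
    finally show ?thesis .
  qed
  have sq: "(\<integral>\<^sup>+v. (\<Theta> v)\<^sup>2 \<partial>lborel) < \<infinity>"
  proof -
    let ?u = "\<lambda>x. ennreal (norm (f x))"
    have "(\<integral>\<^sup>+v. (\<Theta> v)\<^sup>2 \<partial>lborel) = (\<integral>\<^sup>+v. (\<integral>\<^sup>+x. (\<integral>\<^sup>+x'. ?u x * ?u x' * ennreal (k x v * k x' v) \<partial>lborel) \<partial>lborel) \<partial>lborel)"
    proof (rule nn_integral_cong)
      fix v :: "real ^ 'n"
      have "(\<Theta> v)\<^sup>2 = (\<integral>\<^sup>+x. ennreal (norm (f x) * k x v) * \<Theta> v \<partial>lborel)"
        unfolding power2_eq_square by (subst \<Theta>_def, subst nn_integral_multc[symmetric]) auto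
      also have "\<dots> = (\<integral>\<^sup>+x. (\<integral>\<^sup>+x'. ?u x * ?u x' * ennreal (k x v * k x' v) \<partial>lborel) \<partial>lborel)"
      proof (rule nn_integral_cong)
        fix x :: "real ^ 'n"
        have "ennreal (norm (f x) * k x v) * \<Theta> v = (\<integral>\<^sup>+x'. ennreal (norm (f x) * k x v) * ennreal (norm (f x') * k x' v) \<partial>lborel)"
          unfolding \<Theta>_def by (rule nn_integral_cmult[symmetric]) measurable
        also have "\<dots> = (\<integral>\<^sup>+x'. ?u x * ?u x' * ennreal (k x v * k x' v) \<partial>lborel)"
          by (intro nn_integral_cong) (simp add: ennreal_mult less_imp_le[OF k0] mult_ac)
        finally show "ennreal (norm (f x) * k x v) * \<Theta> v = (\<integral>\<^sup>+x'. ?u x * ?u x' * ennreal (k x v * k x' v) \<partial>lborel)" .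
      qed
      finally show "(\<Theta> v)\<^sup>2 = (\<integral>\<^sup>+x. (\<integral>\<^sup>+x'. ?u x * ?u x' * ennreal (k x v * k x' v) \<partial>lborel) \<partial>lborel)" .
    qed
    also have "\<dots> = (\<integral>\<^sup>+x. (\<integral>\<^sup>+v. (\<integral>\<^sup>+x'. ?u x * ?u x' * ennreal (k x v * k x' v) \<partial>lborel) \<partial>lborel) \<partial>lborel)"
    proof (rule lborel_pair.Fubini')
      have "(\<lambda>p. \<integral>\<^sup>+x'. (\<lambda>q. ?u (fst (fst q)) * ?u (snd q) * ennreal (k (fst (fst q)) (snd (fst q)) * k (snd q) (snd (fst q)))) (p, x') \<partial>lborel)
           \<in> borel_measurable (lborel \<Otimes>\<^sub>M lborel)"
        unfolding k_def
        by (rule sigma_finite_measure.borel_measurable_nn_integral_fst) (auto simp: sigma_finite_lborel)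
      then show "(\<lambda>(x, v). \<integral>\<^sup>+x'. ?u x * ?u x' * ennreal (k x v * k x' v) \<partial>lborel) \<in> borel_measurable (lborel \<Otimes>\<^sub>M lborel)"
        by (simp add: case_prod_unfold)
    qed
    also have "\<dots> = (\<integral>\<^sup>+x. (\<integral>\<^sup>+x'. ?u x * ?u x' * ennreal (sqrt pi ^ ?n * exp (a * (x \<bullet> x'))) \<partial>lborel) \<partial>lborel)"
    proof (rule nn_integral_cong)
      fix x :: "real ^ 'n"
      have "(\<integral>\<^sup>+v. (\<integral>\<^sup>+x'. ?u x * ?u x' * ennreal (k x v * k x' v) \<partial>lborel) \<partial>lborel) = (\<integral>\<^sup>+x'. (\<integral>\<^sup>+v. ?u x * ?u x' * ennreal (k x v * k x' v) \<partial>lborel) \<partial>lborel)"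
        by (rule lborel_pair.Fubini') (simp add: case_prod_unfold)
      also have "\<dots> = (\<integral>\<^sup>+x'. ?u x * ?u x' * ennreal (sqrt pi ^ ?n * exp (a * (x \<bullet> x'))) \<partial>lborel)"
        unfolding kk[symmetric] by (intro nn_integral_cong nn_integral_cmult) measurable
      finally show "(\<integral>\<^sup>+v. (\<integral>\<^sup>+x'. ?u x * ?u x' * ennreal (k x v * k x' v) \<partial>lborel) \<partial>lborel) = \<dots>" .
    qed
    also have "\<dots> \<le> (\<integral>\<^sup>+x. (\<integral>\<^sup>+x'. ennreal (sqrt pi ^ ?n) * ennreal (norm (f x) * norm (f x') * exp (a * \<bar>x \<bullet> x'\<bar>)) \<partial>lborel) \<partial>lborel)"
    proof (intro nn_integral_mono)
      fix x x' :: "real ^ 'n"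
      have "a * (x \<bullet> x') \<le> a * \<bar>x \<bullet> x'\<bar>" using a by (intro mult_left_mono) auto
      then have "norm (f x) * norm (f x') * (sqrt pi ^ ?n * exp (a * (x \<bullet> x'))) \<le> norm (f x) * norm (f x') * (sqrt pi ^ ?n * exp (a * \<bar>x \<bullet> x'\<bar>))"
        by (intro mult_left_mono) auto
      then have "norm (f x) * norm (f x') * (sqrt pi ^ ?n * exp (a * (x \<bullet> x'))) \<le> sqrt pi ^ ?n * (norm (f x) * norm (f x') * exp (a * \<bar>x \<bullet> x'\<bar>))"
        by (simp only: mult_ac)
      then show "?u x * ?u x' * ennreal (sqrt pi ^ ?n * exp (a * (x \<bullet> x'))) \<le> ennreal (sqrt pi ^ ?n) * ennreal (norm (f x) * norm (f x') * exp (a * \<bar>x \<bullet> x'\<bar>))"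
        by (simp add: ennreal_mult[symmetric] ennreal_leI)
    qed
    also have "\<dots> = ennreal (sqrt pi ^ ?n) * (\<integral>\<^sup>+x. (\<integral>\<^sup>+x'. ennreal (norm (f x) * norm (f x') * exp (a * \<bar>x \<bullet> x'\<bar>)) \<partial>lborel) \<partial>lborel)"
      by (simp add: nn_integral_cmult)
    also have "\<dots> < \<infinity>" using K by (simp add: ennreal_mult_less_top)
    finally show ?thesis .
  qed
  \<comment> \<open>Integrating against the Gaussian of parameter eps yields the exponent a / (1 + eps) - a / 2, which is a1 / 2 for this eps.\<close>
  define \<epsilon> where "\<epsilon> = (a - a1) / (a + a1)"
  have \<epsilon>: "\<epsilon> > 0" "2 * a / (1 + \<epsilon>) = a + a1"
  proof -
    show "\<epsilon> > 0" unfolding \<epsilon>_def using a by simp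
    have "1 + \<epsilon> = 2 * a / (a + a1)" unfolding \<epsilon>_def using a by (simp add: field_simps)
    then show "2 * a / (1 + \<epsilon>) = a + a1" using a by simp
  qed
  let ?e = "\<lambda>v::real^'n. ennreal (exp (- (\<epsilon> / 2) * (v \<bullet> v)))"
  define C where "C = sqrt (pi / ((1 + \<epsilon>) / 2)) ^ ?n"
  have Cpos: "C > 0" unfolding C_def using \<epsilon>(1) by simp
  have ke: "(\<integral>\<^sup>+v. ennreal (k x v) * ?e v \<partial>lborel) = ennreal (C * exp (a1 / 2 * (x \<bullet> x)))" for x
  proof -
    have "ennreal (k x v) * ?e v = ennreal (exp (- (a / 2) * (x \<bullet> x))) * ennreal (exp ((sqrt (2 * a) *\<^sub>R x) \<bullet> v - ((1 + \<epsilon>) / 2) * (v \<bullet> v)))" for v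
      unfolding k_def by (subst (1 2) ennreal_mult[symmetric]) (auto simp: algebra_simps add_divide_distrib simp flip: exp_add)
    then have "(\<integral>\<^sup>+v. ennreal (k x v) * ?e v \<partial>lborel) = ennreal (exp (- (a / 2) * (x \<bullet> x))) * (\<integral>\<^sup>+v. ennreal (exp ((sqrt (2 * a) *\<^sub>R x) \<bullet> v - ((1 + \<epsilon>) / 2) * (v \<bullet> v))) \<partial>lborel)"
      by (simp add: nn_integral_cmult)
    also have "\<dots> = ennreal (exp (- (a / 2) * (x \<bullet> x)) * (C * exp ((sqrt (2 * a) *\<^sub>R x) \<bullet> (sqrt (2 * a) *\<^sub>R x) / (4 * ((1 + \<epsilon>) / 2)))))"
      unfolding C_def using \<epsilon>(1) by (subst nn_integral_gaussian_vec) (simp_all add: ennreal_mult)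
    also have "exp (- (a / 2) * (x \<bullet> x)) * (C * exp ((sqrt (2 * a) *\<^sub>R x) \<bullet> (sqrt (2 * a) *\<^sub>R x) / (4 * ((1 + \<epsilon>) / 2))))
       = C * exp (- (a / 2) * (x \<bullet> x) + (sqrt (2 * a) *\<^sub>R x) \<bullet> (sqrt (2 * a) *\<^sub>R x) / (4 * ((1 + \<epsilon>) / 2)))"
      unfolding exp_add by simp
    also have "- (a / 2) * (x \<bullet> x) + (sqrt (2 * a) *\<^sub>R x) \<bullet> (sqrt (2 * a) *\<^sub>R x) / (4 * ((1 + \<epsilon>) / 2)) = a1 / 2 * (x \<bullet> x)"
    proof -
      have s: "sqrt (2 * a) * sqrt (2 * a) = 2 * a" using a by simp
      have "(sqrt (2 * a) *\<^sub>R x) \<bullet> (sqrt (2 * a) *\<^sub>R x) / (4 * ((1 + \<epsilon>) / 2)) = 2 * a * (x \<bullet> x) / (2 * (1 + \<epsilon>))"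
      proof -
        have d: "4 * ((1 + \<epsilon>) / 2) = 2 * (1 + \<epsilon>)" by simp
        show ?thesis unfolding d inner_scaleR_left inner_scaleR_right mult.assoc[symmetric] s ..
      qed
      also have "\<dots> = (2 * a / (1 + \<epsilon>)) * (x \<bullet> x) / 2" by simp
      finally show ?thesis unfolding \<epsilon>(2) by (simp add: algebra_simps add_divide_distrib)
    qed
    finally show ?thesis .
  qed
  have "(\<integral>\<^sup>+v. \<Theta> v * ?e v \<partial>lborel)\<^sup>2 \<le> (\<integral>\<^sup>+v. (\<Theta> v)\<^sup>2 \<partial>lborel) * (\<integral>\<^sup>+v. (?e v)\<^sup>2 \<partial>lborel)"
    by (rule Cauchy_Schwarz_nn_integral) measurable
  also have "(\<integral>\<^sup>+v. (?e v)\<^sup>2 \<partial>lborel) = (\<integral>\<^sup>+v. ennreal (exp ((0 :: real ^ 'n) \<bullet> v - \<epsilon> * (v \<bullet> v))) \<partial>lborel)"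
    by (intro nn_integral_cong) (simp add: ennreal_power power2_eq_square ennreal_mult[symmetric] flip: exp_add)
  also have "(\<integral>\<^sup>+v. (\<Theta> v)\<^sup>2 \<partial>lborel) * \<dots> < \<infinity>"
    using sq \<epsilon>(1) by (subst nn_integral_gaussian_vec) (auto simp: ennreal_mult_less_top)
  finally have fin2: "(\<integral>\<^sup>+v. \<Theta> v * ?e v \<partial>lborel)\<^sup>2 < \<infinity>" .
  have fin: "(\<integral>\<^sup>+v. \<Theta> v * ?e v \<partial>lborel) < \<infinity>"
  proof (rule ccontr)
    assume "\<not> ?thesis"
    then have "(\<integral>\<^sup>+v. \<Theta> v * ?e v \<partial>lborel) = top" by (simp add: not_less top_unique)
    with fin2 show False by (simp add: power2_eq_square)
  qed
  have "(\<integral>\<^sup>+v. \<Theta> v * ?e v \<partial>lborel) = (\<integral>\<^sup>+v. (\<integral>\<^sup>+x. ennreal (norm (f x)) * (ennreal (k x v) * ?e v) \<partial>lborel) \<partial>lborel)"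
    unfolding \<Theta>_def by (intro nn_integral_cong, subst nn_integral_multc[symmetric]) (auto simp: ennreal_mult less_imp_le[OF k0] mult_ac intro!: nn_integral_cong)
  also have "\<dots> = (\<integral>\<^sup>+x. (\<integral>\<^sup>+v. ennreal (norm (f x)) * (ennreal (k x v) * ?e v) \<partial>lborel) \<partial>lborel)"
    by (rule lborel_pair.Fubini') (simp add: case_prod_unfold)
  also have "\<dots> = (\<integral>\<^sup>+x. ennreal C * ennreal (norm (f x) * exp (a1 / 2 * (x \<bullet> x))) \<partial>lborel)"
  proof (rule nn_integral_cong)
    fix x :: "real ^ 'n"
    have "(\<integral>\<^sup>+v. ennreal (norm (f x)) * (ennreal (k x v) * ?e v) \<partial>lborel) = ennreal (norm (f x)) * (\<integral>\<^sup>+v. ennreal (k x v) * ?e v \<partial>lborel)"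
      by (rule nn_integral_cmult) measurable
    then show "(\<integral>\<^sup>+v. ennreal (norm (f x)) * (ennreal (k x v) * ?e v) \<partial>lborel) = ennreal C * ennreal (norm (f x) * exp (a1 / 2 * (x \<bullet> x)))"
      unfolding ke using Cpos by (simp add: ennreal_mult mult_ac)
  qed
  also have "\<dots> = ennreal C * (\<integral>\<^sup>+x. ennreal (norm (f x) * exp (a1 / 2 * (x \<bullet> x))) \<partial>lborel)" by (rule nn_integral_cmult) measurable
  finally have "ennreal C * (\<integral>\<^sup>+x. ennreal (norm (f x) * exp (a1 / 2 * (x \<bullet> x))) \<partial>lborel) < \<infinity>" using fin by simp
  then have "(\<integral>\<^sup>+x. ennreal (norm (f x) * exp (a1 / 2 * (x \<bullet> x))) \<partial>lborel) < \<infinity>"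
    using Cpos by (auto simp: ennreal_mult_less_top)
  then show ?thesis by (intro integrableI_bounded) auto
qed

text \<open>
  Fubini's theorem for the integral over \<open>x\<close>, \<open>x'\<close> and \<open>v\<close>. The kernels may grow in \<open>x\<close>, and \<open>g\<close> measures
  by how much; \<open>u\<close> and \<open>w\<close> must be integrable against it.
\<close>

lemma integral_of_product_of_transforms:
  fixes u w :: "real ^ 'n::finite \<Rightarrow> complex" and P Q :: "real ^ 'n \<Rightarrow> real ^ 'n \<Rightarrow> complex" and g :: "real ^ 'n \<Rightarrow> real"
  assumes [measurable]: "u \<in> borel_measurable borel" "w \<in> borel_measurable borel"
      "(\<lambda>p. P (fst p) (snd p)) \<in> borel_measurable (borel \<Otimes>\<^sub>M borel)" "(\<lambda>p. Q (fst p) (snd p)) \<in> borel_measurable (borel \<Otimes>\<^sub>M borel)"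
    and ug: "integrable lborel (\<lambda>x. norm (u x) * g x)" and wg: "integrable lborel (\<lambda>x. norm (w x) * g x)"
    and PQ: "\<And>x x'. integrable lborel (\<lambda>v. P x v * Q x' v)"
    and bd: "\<And>x x'. (LINT v|lborel. norm (P x v * Q x' v)) \<le> C * (g x * g x')"
  shows "integrable lborel (\<lambda>v. (LINT x|lborel. u x * P x v) * (LINT x|lborel. w x * Q x v))"
    and "(LINT v|lborel. (LINT x|lborel. u x * P x v) * (LINT x|lborel. w x * Q x v)) =
      (LINT q|(lborel \<Otimes>\<^sub>M lborel). u (fst q) * w (snd q) * (LINT v|lborel. P (fst q) v * Q (snd q) v))"
proof -
  let ?E = "lborel :: ((real ^ 'n) \<times> (real ^ 'n)) measure"
  let ?F = "\<lambda>q v. u (fst q) * w (snd q) * (P (fst q) v * Q (snd q) v)"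
  have [measurable (raw)]: "(\<lambda>z. P (a z) (b z)) \<in> borel_measurable M" "(\<lambda>z. Q (a z) (b z)) \<in> borel_measurable M"
    if [measurable]: "a \<in> borel_measurable M" "b \<in> borel_measurable M" for a b and M :: "(((real ^ 'n) \<times> (real ^ 'n)) \<times> (real ^ 'n)) measure"
  proof -
    have "(\<lambda>z. (a z, b z)) \<in> M \<rightarrow>\<^sub>M borel \<Otimes>\<^sub>M borel" by measurable
    from measurable_compose[OF this assms(3)] measurable_compose[OF this assms(4)]
    show "(\<lambda>z. P (a z) (b z)) \<in> borel_measurable M" "(\<lambda>z. Q (a z) (b z)) \<in> borel_measurable M" by simp_all
  qed
  have Fm: "(\<lambda>z. ?F (fst z) (snd z)) \<in> borel_measurable (?E \<Otimes>\<^sub>M lborel)"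
    unfolding lborel_prod[symmetric] by measurable
  have ugwg: "integrable ?E (\<lambda>q. C * ((norm (u (fst q)) * g (fst q)) * (norm (w (snd q)) * g (snd q))))"
    unfolding lborel_prod[symmetric] by (intro integrable_mult_right integrable_prod_lborel ug wg)
  have "integrable (?E \<Otimes>\<^sub>M lborel) (\<lambda>z. ?F (fst z) (snd z))"
  proof (rule lborel_pair.Fubini_integrable[OF Fm])
    show "AE q in ?E. integrable lborel (\<lambda>v. ?F (fst (q, v)) (snd (q, v)))" using PQ by simp
    show "integrable ?E (\<lambda>q. LINT v|lborel. norm (?F (fst (q, v)) (snd (q, v))))"
    proof (rule Bochner_Integration.integrable_bound[OF ugwg])
      have "(\<lambda>q. LINT v|lborel. norm (case (q, v) of (q, v) \<Rightarrow> ?F q v)) \<in> borel_measurable ?E"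
        using Fm by (intro sigma_finite_measure.borel_measurable_lebesgue_integral) (auto simp: sigma_finite_lborel case_prod_unfold)
      then show "(\<lambda>q. LINT v|lborel. norm (?F (fst (q, v)) (snd (q, v)))) \<in> borel_measurable ?E" by simp
      show "AE q in ?E. norm (LINT v|lborel. norm (?F (fst (q, v)) (snd (q, v)))) \<le> norm (C * ((norm (u (fst q)) * g (fst q)) * (norm (w (snd q)) * g (snd q))))"
      proof (rule AE_I2)
        fix q
        have "(LINT v|lborel. norm (?F q v)) = norm (u (fst q)) * norm (w (snd q)) * (LINT v|lborel. norm (P (fst q) v * Q (snd q) v))"
          by (subst integral_mult_right_zero[symmetric]) (simp add: norm_mult)
        also have "\<dots> \<le> norm (u (fst q)) * norm (w (snd q)) * (C * (g (fst q) * g (snd q)))"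
          by (intro mult_left_mono bd) simp
        also have "\<dots> = C * ((norm (u (fst q)) * g (fst q)) * (norm (w (snd q)) * g (snd q)))" by simp
        finally have le: "(LINT v|lborel. norm (?F q v)) \<le> C * ((norm (u (fst q)) * g (fst q)) * (norm (w (snd q)) * g (snd q)))" .
        have "0 \<le> (LINT v|lborel. norm (?F q v))" by (rule Bochner_Integration.integral_nonneg) simp
        with le show "norm (LINT v|lborel. norm (?F (fst (q, v)) (snd (q, v)))) \<le> norm (C * ((norm (u (fst q)) * g (fst q)) * (norm (w (snd q)) * g (snd q))))"
          by (simp only: fst_conv snd_conv real_norm_def)
      qed
    qed
  qed
  then have Fi: "integrable (?E \<Otimes>\<^sub>M lborel) (\<lambda>(q, v). ?F q v)" by (simp add: case_prod_unfold)
  have "AE v in lborel. (LINT q|?E. ?F q v) = (LINT x|lborel. u x * P x v) * (LINT x|lborel. w x * Q x v)"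
    using lborel_pair.AE_integrable_snd[OF Fi]
  proof eventually_elim
    fix v assume i: "integrable ?E (\<lambda>q. ?F q v)"
    then have i': "integrable (lborel \<Otimes>\<^sub>M lborel) (\<lambda>(x, x'). ?F (x, x') v)"
      unfolding lborel_prod by (simp add: case_prod_unfold)
    have "(LINT q|?E. ?F q v) = (LINT q|(lborel \<Otimes>\<^sub>M lborel). (case q of (x, x') \<Rightarrow> ?F (x, x') v))"
      unfolding lborel_prod by (simp add: case_prod_unfold)
    also have "\<dots> = (LINT x|lborel. (LINT x'|lborel. ?F (x, x') v))"
      by (rule lborel_pair.integral_fst[OF i', symmetric])
    also have "\<dots> = (LINT x|lborel. (u x * P x v) * (LINT x'|lborel. w x' * Q x' v))"
      by (intro Bochner_Integration.integral_cong refl, subst integral_mult_right_zero[symmetric]) (simp add: mult_ac)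
    also have "\<dots> = (LINT x|lborel. u x * P x v) * (LINT x'|lborel. w x' * Q x' v)"
      by (rule integral_mult_left_zero)
    finally show "(LINT q|?E. ?F q v) = (LINT x|lborel. u x * P x v) * (LINT x|lborel. w x * Q x v)" .
  qed
  note AE = this
  have [measurable]: "(\<lambda>v. LINT x|lborel. u x * P x v) \<in> borel_measurable lborel" "(\<lambda>v. LINT x|lborel. w x * Q x v) \<in> borel_measurable lborel"
  proof -
    have "(\<lambda>v. LINT x|lborel. (case (v, x) of (v, x) \<Rightarrow> u x * P x v)) \<in> borel_measurable lborel"
      "(\<lambda>v. LINT x|lborel. (case (v, x) of (v, x) \<Rightarrow> w x * Q x v)) \<in> borel_measurable lborel"
    proof -
      have s: "(\<lambda>p::(real^'n) \<times> (real^'n). (snd p, fst p)) \<in> lborel \<Otimes>\<^sub>M lborel \<rightarrow>\<^sub>M borel \<Otimes>\<^sub>M borel" by measurable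
      have [measurable]: "(\<lambda>p. P (snd p) (fst p)) \<in> borel_measurable (lborel \<Otimes>\<^sub>M lborel)" "(\<lambda>p. Q (snd p) (fst p)) \<in> borel_measurable (lborel \<Otimes>\<^sub>M lborel)"
        using measurable_compose[OF s assms(3)] measurable_compose[OF s assms(4)] by simp_all
      show "(\<lambda>v. LINT x|lborel. (case (v, x) of (v, x) \<Rightarrow> u x * P x v)) \<in> borel_measurable lborel"
        "(\<lambda>v. LINT x|lborel. (case (v, x) of (v, x) \<Rightarrow> w x * Q x v)) \<in> borel_measurable lborel"
        by (intro sigma_finite_measure.borel_measurable_lebesgue_integral sigma_finite_lborel; simp add: case_prod_unfold)+
    qed
    then show "(\<lambda>v. LINT x|lborel. u x * P x v) \<in> borel_measurable lborel" "(\<lambda>v. LINT x|lborel. w x * Q x v) \<in> borel_measurable lborel" by simp_all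
  qed
  have iv: "integrable lborel (\<lambda>v. LINT q|?E. ?F q v)" by (rule lborel_pair.integrable_snd[OF Fi])
  show "integrable lborel (\<lambda>v. (LINT x|lborel. u x * P x v) * (LINT x|lborel. w x * Q x v))"
    by (rule integrable_cong_AE_imp[OF iv _ AE]) measurable
  have "(LINT v|lborel. (LINT x|lborel. u x * P x v) * (LINT x|lborel. w x * Q x v)) = (LINT v|lborel. (LINT q|?E. ?F q v))"
    by (rule integral_cong_AE) (use AE iv in \<open>auto dest: borel_measurable_integrable\<close>)
  also have "\<dots> = (LINT q|?E. (LINT v|lborel. ?F q v))" by (rule lborel_pair.Fubini_integral[OF Fi])
  also have "\<dots> = (LINT q|?E. u (fst q) * w (snd q) * (LINT v|lborel. P (fst q) v * Q (snd q) v))"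
    by (intro Bochner_Integration.integral_cong refl integral_mult_right_zero)
  finally show "(LINT v|lborel. (LINT x|lborel. u x * P x v) * (LINT x|lborel. w x * Q x v)) =
      (LINT q|(lborel \<Otimes>\<^sub>M lborel). u (fst q) * w (snd q) * (LINT v|lborel. P (fst q) v * Q (snd q) v))"
    unfolding lborel_prod .
qed

section \<open>Continuation to large weights\<close>

lemma finite_multi_index_of_degree: "finite {\<alpha>::'n::finite \<Rightarrow> nat. (\<Sum>j\<in>UNIV. \<alpha> j) = k}"
proof (rule finite_subset)
  show "{\<alpha>::'n \<Rightarrow> nat. (\<Sum>j\<in>UNIV. \<alpha> j) = k} \<subseteq> PiE UNIV (\<lambda>_. {..k})"
    by (auto intro: member_le_sum)
  show "finite (PiE (UNIV :: 'n set) (\<lambda>_. {..k}))" by (intro finite_PiE) auto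
qed

text \<open>
  Scaling all weights by the same \<open>w\<close> multiplies the term of index \<open>\<alpha>\<close> by \<open>w\<close> to the degree of \<open>\<alpha>\<close>, so
  this grouping is what turns a sum over multi-indices into a power series in one variable.
\<close>

lemma has_sum_group_by_degree:
  fixes b :: "('n::finite \<Rightarrow> nat) \<Rightarrow> complex"
  assumes "(b has_sum S) UNIV"
  shows "(\<lambda>k. \<Sum>\<alpha> | (\<Sum>j\<in>UNIV. \<alpha> j) = k. b \<alpha>) sums S"
proof -
  let ?A = "\<lambda>k. {\<alpha>::'n \<Rightarrow> nat. (\<Sum>j\<in>UNIV. \<alpha> j) = k}"
  have bij: "bij_betw snd (Sigma UNIV ?A) (UNIV :: ('n \<Rightarrow> nat) set)"
    by (rule bij_betwI[where g = "\<lambda>\<alpha>. (\<Sum>j\<in>UNIV. \<alpha> j, \<alpha>)"]) auto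
  have "((\<lambda>p. b (snd p)) has_sum S) (Sigma UNIV ?A)"
    using has_sum_reindex_bij_betw[OF bij, of b S] assms by blast
  then have "((\<lambda>k. \<Sum>\<alpha>\<in>?A k. b \<alpha>) has_sum S) UNIV"
    by (rule has_sum_SigmaD) (auto intro: has_sum_finite finite_multi_index_of_degree)
  then show ?thesis by (rule has_sum_imp_sums)
qed

lemma tanh_double: "tanh (2 * s) = ((exp (2 * s))\<^sup>2 - 1) / (1 + (exp (2 * s))\<^sup>2)" for s :: real
proof -
  have "(exp (2 * s))\<^sup>2 = exp (4 * s)" by (simp add: power2_eq_square flip: exp_add)
  moreover have "exp (- 2 * (2 * s)) = 1 / exp (4 * s)" by (simp add: exp_minus field_simps)
  moreover have "(1 - 1 / E) / (1 + 1 / E) = (E - 1) / (1 + E)" if "E > 0" for E :: real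
  proof -
    have "1 - 1 / E = (E - 1) / E" "1 + 1 / E = (1 + E) / E" using that by (simp_all add: field_simps)
    then show ?thesis using that by simp
  qed
  ultimately show ?thesis unfolding tanh_real_altdef by simp
qed

text \<open>
  Scale the weights by a complex parameter \<open>w\<close>. The rotated form \<open>R(w)\<close> is holomorphic near \<open>[0, 1]\<close>, since
  there \<open>f\<close> absorbs the growth of the kernel, and for small \<open>w\<close> it is a power series in \<open>w\<close> with
  nonnegative coefficients. By Pringsheim's theorem the series converges at \<open>w = 1\<close>, where each of its
  terms is bounded by the sum.
\<close>

theorem weighted_hermite_coeff_le_form:
  fixes f :: "real ^ 'n::finite \<Rightarrow> complex" and s :: "'n \<Rightarrow> real"
  assumes ff: "has_fourier_L2 f (\<lambda>x. c * f x)" and f': "f' \<in> borel_measurable borel" "AE x in lborel. f x = f' x"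
    and wg: "integrable lborel (\<lambda>x. norm (f' x) * exp (a1 / 2 * (x \<bullet> x)))"
    and s: "\<And>j. tanh (2 * s j) < a1"
  shows "(\<Prod>j\<in>UNIV. exp (2 * s j) ^ \<alpha> j) * (norm (hermite_coeff f \<alpha>))\<^sup>2 \<le>
     norm c * norm (LINT q|(lborel \<Otimes>\<^sub>M lborel). f' (fst q) * cnj (f' (snd q)) *
        rotated_mehler_vec (\<lambda>j. of_real (exp (2 * s j))) (fst q) (snd q))"
proof -
  note [measurable] = f'(1)
  let ?P = "lborel \<Otimes>\<^sub>M lborel :: ((real ^ 'n) \<times> (real ^ 'n)) measure"
  define \<rho> where "\<rho> j = exp (2 * s j)" for j
  have \<rho>: "\<rho> j > 0" for j unfolding \<rho>_def by simp
  define T where "T z = (z\<^sup>2 - 1) / (1 + z\<^sup>2)" for z :: complex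
  define V where "V z = 2 * \<i> * z / (1 + z\<^sup>2)" for z :: complex
  define H where "H j = {w. 0 < Re (1 + (of_real (\<rho> j) * w)\<^sup>2)}" for j
  define \<kappa> where "\<kappa> j w = Re (T (of_real (\<rho> j) * w)) + \<bar>Re (V (of_real (\<rho> j) * w))\<bar>" for j w
  \<comment> \<open>The real part of the exponent of the kernel is the sum over j of Re T (x^2 + y^2) / 2 + Re V x y, and |x y| is at most (x^2 + y^2) / 2. So kappa bounds the growth of the kernel, and f absorbs it where kappa < a1.\<close>
  define \<Omega>0 where "\<Omega>0 = (\<Inter>j. H j \<inter> \<kappa> j -` {..<a1})"
  have Hnz: "1 + (of_real (\<rho> j) * w)\<^sup>2 \<noteq> 0" if "w \<in> H j" for j w
    using that unfolding H_def by force
  have openH: "open (H j)" for j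
    unfolding H_def by (intro open_Collect_less continuous_intros)
  have open\<Omega>0: "open \<Omega>0"
    unfolding \<Omega>0_def
  proof (intro open_INT ballI finite continuous_open_preimage openH open_lessThan)
    fix j show "continuous_on (H j) (\<kappa> j)"
      unfolding \<kappa>_def T_def V_def by (intro continuous_intros) (use Hnz in auto)
  qed
  have real\<Omega>0: "complex_of_real x \<in> \<Omega>0" if x: "0 \<le> x" "x \<le> 1" for x
    unfolding \<Omega>0_def
  proof (intro INT_I IntI)
    fix j
    let ?z = "\<rho> j * x"
    have e: "complex_of_real (\<rho> j) * of_real x = of_real ?z" by simp
    have p: "1 + ?z\<^sup>2 > 0" by (simp add: add_pos_nonneg)
    show "complex_of_real x \<in> H j" unfolding H_def e using p by (simp flip: of_real_power)
    have t: "T (of_real ?z) = of_real ((?z\<^sup>2 - 1) / (1 + ?z\<^sup>2))" unfolding T_def by simp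
    have v: "V (of_real ?z) = \<i> * of_real (2 * ?z / (1 + ?z\<^sup>2))" unfolding V_def by simp
    have "\<kappa> j (of_real x) = (?z\<^sup>2 - 1) / (1 + ?z\<^sup>2)" unfolding \<kappa>_def e t v by simp
    also have "\<dots> = 1 - 2 / (1 + ?z\<^sup>2)" using p by (simp add: field_simps)
    also have "\<dots> \<le> 1 - 2 / (1 + (\<rho> j)\<^sup>2)"
    proof -
      have "?z\<^sup>2 \<le> (\<rho> j)\<^sup>2" using x \<rho>[of j] by (intro power_mono) (auto simp: mult_left_le)
      then show ?thesis using p by (intro diff_left_mono divide_left_mono) (auto intro!: mult_pos_pos add_pos_nonneg)
    qed
    also have "\<dots> = ((\<rho> j)\<^sup>2 - 1) / (1 + (\<rho> j)\<^sup>2)" by (simp add: field_simps add_pos_nonneg sum_power2_eq_zero_iff add_nonneg_eq_0_iff)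
    also have "\<dots> = tanh (2 * s j)" unfolding tanh_double \<rho>_def ..
    also have "\<dots> < a1" by (rule s)
    finally show "complex_of_real x \<in> \<kappa> j -` {..<a1}" by simp
  qed
  \<comment> \<open>Pringsheim's theorem needs a convex domain; a uniform neighbourhood of the segment is one.\<close>
  define S where "S = closed_segment (0::complex) 1"
  have seg: "w \<in> S \<Longrightarrow> \<exists>x. 0 \<le> x \<and> x \<le> 1 \<and> w = of_real x" for w
    unfolding S_def closed_segment_def by (auto simp: scaleR_conv_of_real)
  have seg': "0 \<le> x \<Longrightarrow> x \<le> 1 \<Longrightarrow> complex_of_real x \<in> S" for x
    unfolding S_def closed_segment_def by (auto simp: scaleR_conv_of_real)
  have "S \<subseteq> \<Omega>0" using seg real\<Omega>0 by blast
  moreover have "compact S" unfolding S_def by simp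
  ultimately obtain \<delta> where \<delta>: "\<delta> > 0" "(\<Union>x\<in>S. ball x \<delta>) \<subseteq> \<Omega>0"
    using compact_subset_open_imp_ball_epsilon_subset[OF _ open\<Omega>0] by metis
  define \<Omega> where "\<Omega> = (\<Union>x\<in>S. \<Union>y\<in>ball 0 \<delta>. {x + y})"
  have \<Omega>eq: "\<Omega> = (\<Union>x\<in>S. ball x \<delta>)"
  proof -
    have "(\<Union>y\<in>ball 0 \<delta>. {x + y}) = ball x \<delta>" for x :: complex
    proof (intro equalityI subsetI)
      fix z assume "z \<in> ball x \<delta>"
      then show "z \<in> (\<Union>y\<in>ball 0 \<delta>. {x + y})" by (intro UN_I[of "z - x"]) (auto simp: dist_norm norm_minus_commute)
    qed (auto simp: dist_norm)
    then show ?thesis unfolding \<Omega>_def by simp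
  qed
  have \<Omega>: "open \<Omega>" "convex \<Omega>" "\<Omega> \<subseteq> \<Omega>0" "\<And>x. 0 \<le> x \<Longrightarrow> x \<le> 1 \<Longrightarrow> complex_of_real x \<in> \<Omega>"
  proof -
    show "open \<Omega>" unfolding \<Omega>eq by auto
    show "convex \<Omega>" unfolding \<Omega>_def S_def by (intro convex_sums) auto
    show "\<Omega> \<subseteq> \<Omega>0" unfolding \<Omega>eq by (rule \<delta>(2))
    show "complex_of_real x \<in> \<Omega>" if "0 \<le> x" "x \<le> 1" for x
      unfolding \<Omega>eq using seg'[OF that] \<delta>(1) by (intro UN_I[of "of_real x"]) auto
  qed
  define E where "E w q = exp (\<Sum>j\<in>UNIV. T (of_real (\<rho> j) * w) * of_real (((fst q $ j)\<^sup>2 + (snd q $ j)\<^sup>2) / 2)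
      + V (of_real (\<rho> j) * w) * of_real (fst q $ j * snd q $ j))" for w and q :: "(real ^ 'n) \<times> (real ^ 'n)"
  define Z where "Z w = (\<Prod>j\<in>UNIV. inverse (csqrt (of_real pi * (1 + (of_real (\<rho> j) * w)\<^sup>2))))" for w
  have rot: "rotated_mehler_vec (\<lambda>j. of_real (\<rho> j) * w) (fst q) (snd q) = Z w * E w q" for w q
    unfolding rotated_mehler_vec_def rotated_mehler_kernel_def Z_def E_def exp_sum[OF finite] prod.distrib[symmetric] T_def V_def
    by (simp only: divide_inverse mult.commute)
  have Eb: "norm (E w q) \<le> exp (a1 / 2 * (fst q \<bullet> fst q)) * exp (a1 / 2 * (snd q \<bullet> snd q))" if w: "w \<in> \<Omega>0" for w q
  proof -
    have "Re (\<Sum>j\<in>UNIV. T (of_real (\<rho> j) * w) * of_real (((fst q $ j)\<^sup>2 + (snd q $ j)\<^sup>2) / 2)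
      + V (of_real (\<rho> j) * w) * of_real (fst q $ j * snd q $ j)) \<le> (\<Sum>j\<in>UNIV. a1 * (((fst q $ j)\<^sup>2 + (snd q $ j)\<^sup>2) / 2))"
      unfolding Re_sum
    proof (rule sum_mono)
      fix j
      let ?x = "fst q $ j" and ?y = "snd q $ j"
      let ?t = "Re (T (of_real (\<rho> j) * w))" and ?v = "Re (V (of_real (\<rho> j) * w))"
      have "w \<in> H j \<inter> \<kappa> j -` {..<a1}" using w unfolding \<Omega>0_def by (rule INT_D) simp
      then have k: "?t + \<bar>?v\<bar> \<le> a1" unfolding \<kappa>_def by simp
      have "\<bar>?x * ?y\<bar> \<le> (?x\<^sup>2 + ?y\<^sup>2) / 2"
        using sum_squares_bound[of "\<bar>?x\<bar>" "\<bar>?y\<bar>"] by (simp add: abs_mult)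
      then have "\<bar>?v\<bar> * \<bar>?x * ?y\<bar> \<le> \<bar>?v\<bar> * ((?x\<^sup>2 + ?y\<^sup>2) / 2)" by (intro mult_left_mono) auto
      then have "?v * (?x * ?y) \<le> \<bar>?v\<bar> * ((?x\<^sup>2 + ?y\<^sup>2) / 2)"
        using abs_ge_self[of "?v * (?x * ?y)"] abs_mult[of ?v "?x * ?y"] by linarith
      moreover have "(?t + \<bar>?v\<bar>) * ((?x\<^sup>2 + ?y\<^sup>2) / 2) \<le> a1 * ((?x\<^sup>2 + ?y\<^sup>2) / 2)"
        using k by (intro mult_right_mono) auto
      moreover have "Re (T (of_real (\<rho> j) * w) * of_real ((?x\<^sup>2 + ?y\<^sup>2) / 2) + V (of_real (\<rho> j) * w) * of_real (?x * ?y))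
         = ?t * ((?x\<^sup>2 + ?y\<^sup>2) / 2) + ?v * (?x * ?y)"
        by (simp only: plus_complex.sel Re_complex_of_real times_complex.sel Im_complex_of_real mult_zero_right diff_zero)
      ultimately show "Re (T (of_real (\<rho> j) * w) * of_real ((?x\<^sup>2 + ?y\<^sup>2) / 2) + V (of_real (\<rho> j) * w) * of_real (?x * ?y)) \<le> a1 * ((?x\<^sup>2 + ?y\<^sup>2) / 2)"
        unfolding distrib_right by linarith
    qed
    also have "\<dots> = a1 / 2 * (fst q \<bullet> fst q) + a1 / 2 * (snd q \<bullet> snd q)"
      by (simp add: inner_vec_def sum_distrib_left power2_eq_square distrib_left add_divide_distrib sum.distrib)
    finally show ?thesis unfolding E_def norm_exp_eq_Re exp_add[symmetric] by simp
  qed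
  let ?f = "\<lambda>q. f' (fst q) * cnj (f' (snd q))"
  have Gi: "integrable ?P (\<lambda>q. (norm (f' (fst q)) * exp (a1 / 2 * (fst q \<bullet> fst q))) * (norm (f' (snd q)) * exp (a1 / 2 * (snd q \<bullet> snd q))))"
    by (intro integrable_prod_lborel wg)
  have Em [measurable]: "E w \<in> borel_measurable ?P" for w unfolding E_def by measurable
  have fEb: "norm (?f q * E w q) \<le> (norm (f' (fst q)) * exp (a1 / 2 * (fst q \<bullet> fst q))) * (norm (f' (snd q)) * exp (a1 / 2 * (snd q \<bullet> snd q)))"
    if "w \<in> \<Omega>0" for w q
  proof -
    have "norm (?f q * E w q) = norm (f' (fst q)) * norm (f' (snd q)) * norm (E w q)" by (simp add: norm_mult)
    also have "\<dots> \<le> norm (f' (fst q)) * norm (f' (snd q)) * (exp (a1 / 2 * (fst q \<bullet> fst q)) * exp (a1 / 2 * (snd q \<bullet> snd q)))"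
      by (intro mult_left_mono Eb that) auto
    finally show ?thesis by (simp only: mult_ac)
  qed
  have fEi: "integrable ?P (\<lambda>q. ?f q * E w q)" if "w \<in> \<Omega>0" for w
  proof (rule Bochner_Integration.integrable_bound[OF Gi])
    show "AE q in ?P. norm (?f q * E w q) \<le> norm ((norm (f' (fst q)) * exp (a1 / 2 * (fst q \<bullet> fst q))) * (norm (f' (snd q)) * exp (a1 / 2 * (snd q \<bullet> snd q))))"
      unfolding real_norm_def by (intro AE_I2 order_trans[OF fEb[OF that] abs_ge_self])
  qed measurable
  define R where "R w = c * (Z w * (LINT q|?P. ?f q * E w q))" for w
  have holint: "(\<lambda>w. LINT q|?P. ?f q * E w q) holomorphic_on \<Omega>0"
  proof (rule holomorphic_on_integral)
    show "(\<lambda>w. ?f q * E w q) holomorphic_on \<Omega>0" for q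
      unfolding E_def T_def V_def
      by (intro holomorphic_intros) (use Hnz in \<open>auto simp: \<Omega>0_def\<close>)
    show "(\<lambda>q. ?f q * E w q) \<in> borel_measurable ?P" for w by measurable
    fix w assume "w \<in> \<Omega>0"
    then obtain r where "r > 0" "ball w r \<subseteq> \<Omega>0" using open\<Omega>0 openE by blast
    then show "\<exists>r>0. \<exists>G. integrable ?P G \<and> ball w r \<subseteq> \<Omega>0 \<and> (\<forall>z\<in>ball w r. \<forall>q\<in>space ?P. norm (?f q * E z q) \<le> G q)"
      using Gi fEb by blast
  qed
  have holR: "R holomorphic_on \<Omega>"
  proof (rule holomorphic_on_subset[OF _ \<Omega>(3)])
    have "Z holomorphic_on \<Omega>0"
      unfolding Z_def
    proof (intro holomorphic_intros)
      fix j w assume "w \<in> \<Omega>0"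
      then have "0 < Re (1 + (of_real (\<rho> j) * w)\<^sup>2)" unfolding \<Omega>0_def H_def by blast
      then have re: "0 < Re (of_real pi * (1 + (of_real (\<rho> j) * w)\<^sup>2))" by simp
      then show "of_real pi * (1 + (of_real (\<rho> j) * w)\<^sup>2) \<notin> \<real>\<^sub>\<le>\<^sub>0" by (auto simp: complex_nonpos_Reals_iff)
      have "complex_of_real pi * (1 + (of_real (\<rho> j) * w)\<^sup>2) \<noteq> 0" using re by (metis less_irrefl zero_complex.sel(1))
      then show "csqrt (of_real pi * (1 + (of_real (\<rho> j) * w)\<^sup>2)) \<noteq> 0" by (simp only: csqrt_eq_0 not_False_eq_True)
    qed
    then show "R holomorphic_on \<Omega>0" unfolding R_def using holint by (intro holomorphic_intros)
  qed
  define b where "b \<alpha> = (\<Prod>j\<in>UNIV. \<rho> j ^ \<alpha> j) * (norm (hermite_coeff f \<alpha>))\<^sup>2" for \<alpha>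
  have b0: "b \<alpha> \<ge> 0" for \<alpha> unfolding b_def using \<rho> by (intro mult_nonneg_nonneg prod_nonneg) (auto intro: less_imp_le)
  define B where "B k = (\<Sum>\<alpha> | (\<Sum>j\<in>UNIV. \<alpha> j) = k. b \<alpha>)" for k
  \<comment> \<open>For positive parameters below r, all scaled weights are at most 1/4.\<close>
  define r where "r = min 1 (1 / (4 * (\<Sum>j\<in>UNIV. \<rho> j)))"
  have \<rho>le: "\<rho> j \<le> (\<Sum>j\<in>UNIV. \<rho> j)" for j using \<rho> by (intro member_le_sum) (auto intro: less_imp_le)
  have \<rho>sum: "(\<Sum>j\<in>UNIV. \<rho> j) > 0" using \<rho> by (intro sum_pos) auto
  have r: "r > 0" unfolding r_def using \<rho>sum by simp
  have Rrot: "R w = c * (LINT q|?P. ?f q * rotated_mehler_vec (\<lambda>j. of_real (\<rho> j) * w) (fst q) (snd q))" for w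
  proof -
    have "Z w * (LINT q|?P. ?f q * E w q) = (LINT q|?P. ?f q * rotated_mehler_vec (\<lambda>j. of_real (\<rho> j) * w) (fst q) (snd q))"
      unfolding rot by (subst integral_mult_right_zero[symmetric]) (simp only: mult_ac)
    then show ?thesis unfolding R_def by simp
  qed
  have "(\<lambda>k. complex_of_real (B k)) sums R 1"
  proof (rule pringsheim_continuation[OF \<Omega>(1,2,4) holR _ r])
    show "0 \<le> B k" for k unfolding B_def by (intro sum_nonneg b0)
    fix x assume x: "0 < x" "x < r"
    have rj: "0 \<le> \<rho> j * x" "\<rho> j * x \<le> 1/4" for j
    proof -
      show "0 \<le> \<rho> j * x" using \<rho>[of j] x by simp
      have "\<rho> j * x \<le> (\<Sum>j\<in>UNIV. \<rho> j) * (1 / (4 * (\<Sum>j\<in>UNIV. \<rho> j)))"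
        using x \<rho>le[of j] \<rho>[of j] unfolding r_def by (intro mult_mono) auto
      also have "\<dots> = 1/4" using \<rho>sum by simp
      finally show "\<rho> j * x \<le> 1/4" .
    qed
    have hs: "((\<lambda>\<alpha>. complex_of_real ((\<Prod>j\<in>UNIV. (\<rho> j * x) ^ \<alpha> j) * (norm (hermite_coeff f \<alpha>))\<^sup>2)) has_sum
     (c * (LINT y|lborel. (LINT x'|lborel. f' x' * cnj (f' y) * rotated_mehler_vec (\<lambda>j. of_real (\<rho> j * x)) x' y)))) UNIV"
      by (rule small_weight_identity[OF ff f' rj])
    have t: "complex_of_real ((\<Prod>j\<in>UNIV. (\<rho> j * x) ^ \<alpha> j) * (norm (hermite_coeff f \<alpha>))\<^sup>2) = of_real (b \<alpha> * x ^ (\<Sum>j\<in>UNIV. \<alpha> j))" for \<alpha>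
      unfolding b_def by (simp add: power_mult_distrib prod.distrib power_sum)
    have g: "(\<Sum>\<alpha> | (\<Sum>j\<in>UNIV. \<alpha> j) = k. complex_of_real (b \<alpha> * x ^ (\<Sum>j\<in>UNIV. \<alpha> j))) = of_real (B k * x ^ k)" for k
      unfolding B_def sum_distrib_right of_real_sum by (intro sum.cong) auto
    have inO: "complex_of_real x \<in> \<Omega>0" using x unfolding r_def by (intro real\<Omega>0) auto
    have "integrable ?P (\<lambda>q. ?f q * rotated_mehler_vec (\<lambda>j. of_real (\<rho> j) * of_real x) (fst q) (snd q))"
      using integrable_mult_right[OF fEi[OF inO], of "Z (of_real x)"] unfolding rot by (simp only: mult_ac)
    then have "integrable ?P (\<lambda>(x', y). f' x' * cnj (f' y) * rotated_mehler_vec (\<lambda>j. of_real (\<rho> j * x)) x' y)"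
      by (simp add: case_prod_unfold)
    from lborel_pair.integral_snd[OF this]
    have "R (of_real x) = c * (LINT y|lborel. (LINT x'|lborel. f' x' * cnj (f' y) * rotated_mehler_vec (\<lambda>j. of_real (\<rho> j * x)) x' y))"
      unfolding Rrot by (simp add: case_prod_unfold)
    then show "(\<lambda>k. complex_of_real (B k * x ^ k)) sums R (of_real x)"
      using has_sum_group_by_degree[OF hs] unfolding t g by simp
  qed
  then have Bs: "B sums Re (R 1)" using sums_Re by fastforce
  have B0: "0 \<le> B k" for k unfolding B_def by (intro sum_nonneg b0)
  let ?k = "\<Sum>j\<in>UNIV. \<alpha> j"
  have "b \<alpha> \<le> B ?k" unfolding B_def using b0 by (intro member_le_sum finite_multi_index_of_degree) auto
  also have "B ?k = (\<Sum>k\<in>{?k}. B k)" by simp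
  also have "\<dots> \<le> Re (R 1)" using Bs B0 by (intro sum_le_suminf[of B "{?k}", simplified sums_unique[OF Bs, symmetric]]) (auto simp: sums_iff)
  also have "\<dots> \<le> norm (R 1)" by (rule complex_Re_le_cmod)
  also have "\<dots> = norm c * norm (LINT q|?P. ?f q * rotated_mehler_vec (\<lambda>j. of_real (\<rho> j)) (fst q) (snd q))"
    unfolding Rrot by (simp add: norm_mult)
  finally show ?thesis unfolding b_def \<rho>_def .
qed

section \<open>Factorisation of the rotated kernel\<close>

text \<open>
  The real part is fixed to 1 as a normalisation of the variable \<open>v\<close>. The imaginary part is written in
  terms of \<open>\<mu>\<close> such that both \<open>|\<gamma>|\<close> and the square root \<open>\<kappa>\<close> of \<open>2 i \<gamma> / cosh (2s)\<close>, the coefficient of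
  \<open>x v\<close> in the kernel below, are explicit.
\<close>

definition chirp_parameter :: "real \<Rightarrow> complex" where
  "chirp_parameter \<mu> = Complex 1 ((1 / \<mu> - \<mu>) / 2)"

text \<open>
  The exponent is \<open>\<alpha> x\<^sup>2 / 2 + \<kappa> x v - \<gamma> v\<^sup>2 / 2\<close>. In \<open>\<integral> P(x, v) P(y, v) dv\<close> the term
  \<open>\<kappa>\<^sup>2 (x + y)\<^sup>2 / (4 \<gamma>)\<close> appears; \<open>\<kappa>\<close> is chosen to make its cross term \<open>i x y / cosh (2s)\<close>, and the imaginary
  part of \<open>\<alpha>\<close> cancels its squares. The parameter \<open>\<mu>\<close> remains free.
\<close>

definition chirp_kernel :: "real \<Rightarrow> real \<Rightarrow> real \<Rightarrow> real \<Rightarrow> complex" where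
  "chirp_kernel s \<mu> x v = exp (Complex (tanh (2 * s)) (- 1 / cosh (2 * s)) * of_real (x\<^sup>2 / 2)
     + Complex (sqrt (\<mu> / cosh (2 * s))) (sqrt (1 / (\<mu> * cosh (2 * s)))) * of_real (x * v)
     - chirp_parameter \<mu> * of_real (v\<^sup>2 / 2))"

lemma chirp_kernel_measurable [measurable (raw)]:
  assumes [measurable]: "f \<in> borel_measurable M" "g \<in> borel_measurable M"
  shows "(\<lambda>z. chirp_kernel s \<mu> (f z) (g z)) \<in> borel_measurable M"
  unfolding chirp_kernel_def by measurable

lemma norm_chirp_parameter: "\<mu> > 0 \<Longrightarrow> norm (chirp_parameter \<mu>) = (1 / \<mu> + \<mu>) / 2"
proof -
  assume \<mu>: "\<mu> > 0"
  have "(1 / \<mu> - \<mu>)\<^sup>2 / 4 + 1 = ((1 / \<mu> + \<mu>) / 2)\<^sup>2"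
    using \<mu> by (simp add: power2_eq_square field_simps)
  then have "1 + ((1 / \<mu> - \<mu>) / 2)\<^sup>2 = ((1 / \<mu> + \<mu>) / 2)\<^sup>2" by (simp add: power_divide)
  then show ?thesis unfolding chirp_parameter_def cmod_def using \<mu> by simp
qed

lemma chirp_kernel_product:
  assumes \<mu>: "\<mu> > 0"
  shows "has_bochner_integral lborel (\<lambda>v. chirp_kernel s \<mu> x v * chirp_kernel s \<mu> y v)
     (csqrt (of_real pi / chirp_parameter \<mu>) * exp (of_real (tanh (2 * s) * ((x\<^sup>2 + y\<^sup>2) / 2)) + \<i> * of_real (x * y / cosh (2 * s))))"
proof -
  let ?\<gamma> = "chirp_parameter \<mu>"
  define C where "C = cosh (2 * s)"
  have C: "C > 0" unfolding C_def by (rule cosh_real_pos)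
  define p where "p = sqrt (\<mu> / C)"
  define q where "q = sqrt (1 / (\<mu> * C))"
  define \<kappa> where "\<kappa> = Complex p q"
  define \<alpha> where "\<alpha> = Complex (tanh (2 * s)) (- 1 / C)"
  have pq: "p\<^sup>2 = \<mu> / C" "q\<^sup>2 = 1 / (\<mu> * C)" "p * q = 1 / C"
  proof -
    show "p\<^sup>2 = \<mu> / C" "q\<^sup>2 = 1 / (\<mu> * C)" unfolding p_def q_def using \<mu> C by simp_all
    have "p * q = sqrt ((1 / C)\<^sup>2)"
      unfolding p_def q_def real_sqrt_mult[symmetric] using \<mu> C by (simp add: power2_eq_square)
    then show "p * q = 1 / C" using C by simp
  qed
  have re: "Re ?\<gamma> = 1" unfolding chirp_parameter_def by simp
  have nz: "?\<gamma> \<noteq> 0" using re by auto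
  have k2: "\<kappa>\<^sup>2 = 2 * \<i> * ?\<gamma> / of_real C"
  proof (rule complex_eqI)
    define d where "d = (1 / \<mu> - \<mu>) / 2"
    have \<gamma>d: "?\<gamma> = Complex 1 d" unfolding chirp_parameter_def d_def ..
    have "Re (\<kappa>\<^sup>2) = p\<^sup>2 - q\<^sup>2" unfolding \<kappa>_def by (simp add: power2_eq_square)
    also have "\<dots> = - 2 * d / C" unfolding pq d_def using \<mu> C by (simp add: field_simps)
    also have "\<dots> = Re (2 * \<i> * ?\<gamma> / of_real C)" unfolding \<gamma>d by simp
    finally show "Re (\<kappa>\<^sup>2) = Re (2 * \<i> * ?\<gamma> / of_real C)" .
    have "Im (\<kappa>\<^sup>2) = 2 * (p * q)" unfolding \<kappa>_def by (simp add: power2_eq_square)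
    also have "\<dots> = Im (2 * \<i> * ?\<gamma> / of_real C)" unfolding pq chirp_parameter_def by simp
    finally show "Im (\<kappa>\<^sup>2) = Im (2 * \<i> * ?\<gamma> / of_real C)" .
  qed
  have "has_bochner_integral lborel (\<lambda>v. exp (\<alpha> * of_real ((x\<^sup>2 + y\<^sup>2) / 2)) * exp ((\<kappa> * of_real (x + y)) * of_real v - ?\<gamma> * (of_real v)\<^sup>2))
     (exp (\<alpha> * of_real ((x\<^sup>2 + y\<^sup>2) / 2)) * (csqrt (of_real pi / ?\<gamma>) * exp ((\<kappa> * of_real (x + y))\<^sup>2 / (4 * ?\<gamma>))))"
    using re by (intro has_bochner_integral_mult_right gaussian_has_integral) simp
  moreover have "exp (\<alpha> * of_real ((x\<^sup>2 + y\<^sup>2) / 2)) * exp ((\<kappa> * of_real (x + y)) * of_real v - ?\<gamma> * (of_real v)\<^sup>2) = chirp_kernel s \<mu> x v * chirp_kernel s \<mu> y v" for v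
    unfolding chirp_kernel_def exp_add[symmetric] C_def[symmetric] p_def[symmetric] q_def[symmetric] \<kappa>_def[symmetric] \<alpha>_def[symmetric]
    by (rule arg_cong[where f = exp]) (simp add: field_simps)
  moreover have "exp (\<alpha> * of_real ((x\<^sup>2 + y\<^sup>2) / 2)) * (csqrt (of_real pi / ?\<gamma>) * exp ((\<kappa> * of_real (x + y))\<^sup>2 / (4 * ?\<gamma>)))
     = csqrt (of_real pi / ?\<gamma>) * exp (of_real (tanh (2 * s) * ((x\<^sup>2 + y\<^sup>2) / 2)) + \<i> * of_real (x * y / C))"
  proof -
    have "(\<kappa> * of_real (x + y))\<^sup>2 / (4 * ?\<gamma>) = \<i> * of_real ((x + y)\<^sup>2 / (2 * C))"
      unfolding power_mult_distrib k2 using nz C by (simp add: field_simps)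
    moreover have "\<alpha> * of_real ((x\<^sup>2 + y\<^sup>2) / 2) = of_real (tanh (2 * s) * ((x\<^sup>2 + y\<^sup>2) / 2)) - \<i> * of_real ((x\<^sup>2 + y\<^sup>2) / (2 * C))"
      unfolding \<alpha>_def by (simp add: complex_eq_iff)
    moreover have "(x + y)\<^sup>2 / (2 * C) = (x\<^sup>2 + y\<^sup>2) / (2 * C) + x * y / C"
      using C by (simp add: field_simps power2_eq_square)
    ultimately have "\<alpha> * of_real ((x\<^sup>2 + y\<^sup>2) / 2) + (\<kappa> * of_real (x + y))\<^sup>2 / (4 * ?\<gamma>) = of_real (tanh (2 * s) * ((x\<^sup>2 + y\<^sup>2) / 2)) + \<i> * of_real (x * y / C)"
      by (simp only: of_real_add distrib_left) simp
    then have "exp (\<alpha> * of_real ((x\<^sup>2 + y\<^sup>2) / 2)) * exp ((\<kappa> * of_real (x + y))\<^sup>2 / (4 * ?\<gamma>)) = exp (of_real (tanh (2 * s) * ((x\<^sup>2 + y\<^sup>2) / 2)) + \<i> * of_real (x * y / C))"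
      by (simp only: exp_add[symmetric])
    then show ?thesis by (simp only: mult.left_commute)
  qed
  ultimately show ?thesis unfolding C_def by (simp only:)
qed

lemma rotated_mehler_kernel_chirp:
  assumes \<mu>: "\<mu> > 0"
  shows "rotated_mehler_kernel (of_real (exp (2 * s))) x y =
     inverse (csqrt (of_real pi * (1 + (of_real (exp (2 * s)))\<^sup>2)) * csqrt (of_real pi / chirp_parameter \<mu>))
       * (LINT v|lborel. chirp_kernel s \<mu> x v * chirp_kernel s \<mu> y v)"
proof -
  have "Re (chirp_parameter \<mu>) = 1" unfolding chirp_parameter_def by simp
  then have nz: "csqrt (of_real pi / chirp_parameter \<mu>) \<noteq> 0" by auto
  have t: "((of_real (exp (2 * s)))\<^sup>2 - 1) / (1 + (of_real (exp (2 * s)))\<^sup>2) = complex_of_real (tanh (2 * s))"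
    unfolding tanh_double by simp
  have "2 * exp (2 * s) / (1 + (exp (2 * s))\<^sup>2) = 1 / cosh (2 * s)"
  proof -
    have c: "cosh (2 * s) = (exp (2 * s) + 1 / exp (2 * s)) / 2" unfolding cosh_field_def exp_minus by (simp add: inverse_eq_divide)
    have g: "2 * E / (1 + E\<^sup>2) = 1 / ((E + 1 / E) / 2)" if "E > 0" for E :: real
      using that by (simp add: field_simps power2_eq_square)
    show ?thesis unfolding c by (rule g) simp
  qed
  moreover have "2 * \<i> * complex_of_real E / (1 + (of_real E)\<^sup>2) = \<i> * of_real (2 * E / (1 + E\<^sup>2))" for E by simp
  ultimately have v: "2 * \<i> * of_real (exp (2 * s)) / (1 + (of_real (exp (2 * s)))\<^sup>2) = \<i> * of_real (1 / cosh (2 * s))"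
    by (simp only:)
  have e: "complex_of_real (tanh (2 * s)) * of_real ((x\<^sup>2 + y\<^sup>2) / 2) + \<i> * of_real (1 / cosh (2 * s)) * of_real (x * y)
      = of_real (tanh (2 * s) * ((x\<^sup>2 + y\<^sup>2) / 2)) + \<i> * of_real (x * y / cosh (2 * s))" by simp
  have I: "(LINT v|lborel. chirp_kernel s \<mu> x v * chirp_kernel s \<mu> y v) =
     csqrt (of_real pi / chirp_parameter \<mu>) * exp (of_real (tanh (2 * s) * ((x\<^sup>2 + y\<^sup>2) / 2)) + \<i> * of_real (x * y / cosh (2 * s)))"
    using chirp_kernel_product[OF \<mu>, of s x y] by (simp add: has_bochner_integral_iff)
  have "e / a = inverse (a * b) * (b * e)" if "b \<noteq> 0" for a b e :: complex
    using that by (simp add: divide_inverse)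
  from this[OF nz] show ?thesis unfolding rotated_mehler_kernel_def t v e I .
qed

lemma chirp_kernel_norm_product:
  assumes \<mu>: "\<mu> > 0"
  shows "has_bochner_integral lborel (\<lambda>v. norm (chirp_kernel s \<mu> x v) * norm (chirp_kernel s \<mu> y v))
     (sqrt pi * exp (tanh (2 * s) * (x\<^sup>2 + y\<^sup>2) / 2 + \<mu> / cosh (2 * s) * (x + y)\<^sup>2 / 4))"
proof -
  define p where "p = sqrt (\<mu> / cosh (2 * s))"
  have p2: "p\<^sup>2 = \<mu> / cosh (2 * s)" unfolding p_def using \<mu> cosh_real_pos[of "2 * s"] by simp
  have n: "norm (chirp_kernel s \<mu> x v) = exp (tanh (2 * s) * (x\<^sup>2 / 2) + p * (x * v) - v\<^sup>2 / 2)" for x v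
    unfolding chirp_kernel_def norm_exp_eq_Re p_def chirp_parameter_def by simp
  have "has_bochner_integral lborel (\<lambda>v. exp (tanh (2 * s) * (x\<^sup>2 + y\<^sup>2) / 2) * exp ((p * (x + y)) * v - 1 * v\<^sup>2))
     (exp (tanh (2 * s) * (x\<^sup>2 + y\<^sup>2) / 2) * (sqrt (pi / 1) * exp ((p * (x + y))\<^sup>2 / (4 * 1))))"
    by (intro has_bochner_integral_mult_right gaussian_real_has_integral) simp
  moreover have "exp (tanh (2 * s) * (x\<^sup>2 + y\<^sup>2) / 2) * exp ((p * (x + y)) * v - 1 * v\<^sup>2) = norm (chirp_kernel s \<mu> x v) * norm (chirp_kernel s \<mu> y v)" for v
    unfolding n exp_add[symmetric] by (rule arg_cong[where f = exp]) (simp add: field_simps)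
  moreover have "exp (tanh (2 * s) * (x\<^sup>2 + y\<^sup>2) / 2) * (sqrt (pi / 1) * exp ((p * (x + y))\<^sup>2 / (4 * 1)))
     = sqrt pi * exp (tanh (2 * s) * (x\<^sup>2 + y\<^sup>2) / 2 + \<mu> / cosh (2 * s) * (x + y)\<^sup>2 / 4)"
    unfolding exp_add power_mult_distrib p2 by simp
  ultimately show ?thesis by (simp only:)
qed

text \<open>
  Conjugating one factor leaves a Gaussian in \<open>v\<close> of parameter 1, and the modulus of its integral has the exponent
  \<open>(tanh (2s) + p\<^sup>2) x y + (tanh (2s) - (q\<^sup>2 - p\<^sup>2) / 2) (x - y)\<^sup>2 / 2\<close>, where \<open>\<kappa> = p + i q\<close>. The hypothesis
  makes the second coefficient nonpositive, so only the product \<open>x y\<close> survives. This is the step that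
  replaces the isotropic growth of the rotated kernel by \<open>exp (b x y)\<close>.
\<close>

lemma chirp_kernel_hermitian_product:
  assumes \<mu>: "\<mu> > 0" and le: "exp (2 * s) * \<mu> \<le> 1"
  shows "norm (LINT v|lborel. chirp_kernel s \<mu> x v * cnj (chirp_kernel s \<mu> y v))
     \<le> sqrt pi * exp ((tanh (2 * s) + \<mu> / cosh (2 * s)) * (x * y))"
proof -
  define C where "C = cosh (2 * s)"
  have C: "C > 0" unfolding C_def by (rule cosh_real_pos)
  define p where "p = sqrt (\<mu> / C)"
  define q where "q = sqrt (1 / (\<mu> * C))"
  have pq: "p\<^sup>2 = \<mu> / C" "q\<^sup>2 = 1 / (\<mu> * C)" unfolding p_def q_def using \<mu> C by simp_all
  define \<kappa> where "\<kappa> = Complex p q"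
  define \<alpha> where "\<alpha> = Complex (tanh (2 * s)) (- 1 / C)"
  have "chirp_kernel s \<mu> x v * cnj (chirp_kernel s \<mu> y v) =
     exp (\<alpha> * of_real (x\<^sup>2 / 2) + cnj \<alpha> * of_real (y\<^sup>2 / 2)) * exp ((\<kappa> * of_real x + cnj \<kappa> * of_real y) * of_real v - 1 * (of_real v)\<^sup>2)" for v
  proof -
    have c: "cnj (chirp_parameter \<mu>) = 2 - chirp_parameter \<mu>" unfolding chirp_parameter_def by (simp add: complex_eq_iff)
    show ?thesis
      unfolding chirp_kernel_def exp_cnj exp_add[symmetric] C_def[symmetric] p_def[symmetric] q_def[symmetric] \<kappa>_def[symmetric] \<alpha>_def[symmetric]
      by (rule arg_cong[where f = exp]) (simp add: c field_simps)
  qed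
  then have "(LINT v|lborel. chirp_kernel s \<mu> x v * cnj (chirp_kernel s \<mu> y v)) =
     exp (\<alpha> * of_real (x\<^sup>2 / 2) + cnj \<alpha> * of_real (y\<^sup>2 / 2)) * (csqrt (of_real pi / 1) * exp ((\<kappa> * of_real x + cnj \<kappa> * of_real y)\<^sup>2 / (4 * 1)))"
    using gaussian_has_integral[of 1 "\<kappa> * of_real x + cnj \<kappa> * of_real y"] by (simp add: has_bochner_integral_iff)
  also have "norm \<dots> = sqrt pi * exp (tanh (2 * s) * (x\<^sup>2 + y\<^sup>2) / 2 + (p\<^sup>2 * (x + y)\<^sup>2 - q\<^sup>2 * (x - y)\<^sup>2) / 4)"
  proof -
    have r1: "Re (\<alpha> * of_real (x\<^sup>2 / 2) + cnj \<alpha> * of_real (y\<^sup>2 / 2)) = tanh (2 * s) * (x\<^sup>2 + y\<^sup>2) / 2"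
      unfolding \<alpha>_def by (simp add: field_simps)
    have k: "\<kappa> * of_real x + cnj \<kappa> * of_real y = Complex (p * (x + y)) (q * (x - y))"
      unfolding \<kappa>_def by (simp add: complex_eq_iff algebra_simps)
    have r2: "Re ((\<kappa> * of_real x + cnj \<kappa> * of_real y)\<^sup>2 / (4 * 1)) = (p\<^sup>2 * (x + y)\<^sup>2 - q\<^sup>2 * (x - y)\<^sup>2) / 4"
      unfolding k by (simp add: power2_eq_square algebra_simps)
    show ?thesis unfolding norm_mult norm_exp_eq_Re r1 r2 by (simp add: norm_csqrt exp_add)
  qed
  also have "\<dots> \<le> sqrt pi * exp ((tanh (2 * s) + \<mu> / C) * (x * y))"
  proof -
    have "tanh (2 * s) * (x\<^sup>2 + y\<^sup>2) / 2 + (p\<^sup>2 * (x + y)\<^sup>2 - q\<^sup>2 * (x - y)\<^sup>2) / 4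
      = (tanh (2 * s) + p\<^sup>2) * (x * y) + (tanh (2 * s) - (q\<^sup>2 - p\<^sup>2) / 2) * (x - y)\<^sup>2 / 2"
      by (simp add: power2_eq_square field_simps)
    moreover have "tanh (2 * s) - (q\<^sup>2 - p\<^sup>2) / 2 \<le> 0"
    proof -
      have E: "exp (2 * s) \<le> 1 / \<mu>" using le \<mu> by (simp add: field_simps)
      moreover have "\<mu> \<le> exp (- (2 * s))" using le by (simp add: exp_minus field_simps)
      ultimately have "sinh (2 * s) \<le> (1 / \<mu> - \<mu>) / 2" unfolding sinh_field_def by simp
      then have 1: "sinh (2 * s) / C \<le> (1 / \<mu> - \<mu>) / 2 / C" using C by (intro divide_right_mono) auto
      have 2: "(q\<^sup>2 - p\<^sup>2) / 2 = (1 / \<mu> - \<mu>) / 2 / C" unfolding pq using \<mu> C by (simp add: field_simps)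
      have 3: "tanh (2 * s) = sinh (2 * s) / C" unfolding tanh_def C_def ..
      show ?thesis unfolding 2 3 using 1 by linarith
    qed
    then have "(tanh (2 * s) - (q\<^sup>2 - p\<^sup>2) / 2) * (x - y)\<^sup>2 / 2 \<le> 0" by (simp add: mult_nonpos_nonneg)
    ultimately show ?thesis unfolding pq(1)[symmetric] by (intro mult_left_mono) auto
  qed
  finally show ?thesis unfolding C_def .
qed

section \<open>Bound for the rotated form\<close>

text \<open>
  If \<open>f\<close> is not integrable, its integral is 0 by convention and the bound persists.
\<close>

lemma norm_integral_le_integral:
  fixes f :: "'a \<Rightarrow> complex"
  assumes g: "integrable M g" and le: "\<And>x. norm (f x) \<le> g x"
  shows "norm (LINT x|M. f x) \<le> (LINT x|M. g x)"
proof (cases "integrable M f")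
  case True
  have "norm (LINT x|M. f x) \<le> (LINT x|M. norm (f x))" by (rule Bochner_Integration.integral_norm_bound)
  also have "\<dots> \<le> (LINT x|M. g x)" using True g le by (intro Bochner_Integration.integral_mono) auto
  finally show ?thesis .
next
  case False
  have "0 \<le> g x" for x using order_trans[OF norm_ge_zero le] .
  then show ?thesis using False by (simp add: not_integrable_integral_eq)
qed

text \<open>
  The \<open>L\<^sup>2\<close> norm of the transform of \<open>u\<close> by the kernel \<open>P\<close> is a form in \<open>u\<close> whose kernel is the Gram matrix
  of \<open>P\<close>.
\<close>

lemma hermitian_square_integral:
  fixes u :: "real ^ 'n::finite \<Rightarrow> complex" and P :: "real ^ 'n \<Rightarrow> real ^ 'n \<Rightarrow> complex" and g :: "real ^ 'n \<Rightarrow> real"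
  assumes u [measurable]: "u \<in> borel_measurable borel"
    and P [measurable]: "(\<lambda>p. P (fst p) (snd p)) \<in> borel_measurable (borel \<Otimes>\<^sub>M borel)"
    and ug: "integrable lborel (\<lambda>x. norm (u x) * g x)"
    and PP: "\<And>x x'. integrable lborel (\<lambda>v. norm (P x v) * norm (P x' v))"
    and bd: "\<And>x x'. (LINT v|lborel. norm (P x v) * norm (P x' v)) \<le> C * (g x * g x')"
    and h: "\<And>x x'. norm (LINT v|lborel. P x v * cnj (P x' v)) \<le> h x x'"
    and hi: "integrable (lborel \<Otimes>\<^sub>M lborel) (\<lambda>q. norm (u (fst q)) * norm (u (snd q)) * h (fst q) (snd q))"
  shows "integrable lborel (\<lambda>v. (norm (LINT x|lborel. u x * P x v))\<^sup>2)"
    and "(LINT v|lborel. (norm (LINT x|lborel. u x * P x v))\<^sup>2) \<le>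
      (LINT q|(lborel \<Otimes>\<^sub>M lborel). norm (u (fst q)) * norm (u (snd q)) * h (fst q) (snd q))"
proof -
  let ?S = "\<lambda>v. LINT x|lborel. u x * P x v"
  have Pm: "P x \<in> borel_measurable borel" for x
    using measurable_compose[OF measurable_Pair1' P, of x] by simp
  have m1: "(\<lambda>x. cnj (u x)) \<in> borel_measurable borel" "(\<lambda>p. cnj (P (fst p) (snd p))) \<in> borel_measurable (borel \<Otimes>\<^sub>M borel)"
    by measurable
  have i1: "integrable lborel (\<lambda>v. P x v * cnj (P x' v))" for x x'
  proof (rule Bochner_Integration.integrable_bound[OF PP[of x x']])
    have [measurable]: "P x \<in> borel_measurable borel" "P x' \<in> borel_measurable borel" by (rule Pm)+
    show "(\<lambda>v. P x v * cnj (P x' v)) \<in> borel_measurable lborel" by measurable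
  qed (simp add: norm_mult)
  have cS: "(LINT x|lborel. cnj (u x) * cnj (P x v)) = cnj (?S v)" for v
    by (subst Bochner_Integration.integral_cnj[symmetric]) simp
  have sq: "?S v * cnj (?S v) = of_real ((norm (?S v))\<^sup>2)" for v unfolding complex_norm_square ..
  have bd': "(LINT v|lborel. norm (P x v * cnj (P x' v))) \<le> C * (g x * g x')" for x x'
    using bd[of x x'] by (simp add: norm_mult)
  have ug': "integrable lborel (\<lambda>x. norm (cnj (u x)) * g x)" using ug by simp
  note T = integral_of_product_of_transforms[OF u m1(1) P m1(2) ug ug' i1 bd', unfolded cS sq]
  show i: "integrable lborel (\<lambda>v. (norm (?S v))\<^sup>2)" using integrable_Re[OF T(1)] by simp
  have nn: "0 \<le> (LINT v|lborel. (norm (?S v))\<^sup>2)" by (intro Bochner_Integration.integral_nonneg) simp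
  have "(LINT v|lborel. (norm (?S v))\<^sup>2) = norm (complex_of_real (LINT v|lborel. (norm (?S v))\<^sup>2))" using nn by simp
  also have "complex_of_real (LINT v|lborel. (norm (?S v))\<^sup>2) = (LINT v|lborel. complex_of_real ((norm (?S v))\<^sup>2))"
    by (rule integral_complex_of_real[symmetric])
  also have "\<dots> = (LINT q|(lborel \<Otimes>\<^sub>M lborel). u (fst q) * cnj (u (snd q)) * (LINT v|lborel. P (fst q) v * cnj (P (snd q) v)))"
    by (rule T(2))
  also have "norm \<dots> \<le> (LINT q|(lborel \<Otimes>\<^sub>M lborel). norm (u (fst q)) * norm (u (snd q)) * h (fst q) (snd q))"
  proof (rule norm_integral_le_integral)
    fix q :: "(real ^ 'n) \<times> (real ^ 'n)"
    show "norm (u (fst q) * cnj (u (snd q)) * (LINT v|lborel. P (fst q) v * cnj (P (snd q) v))) \<le> norm (u (fst q)) * norm (u (snd q)) * h (fst q) (snd q)"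
      unfolding norm_mult complex_mod_cnj by (intro mult_left_mono h) simp
  qed (rule hi)
  finally show "(LINT v|lborel. (norm (?S v))\<^sup>2) \<le> (LINT q|(lborel \<Otimes>\<^sub>M lborel). norm (u (fst q)) * norm (u (snd q)) * h (fst q) (snd q))" .
qed

text \<open>
  The product of the chirp kernels factors the rotated kernel, so the form is \<open>\<integral> S\<^sub>1 S\<^sub>2\<close>, where \<open>S\<^sub>1\<close> and
  \<open>S\<^sub>2\<close> are the transforms of \<open>f\<close> and \<open>cnj f\<close>. The modulus is at most
  \<open>(\<integral> |S\<^sub>1|\<^sup>2 + \<integral> |S\<^sub>2|\<^sup>2) / 2\<close>, and both terms have the same bound. The common value \<open>a\<close> of
  \<open>tanh (2s\<^sub>j) + \<mu>\<^sub>j / cosh (2s\<^sub>j)\<close> lets the coordinates combine to \<open>x \<bullet> y\<close>.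
\<close>

theorem rotated_form_bound:
  fixes f :: "real ^ 'n::finite \<Rightarrow> complex" and s \<mu> :: "'n \<Rightarrow> real"
  assumes f [measurable]: "f \<in> borel_measurable borel"
    and wg: "integrable lborel (\<lambda>x. norm (f x) * exp (a / 2 * (x \<bullet> x)))"
    and \<mu>: "\<And>j. \<mu> j > 0" "\<And>j. exp (2 * s j) * \<mu> j \<le> 1" and a: "a > 0" "\<And>j. tanh (2 * s j) + \<mu> j / cosh (2 * s j) = a"
  shows "integrable (lborel \<Otimes>\<^sub>M lborel) (\<lambda>q. norm (f (fst q)) * norm (f (snd q)) * exp (a * (fst q \<bullet> snd q)))"
    and "norm (LINT q|(lborel \<Otimes>\<^sub>M lborel). f (fst q) * cnj (f (snd q)) * rotated_mehler_vec (\<lambda>j. of_real (exp (2 * s j))) (fst q) (snd q))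
     \<le> (\<Prod>j\<in>UNIV. sqrt (norm (chirp_parameter (\<mu> j)) / (pi * (1 + (exp (2 * s j))\<^sup>2))))
        * (LINT q|(lborel \<Otimes>\<^sub>M lborel). norm (f (fst q)) * norm (f (snd q)) * exp (a * (fst q \<bullet> snd q)))"
proof -
  let ?n = "CARD('n)"
  let ?Q = "lborel \<Otimes>\<^sub>M lborel :: ((real ^ 'n) \<times> (real ^ 'n)) measure"
  define P where "P x v = (\<Prod>j\<in>UNIV. chirp_kernel (s j) (\<mu> j) (x $ j) (v $ j))" for x v :: "real ^ 'n"
  define g where "g x = exp (a / 2 * (x \<bullet> x))" for x :: "real ^ 'n"
  have P [measurable]: "(\<lambda>p. P (fst p) (snd p)) \<in> borel_measurable (borel \<Otimes>\<^sub>M borel)" unfolding P_def by measurable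
  have ex: "(\<Prod>j\<in>UNIV. exp (a * (x $ j * y $ j))) = exp (a * (x \<bullet> y))" for x y :: "real ^ 'n"
    unfolding exp_sum[OF finite, symmetric] by (simp add: inner_vec_def sum_distrib_left)
  have PP: "has_bochner_integral lborel (\<lambda>v. P x v * P y v) (\<Prod>j\<in>UNIV. (LINT v|lborel. chirp_kernel (s j) (\<mu> j) (x $ j) v * chirp_kernel (s j) (\<mu> j) (y $ j) v))" for x y
  proof -
    have "has_bochner_integral lborel (\<lambda>v::real^'n. \<Prod>j\<in>UNIV. chirp_kernel (s j) (\<mu> j) (x $ j) (v $ j) * chirp_kernel (s j) (\<mu> j) (y $ j) (v $ j))
      (\<Prod>j\<in>UNIV. (LINT v|lborel. chirp_kernel (s j) (\<mu> j) (x $ j) v * chirp_kernel (s j) (\<mu> j) (y $ j) v))"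
      using chirp_kernel_product[OF \<mu>(1)] by (intro lborel_vec_prod_integral) (auto simp: has_bochner_integral_iff)
    then show ?thesis unfolding P_def prod.distrib by simp
  qed
  have nPP: "has_bochner_integral lborel (\<lambda>v. norm (P x v) * norm (P y v)) (\<Prod>j\<in>UNIV. (LINT v|lborel. norm (chirp_kernel (s j) (\<mu> j) (x $ j) v) * norm (chirp_kernel (s j) (\<mu> j) (y $ j) v)))" for x y
  proof -
    have "has_bochner_integral lborel (\<lambda>v::real^'n. \<Prod>j\<in>UNIV. norm (chirp_kernel (s j) (\<mu> j) (x $ j) (v $ j)) * norm (chirp_kernel (s j) (\<mu> j) (y $ j) (v $ j)))
      (\<Prod>j\<in>UNIV. (LINT v|lborel. norm (chirp_kernel (s j) (\<mu> j) (x $ j) v) * norm (chirp_kernel (s j) (\<mu> j) (y $ j) v)))"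
      using chirp_kernel_norm_product[OF \<mu>(1)] by (intro lborel_vec_prod_integral) (auto simp: has_bochner_integral_iff)
    then show ?thesis unfolding P_def prod.distrib prod_norm .
  qed
  have nPPbd: "(LINT v|lborel. norm (P x v) * norm (P y v)) \<le> sqrt pi ^ ?n * (g x * g y)" for x y
  proof -
    have "(LINT v|lborel. norm (P x v) * norm (P y v)) = (\<Prod>j\<in>UNIV. (LINT v|lborel. norm (chirp_kernel (s j) (\<mu> j) (x $ j) v) * norm (chirp_kernel (s j) (\<mu> j) (y $ j) v)))"
      using nPP[of x y] by (simp add: has_bochner_integral_iff)
    also have "\<dots> \<le> (\<Prod>j\<in>UNIV. sqrt pi * (exp (a / 2 * (x $ j * x $ j)) * exp (a / 2 * (y $ j * y $ j))))"
    proof (intro prod_mono conjI)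
      fix j
      show "0 \<le> (LINT v|lborel. norm (chirp_kernel (s j) (\<mu> j) (x $ j) v) * norm (chirp_kernel (s j) (\<mu> j) (y $ j) v))"
        by (intro Bochner_Integration.integral_nonneg) simp
      let ?x = "x $ j" and ?y = "y $ j"
      have m: "0 \<le> \<mu> j / cosh (2 * s j)" using \<mu>(1)[of j] by (simp add: less_imp_le)
      have "(?x + ?y)\<^sup>2 \<le> 2 * (?x\<^sup>2 + ?y\<^sup>2)" using sum_squares_bound[of ?x ?y] by (simp add: power2_sum)
      then have "\<mu> j / cosh (2 * s j) * (?x + ?y)\<^sup>2 \<le> \<mu> j / cosh (2 * s j) * (2 * (?x\<^sup>2 + ?y\<^sup>2))" by (rule mult_left_mono[OF _ m])
      moreover have "t * X / 2 + m * W / 4 \<le> (t + m) * X / 2" if "m * W \<le> m * (2 * X)" for t m X W :: real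
        using that distrib_right[of t m X] by linarith
      ultimately have "tanh (2 * s j) * (?x\<^sup>2 + ?y\<^sup>2) / 2 + \<mu> j / cosh (2 * s j) * (?x + ?y)\<^sup>2 / 4 \<le> (tanh (2 * s j) + \<mu> j / cosh (2 * s j)) * (?x\<^sup>2 + ?y\<^sup>2) / 2"
        by blast
      also have "\<dots> = a / 2 * (?x * ?x) + a / 2 * (?y * ?y)" unfolding a(2) by (simp add: power2_eq_square algebra_simps add_divide_distrib)
      finally have "sqrt pi * exp (tanh (2 * s j) * (?x\<^sup>2 + ?y\<^sup>2) / 2 + \<mu> j / cosh (2 * s j) * (?x + ?y)\<^sup>2 / 4) \<le> sqrt pi * (exp (a / 2 * (?x * ?x)) * exp (a / 2 * (?y * ?y)))"
        unfolding exp_add[symmetric] by (intro mult_left_mono) auto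
      then show "(LINT v|lborel. norm (chirp_kernel (s j) (\<mu> j) ?x v) * norm (chirp_kernel (s j) (\<mu> j) ?y v)) \<le> sqrt pi * (exp (a / 2 * (?x * ?x)) * exp (a / 2 * (?y * ?y)))"
        using chirp_kernel_norm_product[OF \<mu>(1)[of j], of "s j" ?x ?y] by (simp only: has_bochner_integral_iff)
    qed
    also have "\<dots> = sqrt pi ^ ?n * (g x * g y)"
      unfolding g_def prod.distrib exp_sum[OF finite, symmetric] by (simp add: inner_vec_def sum_distrib_left)
    finally show ?thesis .
  qed
  have hPP: "norm (LINT v|lborel. P x v * cnj (P y v)) \<le> sqrt pi ^ ?n * exp (a * (x \<bullet> y))" for x y
  proof -
    have i: "integrable lborel (\<lambda>v. chirp_kernel (s j) (\<mu> j) (x $ j) v * cnj (chirp_kernel (s j) (\<mu> j) (y $ j) v))" for j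
    proof (rule Bochner_Integration.integrable_bound)
      show "integrable lborel (\<lambda>v. norm (chirp_kernel (s j) (\<mu> j) (x $ j) v) * norm (chirp_kernel (s j) (\<mu> j) (y $ j) v))"
        using chirp_kernel_norm_product[OF \<mu>(1)] by (simp only: has_bochner_integral_iff)
    qed (measurable, simp add: norm_mult)
    have "has_bochner_integral lborel (\<lambda>v::real^'n. \<Prod>j\<in>UNIV. chirp_kernel (s j) (\<mu> j) (x $ j) (v $ j) * cnj (chirp_kernel (s j) (\<mu> j) (y $ j) (v $ j)))
      (\<Prod>j\<in>UNIV. (LINT v|lborel. chirp_kernel (s j) (\<mu> j) (x $ j) v * cnj (chirp_kernel (s j) (\<mu> j) (y $ j) v)))"
      by (rule lborel_vec_prod_integral[OF i])
    then have "(LINT v|lborel. P x v * cnj (P y v)) = (\<Prod>j\<in>UNIV. (LINT v|lborel. chirp_kernel (s j) (\<mu> j) (x $ j) v * cnj (chirp_kernel (s j) (\<mu> j) (y $ j) v)))"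
      unfolding P_def prod.distrib cnj_prod by (simp only: has_bochner_integral_iff)
    also have "norm \<dots> = (\<Prod>j\<in>UNIV. norm (LINT v|lborel. chirp_kernel (s j) (\<mu> j) (x $ j) v * cnj (chirp_kernel (s j) (\<mu> j) (y $ j) v)))"
      by (rule prod_norm[symmetric])
    also have "\<dots> \<le> (\<Prod>j\<in>UNIV. sqrt pi * exp (a * (x $ j * y $ j)))"
      by (intro prod_mono conjI norm_ge_zero) (rule chirp_kernel_hermitian_product[OF \<mu>, unfolded a(2)])
    also have "\<dots> = sqrt pi ^ ?n * exp (a * (x \<bullet> y))" unfolding prod.distrib ex by simp
    finally show ?thesis .
  qed
  have fg: "integrable lborel (\<lambda>x. norm (f x) * g x)" unfolding g_def by (rule wg)
  show Li: "integrable ?Q (\<lambda>q. norm (f (fst q)) * norm (f (snd q)) * exp (a * (fst q \<bullet> snd q)))"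
  proof (rule Bochner_Integration.integrable_bound[OF integrable_prod_lborel[OF fg fg]])
    show "AE q in ?Q. norm (norm (f (fst q)) * norm (f (snd q)) * exp (a * (fst q \<bullet> snd q))) \<le> norm ((norm (f (fst q)) * g (fst q)) * (norm (f (snd q)) * g (snd q)))"
    proof (rule AE_I2)
      fix q :: "(real ^ 'n) \<times> (real ^ 'n)"
      have "0 \<le> (fst q - snd q) \<bullet> (fst q - snd q)" by simp
      then have "2 * (fst q \<bullet> snd q) \<le> fst q \<bullet> fst q + snd q \<bullet> snd q"
        by (simp add: inner_diff_left inner_diff_right inner_commute)
      then have "a / 2 * (2 * (fst q \<bullet> snd q)) \<le> a / 2 * (fst q \<bullet> fst q + snd q \<bullet> snd q)" using a(1) by (intro mult_left_mono) auto
      then have "exp (a * (fst q \<bullet> snd q)) \<le> g (fst q) * g (snd q)" unfolding g_def exp_add[symmetric] by (simp add: distrib_left)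
      then have "norm (f (fst q)) * norm (f (snd q)) * exp (a * (fst q \<bullet> snd q)) \<le> norm (f (fst q)) * norm (f (snd q)) * (g (fst q) * g (snd q))"
        by (intro mult_left_mono) auto
      then show "norm (norm (f (fst q)) * norm (f (snd q)) * exp (a * (fst q \<bullet> snd q))) \<le> norm ((norm (f (fst q)) * g (fst q)) * (norm (f (snd q)) * g (snd q)))"
        unfolding g_def by (simp add: abs_mult mult_ac)
    qed
  qed measurable
  define L where "L = (LINT q|?Q. norm (f (fst q)) * norm (f (snd q)) * exp (a * (fst q \<bullet> snd q)))"
  define S1 where "S1 v = (LINT x|lborel. f x * P x v)" for v
  define S2 where "S2 v = (LINT x|lborel. cnj (f x) * P x v)" for v
  have hi: "integrable ?Q (\<lambda>q. norm (u (fst q)) * norm (u (snd q)) * (sqrt pi ^ ?n * exp (a * (fst q \<bullet> snd q))))"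
    "(LINT q|?Q. norm (u (fst q)) * norm (u (snd q)) * (sqrt pi ^ ?n * exp (a * (fst q \<bullet> snd q)))) = sqrt pi ^ ?n * L"
    if "\<And>x. norm (u x) = norm (f x)" for u :: "real ^ 'n \<Rightarrow> complex"
  proof -
    have e: "norm (u (fst q)) * norm (u (snd q)) * (sqrt pi ^ ?n * exp (a * (fst q \<bullet> snd q))) = sqrt pi ^ ?n * (norm (f (fst q)) * norm (f (snd q)) * exp (a * (fst q \<bullet> snd q)))" for q
      unfolding that by simp
    show "integrable ?Q (\<lambda>q. norm (u (fst q)) * norm (u (snd q)) * (sqrt pi ^ ?n * exp (a * (fst q \<bullet> snd q))))"
      unfolding e by (intro integrable_mult_right Li)
    show "(LINT q|?Q. norm (u (fst q)) * norm (u (snd q)) * (sqrt pi ^ ?n * exp (a * (fst q \<bullet> snd q)))) = sqrt pi ^ ?n * L"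
      unfolding e L_def by (rule integral_mult_right_zero)
  qed
  have nPi: "integrable lborel (\<lambda>v. norm (P x v) * norm (P x' v))" for x x' using nPP by (simp only: has_bochner_integral_iff)
  have cf: "(\<lambda>x. cnj (f x)) \<in> borel_measurable borel" by measurable
  have cfg: "integrable lborel (\<lambda>x. norm (cnj (f x)) * g x)" using fg by simp
  have cn: "norm (cnj (f x)) = norm (f x)" for x by simp
  note h1 = hi[of f, OF refl]
  note h2 = hi[of "\<lambda>x. cnj (f x)", OF cn]
  note S1b = hermitian_square_integral[OF f P fg nPi nPPbd hPP h1(1), unfolded h1(2), folded S1_def]
  note S2b = hermitian_square_integral[OF cf P cfg nPi nPPbd hPP h2(1), unfolded h2(2), folded S2_def]
  have PPi: "integrable lborel (\<lambda>v. P x v * P x' v)" for x x' using PP by (simp only: has_bochner_integral_iff)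
  have PPn: "(LINT v|lborel. norm (P x v * P x' v)) \<le> sqrt pi ^ ?n * (g x * g x')" for x x' using nPPbd[of x x'] by (simp add: norm_mult)
  note T = integral_of_product_of_transforms[OF f cf P P fg cfg PPi PPn, folded S1_def S2_def]
  define c where "c j = inverse (csqrt (of_real pi * (1 + (of_real (exp (2 * s j)))\<^sup>2)) * csqrt (of_real pi / chirp_parameter (\<mu> j)))" for j
  define Cst where "Cst = (\<Prod>j\<in>UNIV. c j)"
  have rot: "rotated_mehler_vec (\<lambda>j. of_real (exp (2 * s j))) x y = Cst * (LINT v|lborel. P x v * P y v)" for x y
  proof -
    have "(LINT v|lborel. P x v * P y v) = (\<Prod>j\<in>UNIV. (LINT v|lborel. chirp_kernel (s j) (\<mu> j) (x $ j) v * chirp_kernel (s j) (\<mu> j) (y $ j) v))"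
      using PP[of x y] by (simp only: has_bochner_integral_iff)
    moreover have "rotated_mehler_kernel (of_real (exp (2 * s j))) (x $ j) (y $ j) = c j * (LINT v|lborel. chirp_kernel (s j) (\<mu> j) (x $ j) v * chirp_kernel (s j) (\<mu> j) (y $ j) v)" for j
      unfolding c_def by (rule rotated_mehler_kernel_chirp[OF \<mu>(1)])
    ultimately show ?thesis unfolding rotated_mehler_vec_def Cst_def by (simp only: prod.distrib)
  qed
  have "(LINT q|?Q. f (fst q) * cnj (f (snd q)) * rotated_mehler_vec (\<lambda>j. of_real (exp (2 * s j))) (fst q) (snd q))
     = (LINT q|?Q. Cst * (f (fst q) * cnj (f (snd q)) * (LINT v|lborel. P (fst q) v * P (snd q) v)))"
    unfolding rot by (simp only: mult_ac)
  also have "\<dots> = Cst * (LINT q|?Q. f (fst q) * cnj (f (snd q)) * (LINT v|lborel. P (fst q) v * P (snd q) v))" by (rule integral_mult_right_zero)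
  also have "\<dots> = Cst * (LINT v|lborel. S1 v * S2 v)" unfolding T(2) ..
  finally have form: "(LINT q|?Q. f (fst q) * cnj (f (snd q)) * rotated_mehler_vec (\<lambda>j. of_real (exp (2 * s j))) (fst q) (snd q)) = Cst * (LINT v|lborel. S1 v * S2 v)" .
  have "norm (LINT v|lborel. S1 v * S2 v) \<le> (LINT v|lborel. ((norm (S1 v))\<^sup>2 + (norm (S2 v))\<^sup>2) / 2)"
  proof (rule norm_integral_le_integral)
    show "integrable lborel (\<lambda>v. ((norm (S1 v))\<^sup>2 + (norm (S2 v))\<^sup>2) / 2)" using S1b(1) S2b(1) by simp
    show "norm (S1 v * S2 v) \<le> ((norm (S1 v))\<^sup>2 + (norm (S2 v))\<^sup>2) / 2" for v
      using sum_squares_bound[of "norm (S1 v)" "norm (S2 v)"] by (simp add: norm_mult)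
  qed
  also have "\<dots> = ((LINT v|lborel. (norm (S1 v))\<^sup>2) + (LINT v|lborel. (norm (S2 v))\<^sup>2)) / 2" using S1b(1) S2b(1) by simp
  also have "\<dots> \<le> sqrt pi ^ ?n * L" using S1b(2) S2b(2) by simp
  finally have b: "norm (LINT v|lborel. S1 v * S2 v) \<le> sqrt pi ^ ?n * L" .
  have "norm (LINT q|?Q. f (fst q) * cnj (f (snd q)) * rotated_mehler_vec (\<lambda>j. of_real (exp (2 * s j))) (fst q) (snd q)) \<le> norm Cst * (sqrt pi ^ ?n * L)"
    unfolding form norm_mult by (intro mult_left_mono b) simp
  also have "\<dots> = (norm Cst * sqrt pi ^ ?n) * L" by simp
  also have "norm Cst * sqrt pi ^ ?n = (\<Prod>j\<in>UNIV. sqrt (norm (chirp_parameter (\<mu> j)) / (pi * (1 + (exp (2 * s j))\<^sup>2))))"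
  proof -
    have "norm Cst * sqrt pi ^ ?n = (\<Prod>j\<in>(UNIV::'n set). norm (c j) * sqrt pi)"
      unfolding Cst_def prod_norm[symmetric] prod.distrib by simp
    also have "\<dots> = (\<Prod>j\<in>UNIV. sqrt (norm (chirp_parameter (\<mu> j)) / (pi * (1 + (exp (2 * s j))\<^sup>2))))"
    proof (rule prod.cong[OF refl])
      fix j
      define A where "A = pi * (1 + (exp (2 * s j))\<^sup>2)"
      define G where "G = norm (chirp_parameter (\<mu> j))"
      have A: "A > 0" unfolding A_def by (intro mult_pos_pos add_pos_nonneg) auto
      have "Re (chirp_parameter (\<mu> j)) = 1" unfolding chirp_parameter_def by simp
      then have G: "G > 0" unfolding G_def by auto
      have e: "complex_of_real pi * (1 + (of_real (exp (2 * s j)))\<^sup>2) = of_real A" unfolding A_def by simp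
      have "norm (c j) = inverse (sqrt A * sqrt (pi / G))"
        unfolding c_def e norm_inverse norm_mult norm_csqrt norm_of_real norm_divide G_def[symmetric] using A by simp
      also have "\<dots> * sqrt pi = sqrt (G / A)"
        using A G by (simp add: real_sqrt_divide field_simps)
      finally show "norm (c j) * sqrt pi = sqrt (norm (chirp_parameter (\<mu> j)) / (pi * (1 + (exp (2 * s j))\<^sup>2)))"
        unfolding A_def G_def .
    qed
    finally show ?thesis .
  qed
  finally show "norm (LINT q|?Q. f (fst q) * cnj (f (snd q)) * rotated_mehler_vec (\<lambda>j. of_real (exp (2 * s j))) (fst q) (snd q))
     \<le> (\<Prod>j\<in>UNIV. sqrt (norm (chirp_parameter (\<mu> j)) / (pi * (1 + (exp (2 * s j))\<^sup>2))))
        * (LINT q|?Q. norm (f (fst q)) * norm (f (snd q)) * exp (a * (fst q \<bullet> snd q)))" unfolding L_def .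
qed

section \<open>Decay of the Hermite coefficients\<close>

lemma sinh_lower_bound:
  fixes x :: real
  assumes "0 \<le> x" "x \<le> 2"
  shows "2 / 3 * x \<le> sinh x"
proof -
  have e: "1 + x \<le> exp x" by (rule exp_ge_add_one_self)
  have "exp (- x) = 1 / exp x" by (simp add: exp_minus inverse_eq_divide)
  also have "\<dots> \<le> 1 / (1 + x)" using e assms by (intro divide_left_mono) auto
  finally have e': "exp (- x) \<le> 1 / (1 + x)" .
  have "0 \<le> x * (2 - x)" using assms by simp
  then have "4 / 3 * x \<le> (1 + x) - 1 / (1 + x)"
    using assms by (simp add: field_simps)
  with e e' have "4 / 3 * x \<le> exp x - exp (- x)" by linarith
  then show ?thesis unfolding sinh_field_def by simp
qed

text \<open>
  In the application \<open>m = 2\<alpha>\<^sub>j + 1\<close>, and \<open>m \<tau> = 1 / 4\<close> bounds the loss that \<open>s < t\<^sub>1\<close> causes in \<open>exp (m s)\<close>. By the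
  subtraction formula for \<open>sinh\<close>, the choice of \<open>\<mu>\<close> is the one for which \<open>tanh (2s) + \<mu> / cosh (2s)\<close> equals
  \<open>tanh (2 t\<^sub>1)\<close>. Since \<open>\<mu>\<close> is of order \<open>1 / (m cosh (2s))\<close>, the factor is of order
  \<open>\<surd>m exp (- s)\<close>.
\<close>

lemma chirp_factor_bound:
  fixes m t1 :: real
  assumes m: "m \<ge> 1" and t1: "t1 > 0"
  defines "\<tau> \<equiv> 1 / (4 * m)"
  defines "s \<equiv> t1 - \<tau>"
  defines "\<mu> \<equiv> sinh (2 * \<tau>) / cosh (2 * t1)"
  shows "\<mu> > 0" and "exp (2 * s) * \<mu> \<le> 1" and "tanh (2 * s) + \<mu> / cosh (2 * s) = tanh (2 * t1)"
    and "sqrt (norm (chirp_parameter \<mu>) / (pi * (1 + (exp (2 * s))\<^sup>2))) \<le> exp (- s) * m powr (1 / 2)"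
proof -
  have \<tau>: "\<tau> > 0" "2 * \<tau> \<le> 1 / 2" unfolding \<tau>_def using m by (simp_all add: field_simps)
  have ts: "t1 = s + \<tau>" unfolding s_def by simp
  have c1: "cosh (2 * t1) > 0" and c2: "cosh (2 * s) > 0" by simp_all
  show \<mu>: "\<mu> > 0" unfolding \<mu>_def using \<tau> c1 by simp
  \<comment> \<open>The left-hand side is (exp (2 s + 2 tau) - exp (2 s - 2 tau)) / 2, and 2 s + 2 tau = 2 t1.\<close>
  have "exp (2 * s) * sinh (2 * \<tau>) \<le> cosh (2 * t1)"
  proof -
    have "exp (2 * s) * sinh (2 * \<tau>) = (exp (2 * s + 2 * \<tau>) - exp (2 * s - 2 * \<tau>)) / 2"
    proof -
      have "exp (2 * s) * exp (2 * \<tau>) = exp (2 * s + 2 * \<tau>)" "exp (2 * s) * exp (- (2 * \<tau>)) = exp (2 * s - 2 * \<tau>)"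
        unfolding exp_add[symmetric] by simp_all
      then show ?thesis unfolding sinh_field_def by (simp only: times_divide_eq_right right_diff_distrib)
    qed
    also have "\<dots> \<le> (exp (2 * s + 2 * \<tau>) + exp (- (2 * s + 2 * \<tau>))) / 2"
    proof -
      have "(u - w) / 2 \<le> (u + z) / 2" if "w > 0" "z > 0" for u w z :: real using that by simp
      then show ?thesis using exp_gt_zero by blast
    qed
    also have "\<dots> = cosh (2 * t1)" unfolding cosh_field_def ts by (simp add: algebra_simps)
    finally show ?thesis .
  qed
  then show "exp (2 * s) * \<mu> \<le> 1" unfolding \<mu>_def using c1 by (simp add: divide_le_eq)
  show "tanh (2 * s) + \<mu> / cosh (2 * s) = tanh (2 * t1)"
  proof -
    have "sinh (2 * \<tau>) = sinh (2 * t1 - 2 * s)" unfolding ts by (simp add: algebra_simps)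
    also have "\<dots> = sinh (2 * t1) * cosh (2 * s) - cosh (2 * t1) * sinh (2 * s)" by (rule sinh_diff)
    finally have "sinh (2 * s) * cosh (2 * t1) + sinh (2 * \<tau>) = sinh (2 * t1) * cosh (2 * s)" by (simp add: mult.commute)
    moreover have "S / c + w / d / c = T / d" if "S * d + w = T * c" "c \<noteq> 0" "d \<noteq> 0" for S c w d T :: real
      using that by (simp add: field_simps)
    ultimately show ?thesis unfolding tanh_def \<mu>_def using c1 c2 by simp
  qed
  have ehalf: "exp (1/2 :: real) \<le> 2"
  proof -
    have "(exp (1/2 :: real))\<^sup>2 = exp 1" by (simp add: power2_eq_square flip: exp_add)
    also have "\<dots> \<le> 2\<^sup>2" using exp_le by simp
    finally show ?thesis by (rule power2_le_imp_le) simp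
  qed
  have "exp (2 * \<tau>) \<le> exp (1/2)" using \<tau> by simp
  then have e2: "exp (2 * \<tau>) \<le> 2" using ehalf by (rule order_trans)
  have "sinh (2 * \<tau>) \<le> 1"
  proof -
    have "(u - w) / 2 \<le> 1" if "u \<le> 2" "w > 0" for u w :: real using that by simp
    then show ?thesis unfolding sinh_field_def using e2 exp_gt_zero by blast
  qed
  also have "1 \<le> cosh (2 * t1)" by (rule cosh_real_ge_1)
  finally have "\<mu> \<le> 1" unfolding \<mu>_def using c1 by simp
  then have "norm (chirp_parameter \<mu>) \<le> 1 / \<mu>"
  proof -
    have "\<mu> \<le> 1 / \<mu>" using \<mu> \<open>\<mu> \<le> 1\<close> by (simp add: field_simps mult_le_one)
    then show ?thesis unfolding norm_chirp_parameter[OF \<mu>] by simp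
  qed
  also have "1 / \<mu> = cosh (2 * t1) / sinh (2 * \<tau>)" unfolding \<mu>_def by simp
  also have "\<dots> \<le> (2 * cosh (2 * s)) / (1 / (3 * m))"
  proof (rule frac_le)
    have "cosh (2 * t1) = (exp (2 * \<tau>) * exp (2 * s) + exp (- (2 * \<tau>)) * exp (- (2 * s))) / 2"
      unfolding cosh_field_def ts by (simp add: exp_add[symmetric] algebra_simps)
    also have "\<dots> \<le> (2 * exp (2 * s) + 2 * exp (- (2 * s))) / 2"
    proof -
      have "exp (- (2 * \<tau>)) \<le> exp 0" using \<tau>(1) unfolding exp_le_cancel_iff by simp
      then have "exp (- (2 * \<tau>)) \<le> 2" unfolding exp_zero by linarith
      then have "exp (- (2 * \<tau>)) * exp (- (2 * s)) \<le> 2 * exp (- (2 * s))" by (rule mult_right_mono) (rule exp_ge_zero)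
      moreover have "exp (2 * \<tau>) * exp (2 * s) \<le> 2 * exp (2 * s)" using e2 by (intro mult_right_mono) auto
      ultimately show ?thesis by (intro divide_right_mono add_mono) auto
    qed
    also have "\<dots> = 2 * cosh (2 * s)" unfolding cosh_field_def by simp
    finally show "cosh (2 * t1) \<le> 2 * cosh (2 * s)" .
    have "1 / (3 * m) = 2 / 3 * (2 * \<tau>)" unfolding \<tau>_def by simp
    also have "\<dots> \<le> sinh (2 * \<tau>)" using \<tau> by (intro sinh_lower_bound) auto
    finally show "1 / (3 * m) \<le> sinh (2 * \<tau>)" .
  qed (use m c2 in auto)
  finally have n: "norm (chirp_parameter \<mu>) \<le> 6 * m * cosh (2 * s)" by (simp add: mult_ac)
  have r: "1 + (exp (2 * s))\<^sup>2 = 2 * exp (2 * s) * cosh (2 * s)"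
  proof -
    have "1 + E\<^sup>2 = 2 * E * ((E + inverse E) / 2)" if "E > 0" for E :: real
      using that by (simp add: power2_eq_square field_simps)
    then show ?thesis unfolding cosh_field_def exp_minus using exp_gt_zero by blast
  qed
  have "norm (chirp_parameter \<mu>) / (pi * (1 + (exp (2 * s))\<^sup>2)) \<le> 6 * m * cosh (2 * s) / (3 * (2 * exp (2 * s) * cosh (2 * s)))"
    unfolding r using n pi_gt3 m c2 by (intro frac_le mult_right_mono) auto
  also have "\<dots> = m * exp (- (2 * s))" using c2 by (simp add: exp_minus field_simps)
  also have "\<dots> = (exp (- s) * m powr (1 / 2))\<^sup>2"
  proof -
    have "(exp (- s))\<^sup>2 = exp (- (2 * s))" by (simp add: power2_eq_square flip: exp_add)
    moreover have "(m powr (1 / 2))\<^sup>2 = m" using m by (simp add: powr_half_sqrt)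
    ultimately show ?thesis unfolding power_mult_distrib by simp
  qed
  finally have "sqrt (norm (chirp_parameter \<mu>) / (pi * (1 + (exp (2 * s))\<^sup>2))) \<le> sqrt ((exp (- s) * m powr (1 / 2))\<^sup>2)"
    by (rule real_sqrt_le_mono)
  then show "sqrt (norm (chirp_parameter \<mu>) / (pi * (1 + (exp (2 * s))\<^sup>2))) \<le> exp (- s) * m powr (1 / 2)" by simp
qed

lemma K_int_eigenfunction:
  fixes f fhat :: "real ^ 'n::finite \<Rightarrow> complex"
  assumes f': "f' \<in> borel_measurable borel" "AE x in lborel. f x = f' x" and fhat: "AE x in lborel. fhat x = c * f x"
  shows "K_int a f fhat = ennreal (norm c) *
     (\<integral>\<^sup>+x. (\<integral>\<^sup>+y. ennreal (norm (f' x) * norm (f' y) * exp (a * \<bar>x \<bullet> y\<bar>)) \<partial>lborel) \<partial>lborel)"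
proof -
  note [measurable] = f'(1)
  let ?k = "\<lambda>x y. ennreal (norm (f' x) * norm (f' y) * exp (a * \<bar>x \<bullet> y\<bar>))"
  have inner: "(\<integral>\<^sup>+y. ennreal (norm (f x) * norm (fhat y) * exp (a * \<bar>x \<bullet> y\<bar>)) \<partial>lborel) = ennreal (norm c) * (\<integral>\<^sup>+y. ?k x y \<partial>lborel)"
    if fx: "f x = f' x" for x
  proof -
    have "(\<integral>\<^sup>+y. ennreal (norm (f x) * norm (fhat y) * exp (a * \<bar>x \<bullet> y\<bar>)) \<partial>lborel) = (\<integral>\<^sup>+y. ennreal (norm c) * ?k x y \<partial>lborel)"
    proof (rule nn_integral_cong_AE)
      show "AE y in lborel. ennreal (norm (f x) * norm (fhat y) * exp (a * \<bar>x \<bullet> y\<bar>)) = ennreal (norm c) * ?k x y"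
        using fhat f'(2)
        by eventually_elim (simp add: fx norm_mult ennreal_mult[symmetric] mult_ac)
    qed
    also have "\<dots> = ennreal (norm c) * (\<integral>\<^sup>+y. ?k x y \<partial>lborel)" by (rule nn_integral_cmult) measurable
    finally show ?thesis .
  qed
  have "K_int a f fhat = (\<integral>\<^sup>+x. ennreal (norm c) * (\<integral>\<^sup>+y. ?k x y \<partial>lborel) \<partial>lborel)"
    unfolding K_int_def nn_integral_completion
    by (rule nn_integral_cong_AE) (use f'(2) in eventually_elim, rule inner)
  also have "\<dots> = ennreal (norm c) * (\<integral>\<^sup>+x. (\<integral>\<^sup>+y. ?k x y \<partial>lborel) \<partial>lborel)"
  proof (rule nn_integral_cmult)
    have "(\<lambda>x. \<integral>\<^sup>+y. (\<lambda>(x, y). ?k x y) (x, y) \<partial>lborel) \<in> borel_measurable lborel"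
      by (rule sigma_finite_measure.borel_measurable_nn_integral_fst) (auto simp: sigma_finite_lborel case_prod_unfold)
    then show "(\<lambda>x. \<integral>\<^sup>+y. ?k x y \<partial>lborel) \<in> borel_measurable lborel" by simp
  qed
  finally show ?thesis .
qed

text \<open>
  The sum of the nonnegative terms of the identity for weights \<open>1/4\<close> is zero.
\<close>

lemma hermite_coeff_zero_of_fourier_zero:
  fixes f :: "real ^ 'n::finite \<Rightarrow> complex"
  assumes ff: "has_fourier_L2 f (\<lambda>x. 0 * f x)"
  shows "hermite_coeff f \<alpha> = 0"
proof -
  have fm: "f \<in> borel_measurable lebesgue" using ff unfolding has_fourier_L2_def L2_def by auto
  obtain f' where f': "f' \<in> borel_measurable borel" "AE x in lborel. f x = f' x" by (rule borel_representative[OF fm])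
  let ?b = "\<lambda>\<alpha>. (\<Prod>j\<in>UNIV. (1/4) ^ \<alpha> j) * (norm (hermite_coeff f \<alpha>))\<^sup>2"
  have "((\<lambda>\<alpha>. complex_of_real (?b \<alpha>)) has_sum complex_of_real 0) UNIV"
    using small_weight_identity[OF ff f', of "\<lambda>_. 1/4"] by simp
  then have hs: "(?b has_sum 0) UNIV" by (simp only: has_sum_of_real_iff)
  have b0: "0 \<le> ?b \<beta>" for \<beta> by (intro mult_nonneg_nonneg prod_nonneg) auto
  have "(\<Sum>\<beta>\<in>{\<alpha>}. ?b \<beta>) \<le> 0" using b0 by (intro finite_sum_le_has_sum[OF hs]) auto
  then have "?b \<alpha> = 0" using b0[of \<alpha>] by simp
  then show ?thesis by simp
qed

theorem theorem2p10:
  fixes f fhat :: "real ^ 'n \<Rightarrow> complex"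
  assumes "CARD('n) \<ge> 2"
    and "f \<in> L2"
    and "O_finite f"
    and "fourier_eigenfunction f"
    and "has_fourier_L2 f fhat"
  shows "\<exists>C>0. \<forall>a. 0 < a \<and> a < 1 \<and> K_int a f fhat < \<infinity> \<longrightarrow>
           (\<forall>\<alpha> t. t > 0 \<and> a = tanh (2 * t) \<longrightarrow>
              norm (hermite_coeff f \<alpha>)
                \<le> C * sqrt (enn2real (K_int a f fhat))
                    * (\<Prod>j\<in>UNIV. (2 * real (\<alpha> j) + 1) powr (1 / 4))
                    * exp (- (2 * real (\<Sum>j\<in>UNIV. \<alpha> j) + real CARD('n)) * t / 2))"
proof (intro exI[of _ "exp (real CARD('n))"] conjI allI impI)
  \<comment> \<open>The square of this constant absorbs a factor exp (1/4) for every coordinate, from tau, and a factor e from replacing t by t1.\<close>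
  show "0 < exp (real CARD('n))" by simp
  fix a t :: real and \<alpha> :: "'n \<Rightarrow> nat"
  assume "0 < a \<and> a < 1 \<and> K_int a f fhat < \<infinity>" and "t > 0 \<and> a = tanh (2 * t)"
  then have a: "0 < a" "a < 1" and K: "K_int a f fhat < \<infinity>" and t: "t > 0" "a = tanh (2 * t)" by auto
  obtain c where ff: "has_fourier_L2 f (\<lambda>x. c * f x)"
    using assms(4) unfolding fourier_eigenfunction_def by blast
  have fm: "f \<in> borel_measurable lebesgue" using assms(2) unfolding L2_def by auto
  obtain f' where f': "f' \<in> borel_measurable borel" "AE x in lborel. f x = f' x" by (rule borel_representative[OF fm])
  note [measurable] = f'(1)
  let ?L = "\<integral>\<^sup>+x. (\<integral>\<^sup>+y. ennreal (norm (f' x) * norm (f' y) * exp (a * \<bar>x \<bullet> y\<bar>)) \<partial>lborel) \<partial>lborel"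
  have KL: "K_int a f fhat = ennreal (norm c) * ?L"
    by (rule K_int_eigenfunction[OF f' has_fourier_L2_unique[OF assms(5) ff]])
  let ?m = "\<lambda>j. 2 * real (\<alpha> j) + 1"
  define N where "N = 2 * real (\<Sum>j\<in>UNIV. \<alpha> j) + real CARD('n)"
  have n1: "real CARD('n) \<ge> 1" using assms(1) by simp
  have Nm: "N = (\<Sum>j\<in>UNIV. ?m j)" unfolding N_def by (simp add: sum.distrib sum_distrib_left)
  have "0 \<le> 2 * real (\<Sum>j\<in>UNIV. \<alpha> j)" by (intro mult_nonneg_nonneg of_nat_0_le_iff) simp
  then have N: "N > 0" unfolding N_def using n1 by linarith
  let ?K = "enn2real (K_int a f fhat)"
  show "norm (hermite_coeff f \<alpha>) \<le> exp (real CARD('n)) * sqrt ?K * (\<Prod>j\<in>UNIV. ?m j powr (1 / 4))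
      * exp (- (2 * real (\<Sum>j\<in>UNIV. \<alpha> j) + real CARD('n)) * t / 2)"
  proof (cases "c = 0")
    case True
    have "hermite_coeff f \<alpha> = 0" by (rule hermite_coeff_zero_of_fourier_zero) (use ff True in simp)
    moreover have "0 \<le> (\<Prod>j\<in>UNIV. ?m j powr (1 / 4))" by (intro prod_nonneg) simp
    ultimately show ?thesis by simp
  next
    case False
    then have Lfin: "?L < \<infinity>" using K unfolding KL by (auto simp: ennreal_mult_less_top)
    \<comment> \<open>Passing from t to t1 < t leaves room for a1 = tanh (2 t1) < a, and costs at most the factor e in the square of the bound, uniformly in the multi-index.\<close>
    define t1 where "t1 = max (t / 2) (t - 1 / N)"
    have t1: "t1 > 0" "t1 < t" "N * (t - t1) \<le> 1"
    proof -
      show "t1 > 0" "t1 < t" unfolding t1_def using t N by auto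
      have "t - t1 \<le> 1 / N" unfolding t1_def by simp
      then have "N * (t - t1) \<le> N * (1 / N)" using N by (intro mult_left_mono) auto
      then show "N * (t - t1) \<le> 1" using N by simp
    qed
    define a1 where "a1 = tanh (2 * t1)"
    have a1: "0 < a1" "a1 < a" unfolding a1_def t(2) using t1 by simp_all
    define \<tau> where "\<tau> j = 1 / (4 * ?m j)" for j
    define s where "s j = t1 - \<tau> j" for j
    define \<mu> where "\<mu> j = sinh (2 * \<tau> j) / cosh (2 * t1)" for j
    have m1: "?m j \<ge> 1" for j by simp
    note cb = chirp_factor_bound[OF m1 t1(1), folded \<tau>_def, folded s_def \<mu>_def a1_def]
    have wg: "integrable lborel (\<lambda>x. norm (f' x) * exp (a1 / 2 * (x \<bullet> x)))"
      by (rule weighted_integrable_of_double_integral[OF f'(1) a1 Lfin])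
    have sa: "tanh (2 * s j) < a1" for j
    proof -
      have "0 < \<mu> j / cosh (2 * s j)" using cb(1)[of j] by simp
      then show ?thesis using cb(3)[of j] by linarith
    qed
    define L' where "L' = (LINT q|(lborel \<Otimes>\<^sub>M lborel). norm (f' (fst q)) * norm (f' (snd q)) * exp (a1 * (fst q \<bullet> snd q)))"
    note fb = rotated_form_bound[OF f'(1) wg cb(1) cb(2) a1(1) cb(3), folded L'_def]
    have L'0: "0 \<le> L'" unfolding L'_def by (intro Bochner_Integration.integral_nonneg) simp
    have "ennreal L' = (\<integral>\<^sup>+q. ennreal (norm (f' (fst q)) * norm (f' (snd q)) * exp (a1 * (fst q \<bullet> snd q))) \<partial>(lborel \<Otimes>\<^sub>M lborel))"
      unfolding L'_def by (rule nn_integral_eq_integral[symmetric, OF fb(1)]) simp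
    also have "\<dots> = (\<integral>\<^sup>+x. (\<integral>\<^sup>+y. ennreal (norm (f' x) * norm (f' y) * exp (a1 * (x \<bullet> y))) \<partial>lborel) \<partial>lborel)"
      by (subst lborel.nn_integral_fst[symmetric]) simp_all
    also have "\<dots> \<le> ?L"
    proof (intro nn_integral_mono ennreal_leI mult_left_mono)
      fix x y :: "real ^ 'n"
      have "a1 * (x \<bullet> y) \<le> a1 * \<bar>x \<bullet> y\<bar>" using a1 by (intro mult_left_mono) auto
      also have "\<dots> \<le> a * \<bar>x \<bullet> y\<bar>" using a1 by (intro mult_right_mono) auto
      finally show "exp (a1 * (x \<bullet> y)) \<le> exp (a * \<bar>x \<bullet> y\<bar>)" by simp
    qed simp
    finally have "ennreal (norm c * L') \<le> K_int a f fhat" unfolding KL using L'0 by (simp add: ennreal_mult mult_left_mono)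
    then have cL: "norm c * L' \<le> ?K"
      using enn2real_mono[of "ennreal (norm c * L')" "K_int a f fhat"] K L'0 by simp
    let ?p = "\<Prod>j\<in>UNIV. exp (2 * s j) ^ \<alpha> j"
    let ?q = "\<Prod>j\<in>UNIV. exp (- s j) * ?m j powr (1 / 2)"
    have p0: "?p > 0" by (intro prod_pos) simp
    have q0: "?q \<ge> 0" by (intro prod_nonneg) simp
    have "?p * (norm (hermite_coeff f \<alpha>))\<^sup>2 \<le> norm c * norm (LINT q|(lborel \<Otimes>\<^sub>M lborel). f' (fst q) * cnj (f' (snd q)) *
        rotated_mehler_vec (\<lambda>j. of_real (exp (2 * s j))) (fst q) (snd q))"
      by (rule weighted_hermite_coeff_le_form[OF ff f' wg sa])
    also have "\<dots> \<le> norm c * ((\<Prod>j\<in>UNIV. sqrt (norm (chirp_parameter (\<mu> j)) / (pi * (1 + (exp (2 * s j))\<^sup>2)))) * L')"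
      by (intro mult_left_mono fb(2)) simp
    also have "\<dots> \<le> norm c * (?q * L')"
      by (intro mult_left_mono mult_right_mono prod_mono conjI cb(4) L'0) (auto intro!: divide_nonneg_nonneg mult_nonneg_nonneg add_nonneg_nonneg)
    also have "\<dots> = ?q * (norm c * L')" by simp
    also have "\<dots> \<le> ?q * ?K" by (intro mult_left_mono cL q0)
    finally have main: "?p * (norm (hermite_coeff f \<alpha>))\<^sup>2 \<le> ?q * ?K" .
    define M where "M = (\<Prod>j\<in>UNIV. ?m j powr (1 / 2))"
    have M0: "M \<ge> 0" unfolding M_def by (intro prod_nonneg) simp
    have qp: "?q = ?p * (exp (real CARD('n) / 4 - N * t1) * M)"
    proof -
      have "exp (- s j) * ?m j powr (1 / 2) = exp (2 * s j) ^ \<alpha> j * (exp (1 / 4 - ?m j * t1) * ?m j powr (1 / 2))" for j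
      proof -
        have "?m j * \<tau> j = 1 / 4" unfolding \<tau>_def by simp
        then have "?m j * s j = ?m j * t1 - 1 / 4" unfolding s_def by (simp only: right_diff_distrib)
        then have "- s j = real (\<alpha> j) * (2 * s j) + (1 / 4 - ?m j * t1)" by (simp add: algebra_simps)
        then have "exp (- s j) = exp (2 * s j) ^ \<alpha> j * exp (1 / 4 - ?m j * t1)"
          by (simp only: exp_add exp_of_nat_mult)
        then show ?thesis by simp
      qed
      then have "?q = ?p * ((\<Prod>j\<in>UNIV. exp (1 / 4 - ?m j * t1)) * M)" unfolding M_def by (simp add: prod.distrib)
      also have "(\<Prod>j\<in>(UNIV::'n set). exp (1 / 4 - ?m j * t1)) = exp (real CARD('n) / 4 - N * t1)"
        unfolding exp_sum[OF finite, symmetric] Nm sum_distrib_right sum_subtractf by simp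
      finally show ?thesis .
    qed
    have "(norm (hermite_coeff f \<alpha>))\<^sup>2 \<le> exp (real CARD('n) / 4 - N * t1) * M * ?K"
    proof -
      have "?p * (norm (hermite_coeff f \<alpha>))\<^sup>2 \<le> ?p * (exp (real CARD('n) / 4 - N * t1) * M * ?K)"
        using main unfolding qp by (simp only: mult.assoc)
      then show ?thesis using p0 by (simp only: mult_le_cancel_left_pos)
    qed
    also have "\<dots> \<le> exp (2 * real CARD('n) - N * t) * M * ?K"
    proof (intro mult_right_mono M0)
      have "N * t - N * t1 \<le> 1" using t1(3) by (simp add: right_diff_distrib)
      then show "exp (real CARD('n) / 4 - N * t1) \<le> exp (2 * real CARD('n) - N * t)" unfolding exp_le_cancel_iff using n1 by linarith
    qed simp
    also have "\<dots> = (exp (real CARD('n)) * sqrt ?K * (\<Prod>j\<in>UNIV. ?m j powr (1 / 4)) * exp (- N * t / 2))\<^sup>2"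
    proof -
      have "(\<Prod>j\<in>UNIV. ?m j powr (1 / 4))\<^sup>2 = M"
        unfolding M_def prod_power_distrib by (simp add: power2_eq_square flip: powr_add)
      moreover have "(exp (real CARD('n)))\<^sup>2 * (exp (- N * t / 2))\<^sup>2 = exp (2 * real CARD('n) - N * t)"
        unfolding power2_eq_square exp_add[symmetric] by (simp add: algebra_simps)
      moreover have "(sqrt ?K)\<^sup>2 = ?K" by simp
      ultimately show ?thesis unfolding power_mult_distrib by (simp add: mult_ac)
    qed
    finally have "norm (hermite_coeff f \<alpha>) \<le> exp (real CARD('n)) * sqrt ?K * (\<Prod>j\<in>UNIV. ?m j powr (1 / 4)) * exp (- N * t / 2)"
      by (rule power2_le_imp_le) (intro mult_nonneg_nonneg prod_nonneg; simp)
    then show ?thesis unfolding N_def by simp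
  qed
qed

end
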